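(* Fix integers $n \geq 2$ and $k \geq 2$. Fix $s < \frac{1}{4} + \frac{n-1}{4((k-1)n+1)}$. There exist a constant $C>1$, a sequence of real numbers $R_j \to \infty$ as $j \to \infty$, and a sequence of functions $f_j \in L^2(\mathbb{R}^n)$ such that $\|f_j \|_{L^2(\mathbb{R}^n)} =1$ and $\hat{f_j}$ is supported in the annulus $\{\xi \in \mathbb{R}^n : (1/C)R_j \leq |\xi| \leq CR_j\}$ for each $j$, with the property that $$\lim_{j \to \infty} R_j^{-s} \Big\| \sup_{0<t<1} |T_t^{(P_k)} f_j| \, \Big\|_{L^1(B_n(0,1))} = \infty.$$
   Context: For $\xi \in \mathbb{R}^n$ let $P_k(\xi) = \xi_1^k + \cdots + \xi_n^k$. For $t \in \mathbb{R}$ define $$T_t^{(P_k)}f(x)=\frac{1}{(2\pi)^n} \int_{\mathbb{R}^n} \hat{f}(\xi)e^{i(\xi \cdot x+P_k(\xi)t)}\, d\xi, \qquad \hat f(\xi) = \int_{\mathbb{R}^n} f(x) e^{-ix\cdot \xi}\,dx.$$ $B_n(0,1)$ is the Euclidean unit ball centered at the origin in $\mathbb{R}^n$. *)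

theory Defs
  imports "HOL-Analysis.Analysis"
begin

definition square_integrable :: "('a::euclidean_space \<Rightarrow> complex) \<Rightarrow> bool" where
  "square_integrable f \<longleftrightarrow>
     f \<in> borel_measurable lborel \<and> integrable lborel (\<lambda>x. (norm (f x))\<^sup>2)"

definition norm_L2 :: "('a::euclidean_space \<Rightarrow> complex) \<Rightarrow> real" where
  "norm_L2 f = sqrt (LINT x|lborel. (norm (f x))\<^sup>2)"

definition fourier_integral :: "('a::euclidean_space \<Rightarrow> complex) \<Rightarrow> 'a \<Rightarrow> complex" where
  "fourier_integral f \<xi> = (LINT x|lborel. f x * cis (- (x \<bullet> \<xi>)))"

text \<open>
  The integral defining the Fourier transform converges only for integrable functions. For other
  square integrable functions the transform is, by Plancherel's theorem, the limit in the mean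
  of the transforms of the truncations to balls; it is determined almost everywhere, and a
  representative is chosen.
\<close>

definition has_L2_fourier ::
  "('a::euclidean_space \<Rightarrow> complex) \<Rightarrow> ('a \<Rightarrow> complex) \<Rightarrow> bool" where
  "has_L2_fourier f g \<longleftrightarrow> square_integrable g \<and>
     (\<lambda>N::nat. norm_L2 (\<lambda>\<xi>. fourier_integral
        (\<lambda>x. indicator (cball 0 (real N)) x * f x) \<xi> - g \<xi>)) \<longlonglongrightarrow> 0"

definition fourier :: "('a::euclidean_space \<Rightarrow> complex) \<Rightarrow> 'a \<Rightarrow> complex" where
  "fourier f = (if integrable lborel f then fourier_integral f else (SOME g. has_L2_fourier f g))"

definition power_symbol :: "nat \<Rightarrow> real ^ 'n \<Rightarrow> real" where
  "power_symbol k \<xi> = (\<Sum>i\<in>UNIV. (\<xi> $ i) ^ k)"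

definition propagator ::
  "(real ^ 'n \<Rightarrow> real) \<Rightarrow> real \<Rightarrow> (real ^ 'n \<Rightarrow> complex) \<Rightarrow> real ^ 'n \<Rightarrow> complex" where
  "propagator P t f x =
     1 / of_real ((2 * pi) ^ CARD('n)) *
     (LINT \<xi>|lborel. fourier f \<xi> * cis (\<xi> \<bullet> x + P \<xi> * t))"

text \<open>
  The supremum is taken in the extended nonnegative reals, so that neither it nor the integral
  in the norm below depends on a boundedness or integrability side condition.
\<close>

definition maximal_function ::
  "(real ^ 'n \<Rightarrow> real) \<Rightarrow> (real ^ 'n \<Rightarrow> complex) \<Rightarrow> real ^ 'n \<Rightarrow> ennreal" where
  "maximal_function P f x = (SUP t\<in>{0<..<1}. ennreal (norm (propagator P t f x)))"

definition norm_L1_on :: "'a::euclidean_space set \<Rightarrow> ('a \<Rightarrow> ennreal) \<Rightarrow> ennreal" where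
  "norm_L1_on A h = (\<integral>\<^sup>+ x \<in> A. h x \<partial>lborel)"

end

theory Submission
  imports Defs "HOL-Probability.Sinc_Integral" "HOL-Number_Theory.Cong"
    "HOL-Computational_Algebra.Squarefree"
begin

text \<open>
  Write \<open>d = n - 1\<close>. The symbol \<open>P\<^sub>k\<close> is a sum of functions of one variable, so the evolution of a
  product \<open>\<Prod>i. g\<^sub>i (x\<^sub>i)\<close> is the product of one-dimensional evolutions. One distinguished
  coordinate carries a single packet with frequency \<open>R\<close> and bandwidth \<open>sqrt R\<close>. It stays large
  exactly where \<open>x + k R\<^sup>k\<^sup>-\<^sup>1 t\<close> is at most of order \<open>1 / sqrt R\<close>, so the distinguished coordinate of a
  point selects the times that are available to it; relative to its \<open>L\<^sup>2\<close> norm the packet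
  has height \<open>R\<^sup>1\<^sup>/\<^sup>4\<close>. Every other coordinate carries the frequencies \<open>L m\<close> with \<open>X \<le> m < 2 X\<close> and
  \<open>L = R / X\<close>. At \<open>t = 2 \<pi> A / (q L\<^sup>k)\<close> and \<open>x = 2 \<pi> B / (q L)\<close> the \<open>m\<close>-th phase is
  \<open>2 \<pi> (A m\<^sup>k + B m) / q\<close>, and the evolution is, up to small perturbations, a Weyl sum modulo \<open>q\<close>.
  For a prime \<open>q \<le> X\<close> this sum has size \<open>X / sqrt q\<close> for a positive proportion of \<open>A\<close> and \<open>B\<close>
  (\<open>many_large_weyl_sums\<close>), whereas the \<open>L\<^sup>2\<close> norm of the factor is only of order \<open>sqrt X\<close>. Each of the
  \<open>d\<close> coordinates therefore gains a factor \<open>sqrt (X / q)\<close> (\<open>focusing_packet\<close>).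

  It remains to see that such points are frequent. With primes \<open>q\<close> comparable to \<open>Q\<close> and
  \<open>sqrt R = X\<^sup>k / Q\<close>, the admissible distinguished coordinates for a single \<open>q\<close> fill a positive
  proportion of an interval, and each other coordinate may range over a set of measure of
  order \<open>Q / X\<close>. The sets that belong to different primes intersect at most as much as independent
  sets would (\<open>measure_comb_Int_le\<close>), so as long as the total measure, of order
  \<open>#primes * (Q / X)\<^sup>d\<close>, is small, it is attained up to a factor 2 by the union
  (\<open>measure_focus_boxes_ge\<close>). Taking \<open>Q = y\<^sup>d\<close> and \<open>X = H y\<^sup>n\<close> with a large constant \<open>H\<close> makes
  \<open>Q (Q / X)\<^sup>d\<close> a small constant. The loss is then only the density of the primes, at most
  \<open>Q\<^sup>\<epsilon>\<close> on infinitely many scales (\<open>frequently_many_primes\<close>), and the gain is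
  \<open>R\<^sup>1\<^sup>/\<^sup>4 (X / Q)\<^sup>d\<^sup>/\<^sup>2 = R\<^sup>1\<^sup>/\<^sup>4 (H y)\<^sup>d\<^sup>/\<^sup>2\<close> with \<open>R\<close> of order \<open>y\<close> to the power \<open>2 ((k - 1) n + 1)\<close>. This
  is \<open>R\<close> to the power \<open>1/4 + d / (4 ((k - 1) n + 1))\<close>.

  The size of the Weyl sums is a statement about most \<open>A\<close> and \<open>B\<close>, and it follows from their second
  and fourth moments over all \<open>A\<close> and \<open>B\<close>. These count solutions of congruences; the count for the
  fourth moment rests on the fact that a polynomial of degree at most \<open>k\<close> has at most \<open>k\<close> roots
  modulo a prime.
\<close>

section \<open>Additive characters and mean values\<close>

definition echar :: "nat \<Rightarrow> int \<Rightarrow> complex" where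
  "echar q h = cis (2 * pi * real_of_int h / real q)"

lemma echar_add: "echar q (a + b) = echar q a * echar q b"
  by (simp add: echar_def cis_mult add_divide_distrib ring_distribs)

lemma echar_minus: "echar q (- a) = cnj (echar q a)"
  by (simp add: echar_def cis_cnj)

lemma echar_power: "echar q h ^ n = echar q (int n * h)"
  by (induction n) (simp_all add: echar_add ring_distribs, simp add: echar_def)

lemma norm_echar [simp]: "norm (echar q h) = 1"
  by (simp add: echar_def)

lemma echar_eq_1_iff:
  assumes "q > 0"
  shows "echar q h = 1 \<longleftrightarrow> int q dvd h"
proof -
  have "echar q h = 1 \<longleftrightarrow> (\<exists>n::int. 2 * pi * real_of_int h / real q = of_int n * (2 * pi))"
    unfolding echar_def by (auto simp: complex_eq_iff cos_one_2pi_int mult_ac sin_zero_iff_int2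
        intro: exI[of _ "2 * _"])
  also have "\<dots> \<longleftrightarrow> (\<exists>n::int. real_of_int h = real_of_int (int q * n))"
    using assms by (auto simp: field_simps)
  also have "\<dots> \<longleftrightarrow> int q dvd h"
    unfolding of_int_eq_iff by (auto simp: dvd_def)
  finally show ?thesis .
qed

lemma sum_echar:
  assumes "q > 0" "q dvd N"
  shows "(\<Sum>A\<in>{1..N}. echar q (int A * h)) = (if int q dvd h then of_nat N else 0)"
proof (cases "int q dvd h")
  case True
  then have "echar q (int A * h) = 1" for A
    using echar_eq_1_iff[OF assms(1)] by simp
  then show ?thesis using True by simp
next
  case False
  let ?z = "echar q h"
  have z: "?z \<noteq> 1" using False echar_eq_1_iff[OF assms(1)] by simp
  have "int q dvd int N * h" using assms(2) by simp
  then have zN: "?z ^ N = 1" unfolding echar_power using echar_eq_1_iff[OF assms(1)] by simp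
  have "(\<Sum>A\<in>{1..N}. echar q (int A * h)) = (\<Sum>A\<in>{1..N}. ?z ^ A)"
    by (simp add: echar_power)
  also have "\<dots> = (\<Sum>A<N. ?z ^ Suc A)"
    by (rule sum.reindex_bij_witness[of _ Suc "\<lambda>x. x - 1"]) auto
  also have "\<dots> = ?z * (\<Sum>A<N. ?z ^ A)"
    by (simp add: sum_distrib_left)
  also have "\<dots> = 0" using z zN by (simp add: geometric_sum)
  finally show ?thesis using False by simp
qed

text \<open>
  Averaging over full periods of \<open>A\<close> and \<open>B\<close> keeps precisely the pairs on which \<open>u\<close> and \<open>v\<close> agree
  modulo \<open>q\<close>. For an abstract index set \<open>P\<close> the identity serves for second and fourth moments alike,
  because the square of a sum over \<open>I\<close> is a sum over \<open>P = I \<times> I\<close>.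
\<close>

lemma mean_square_echar_sum:
  fixes u v :: "'p \<Rightarrow> int"
  assumes P: "finite P" and q: "q > 0" "q dvd NA" "q dvd NB"
  shows "(\<Sum>A\<in>{1..NA}. \<Sum>B\<in>{1..NB}. (cmod (\<Sum>p\<in>P. echar q (int A * u p + int B * v p)))\<^sup>2)
    = real NA * real NB *
      real (card {(p, p') \<in> P \<times> P. int q dvd u p - u p' \<and> int q dvd v p - v p'})"
    (is "?L = ?R")
proof -
  let ?S = "\<lambda>A B. \<Sum>p\<in>P. echar q (int A * u p + int B * v p)"
  have sq: "of_real ((cmod (?S A B))\<^sup>2) =
      (\<Sum>(p, p')\<in>P \<times> P. echar q (int A * (u p - u p')) * echar q (int B * (v p - v p')))" for A B
  proof -
    have "of_real ((cmod (?S A B))\<^sup>2) = ?S A B * cnj (?S A B)"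
      by (rule complex_norm_square)
    also have "\<dots> = (\<Sum>p\<in>P. \<Sum>p'\<in>P. echar q (int A * u p + int B * v p)
        * cnj (echar q (int A * u p' + int B * v p')))"
      by (simp add: sum_product)
    also have "\<dots> = (\<Sum>p\<in>P. \<Sum>p'\<in>P. echar q (int A * (u p - u p')) * echar q (int B * (v p - v p')))"
      by (intro sum.cong refl) (simp flip: echar_add echar_minus add: algebra_simps)
    finally show ?thesis by (simp add: sum.cartesian_product)
  qed
  have "complex_of_real ?L = (\<Sum>A\<in>{1..NA}. \<Sum>B\<in>{1..NB}. \<Sum>(p, p')\<in>P \<times> P.
      echar q (int A * (u p - u p')) * echar q (int B * (v p - v p')))"
    by (simp flip: of_real_power add: sq del: of_real_power)
  also have "\<dots> = (\<Sum>A\<in>{1..NA}. \<Sum>(p, p')\<in>P \<times> P. \<Sum>B\<in>{1..NB}.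
      echar q (int A * (u p - u p')) * echar q (int B * (v p - v p')))"
    by (intro sum.cong refl, subst sum.swap) (simp add: case_prod_beta)
  also have "\<dots> = (\<Sum>(p, p')\<in>P \<times> P. \<Sum>A\<in>{1..NA}. \<Sum>B\<in>{1..NB}.
      echar q (int A * (u p - u p')) * echar q (int B * (v p - v p')))"
    by (subst sum.swap) (simp add: case_prod_beta)
  also have "\<dots> = (\<Sum>(p, p')\<in>P \<times> P.
      (if int q dvd u p - u p' then of_nat NA else 0) * (if int q dvd v p - v p' then of_nat NB else 0))"
    by (intro sum.cong refl)
       (simp only: case_prod_beta flip: sum_product sum_echar[OF q(1) q(2)] sum_echar[OF q(1) q(3)])
  also have "\<dots> = (\<Sum>x\<in>P \<times> P. if int q dvd u (fst x) - u (snd x) \<and> int q dvd v (fst x) - v (snd x)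
      then of_nat NA * of_nat NB else 0)"
    by (intro sum.cong refl) auto
  also have "\<dots> = of_nat NA * of_nat NB *
      of_nat (card {x \<in> P \<times> P. int q dvd u (fst x) - u (snd x) \<and> int q dvd v (fst x) - v (snd x)})"
    using P by (simp flip: sum.inter_filter)
  also have "{x \<in> P \<times> P. int q dvd u (fst x) - u (snd x) \<and> int q dvd v (fst x) - v (snd x)}
     = {(p, p') \<in> P \<times> P. int q dvd u p - u p' \<and> int q dvd v p - v p'}" by auto
  also have "of_nat NA * of_nat NB * of_nat (card \<dots>) = complex_of_real ?R" by simp
  finally show ?thesis unfolding of_real_eq_iff .
qed

text \<open>
  Lagrange's argument: a root \<open>r\<close> splits off the factor \<open>x - r\<close> up to a constant divisible by \<open>q\<close>, and
  every other root modulo \<open>q\<close> is a root of the cofactor because \<open>q\<close> is prime.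
\<close>

lemma card_roots_mod_prime_le_degree:
  fixes f :: "int poly" and q :: nat
  assumes "prime q" "\<exists>i. \<not> int q dvd coeff f i"
  shows "card {x \<in> {0..<q}. int q dvd poly f (int x)} \<le> degree f"
  using assms(2)
proof (induction "degree f" arbitrary: f rule: less_induct)
  case less
  show ?case
  proof (cases "\<exists>r\<in>{0..<q}. int q dvd poly f (int r)")
    case False
    then have "{x \<in> {0..<q}. int q dvd poly f (int x)} = {}" by auto
    then show ?thesis by (simp only: card.empty)
  next
    case True
    then obtain r where r: "r < q" "int q dvd poly f (int r)" by auto
    define g where "g = synthetic_div f (int r)"
    have eq: "f = g * [:- int r, 1:] + [:poly f (int r):]"
      using synthetic_div_correct'[of "int r" f] by (simp add: g_def mult.commute)
    have deg: "degree f \<noteq> 0"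
    proof
      assume "degree f = 0"
      then obtain c where "f = [:c:]" by (metis degree_eq_zeroE)
      moreover have "int q dvd coeff [:c:] i" for i using r(2) \<open>f = [:c:]\<close> by (cases i) auto
      ultimately show False using less.prems by auto
    qed
    have dg: "degree g < degree f" using deg by (simp add: g_def degree_synthetic_div)
    have ex: "\<exists>i. \<not> int q dvd coeff g i"
    proof (rule ccontr)
      assume "\<not> ?thesis"
      then have g: "int q dvd coeff g i" for i by auto
      have "int q dvd coeff f i" for i
      proof -
        have "f = smult (- int r) g + pCons 0 g + [:poly f (int r):]"
          using eq by (simp add: mult.commute)
        then have "coeff f i = coeff (smult (- int r) g + pCons 0 g + [:poly f (int r):]) i"
          by metis
        also have "int q dvd \<dots>" using g r
          by (cases i) (auto intro!: dvd_add)
        finally show ?thesis .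
      qed
      then show False using less.prems by auto
    qed
    have IH: "card {x \<in> {0..<q}. int q dvd poly g (int x)} \<le> degree g"
      by (rule less.hyps[OF dg ex])
    have sub: "{x \<in> {0..<q}. int q dvd poly f (int x)} \<subseteq> insert r {x \<in> {0..<q}. int q dvd poly g (int x)}"
    proof
      fix x assume x: "x \<in> {x \<in> {0..<q}. int q dvd poly f (int x)}"
      have "poly f (int x) = poly g (int x) * (int x - int r) + poly f (int r)"
        by (subst eq) (simp add: algebra_simps)
      then have "int q dvd poly g (int x) * (int x - int r)"
        using x r(2) by (simp add: dvd_add_left_iff)
      then have "int q dvd poly g (int x) \<or> int q dvd int x - int r"
        using assms(1) by (simp add: prime_dvd_mult_iff)
      moreover have "x = r" if "int q dvd int x - int r"
      proof -
        have "[x = r] (mod q)" using that by (simp add: cong_iff_dvd_diff flip: cong_int_iff)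
        then show ?thesis using x r(1) by (simp add: cong_def)
      qed
      ultimately show "x \<in> insert r {x \<in> {0..<q}. int q dvd poly g (int x)}" using x by auto
    qed
    have "card {x \<in> {0..<q}. int q dvd poly f (int x)} \<le> card (insert r {x \<in> {0..<q}. int q dvd poly g (int x)})"
      by (rule card_mono[OF _ sub]) simp
    also have "\<dots> \<le> Suc (degree g)" using IH by (simp add: card_insert_if)
    also have "\<dots> \<le> degree f" using dg by simp
    finally show ?thesis .
  qed
qed

text \<open>
  For odd \<open>k\<close> the terms of degree \<open>k\<close> cancel, so the leading coefficient cannot be used uniformly. The
  coefficient of \<open>x\<^sup>k\<^sup>-\<^sup>1\<close> is \<open>\<plusminus>k \<sigma>\<close> for either parity; it is a unit modulo \<open>q\<close> since \<open>k < q\<close>.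
\<close>

lemma card_power_sum_solutions:
  fixes q k :: nat and \<sigma> \<tau> :: int
  assumes q: "prime q" "k < q" and k: "k \<ge> 2" and \<sigma>: "\<not> int q dvd \<sigma>"
  shows "card {x \<in> {0..<q}. int q dvd int x ^ k + (\<sigma> - int x) ^ k - \<tau>} \<le> k"
proof -
  define f where "f = monom 1 k + [:\<sigma>, -1:] ^ k - [:\<tau>:]"
  have P: "poly f (int x) = int x ^ k + (\<sigma> - int x) ^ k - \<tau>" for x
    by (simp add: f_def poly_monom)
  have "degree f \<le> k" unfolding f_def
    by (intro degree_diff_le degree_add_le degree_monom_le order.trans[OF degree_power_le]) auto
  moreover have "coeff f (k - 1) = of_nat k * \<sigma> * (-1) ^ (k - 1)"
  proof -
    have "[:\<sigma>, -1:] ^ k = (monom (-1) 1 + [:\<sigma>:]) ^ k"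
      by (simp add: monom_altdef)
    also have "\<dots> = (\<Sum>i\<le>k. of_nat (k choose i) * monom (-1) 1 ^ i * [:\<sigma>:] ^ (k - i))"
      by (rule binomial_ring)
    also have "\<dots> = (\<Sum>i\<le>k. monom (of_nat (k choose i) * (-1) ^ i * \<sigma> ^ (k - i)) i)"
      by (intro sum.cong refl)
         (simp add: monom_power of_nat_poly poly_const_pow smult_monom mult_monom flip: monom_0)
    finally have e: "[:\<sigma>, -1:] ^ k = \<dots>" .
    have "coeff ([:\<sigma>, -1:] ^ k) (k - 1) =
        (\<Sum>i\<le>k. if i = k - 1 then of_nat (k choose i) * (-1) ^ i * \<sigma> ^ (k - i) else 0)"
      by (subst e) (simp add: coeff_sum)
    also have "\<dots> = of_nat (k choose (k - 1)) * (-1) ^ (k - 1) * \<sigma> ^ (k - (k - 1))"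
      by (simp add: sum.delta)
    finally have "coeff ([:\<sigma>, -1:] ^ k) (k - 1) = of_nat k * \<sigma> * (-1) ^ (k - 1)"
      using k binomial_symmetric[of "k-1" k] by simp
    moreover have "coeff (monom 1 k - [:\<tau>:]) (k - 1) = 0"
      using k by (cases "k - 1") auto
    ultimately show ?thesis unfolding f_def by simp
  qed
  moreover have "\<not> int q dvd of_nat k * \<sigma> * (-1) ^ (k - 1)"
  proof -
    have pr: "prime (int q)" using q by simp
    have "\<not> int q dvd int k" using q k by (auto dest: dvd_imp_le)
    moreover have "\<not> int q dvd (-1) ^ (k - 1)" using q k by (auto simp: minus_one_power_iff)
    ultimately show ?thesis using pr \<sigma> by (simp add: prime_dvd_mult_iff)
  qed
  ultimately have "\<exists>i. \<not> int q dvd coeff f i" by metis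
  from card_roots_mod_prime_le_degree[OF q(1) this] P \<open>degree f \<le> k\<close> show ?thesis by simp
qed

text \<open>
  The sum runs over \<open>r\<close> consecutive integers from \<open>X\<close> on. The length is kept as a parameter since
  summation by parts also involves the partial sums.
\<close>

definition weyl_sum :: "nat \<Rightarrow> nat \<Rightarrow> nat \<Rightarrow> nat \<Rightarrow> nat \<Rightarrow> nat \<Rightarrow> complex" where
  "weyl_sum k q A B X r = (\<Sum>m\<in>{X..<X + r}. echar q (int A * int m ^ k + int B * int m))"

definition large_weyl_pair :: "nat \<Rightarrow> nat \<Rightarrow> nat \<Rightarrow> real \<Rightarrow> nat \<Rightarrow> nat \<Rightarrow> bool" where
  "large_weyl_pair k q X T A B \<longleftrightarrow>
     real X / (2 * sqrt (real q)) \<le> cmod (weyl_sum k q A B X X) \<and>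
     (\<Sum>r\<in>{1..X}. cmod (weyl_sum k q A B X r)) \<le> T * (real X)\<^sup>2 / sqrt (real q)"

lemma card_residue_class_le:
  assumes "q > 0" "q \<le> X" "r \<le> X"
  shows "real (card {m \<in> {X..<X + r}. int q dvd int m - c}) \<le> 2 * real X / real q"
proof -
  have "card {m \<in> {X..<X + r}. int q dvd int m - c} \<le> card {..r div q}"
  proof (rule card_inj_on_le[where f = "\<lambda>m. (m - X) div q"])
    show "inj_on (\<lambda>m. (m - X) div q) {m \<in> {X..<X + r}. int q dvd int m - c}"
    proof (rule inj_onI)
      fix m m' assume m: "m \<in> {m \<in> {X..<X + r}. int q dvd int m - c}"
        and m': "m' \<in> {m \<in> {X..<X + r}. int q dvd int m - c}"
        and e: "(m - X) div q = (m' - X) div q"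
      have "int q dvd int m - c" "int q dvd int m' - c" using m m' by blast+
      then have "int q dvd (int m - c) - (int m' - c)" by (rule dvd_diff)
      also have "(int m - c) - (int m' - c) = int (m - X) - int (m' - X)" using m m' by auto
      finally have "(m - X) mod q = (m' - X) mod q"
        using cong_int_iff[of "m - X" "m' - X" q] by (simp add: cong_iff_dvd_diff cong_def)
      then have "m - X = m' - X" using e by (metis div_mult_mod_eq)
      then show "m = m'" using m m' by auto
    qed
    show "(\<lambda>m. (m - X) div q) ` {m \<in> {X..<X + r}. int q dvd int m - c} \<subseteq> {..r div q}"
      by (auto intro!: div_le_mono)
  qed simp
  then have "real (card {m \<in> {X..<X + r}. int q dvd int m - c}) \<le> real (r div q) + 1" by simp
  also have "real (r div q) \<le> real X / real q"
    using of_nat_div_le_of_nat[of r q] assms by (meson divide_right_mono of_nat_0_le_iff of_nat_mono order_trans)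
  also have "1 \<le> real X / real q" using assms by simp
  finally show ?thesis by simp
qed

lemma card_residue_class_ge:
  assumes "q > 0" "q \<le> X" "X \<le> m" "m < X + X"
  shows "real X / (2 * real q) \<le> real (card {m' \<in> {X..<X + X}. int q dvd int m - int m'})"
proof -
  define c where "c = (m - X) mod q"
  have cq: "c < q" using assms by (simp add: c_def)
  have cm: "int q dvd int m - int X - int c"
  proof -
    have "int m - int X - int c = int q * int ((m - X) div q)"
      using assms div_mult_mod_eq[of "m - X" q] unfolding c_def
      by (metis add_diff_cancel_right' mult.commute of_nat_diff of_nat_mult of_nat_add)
    then show ?thesis by simp
  qed
  have "card {..<X div q} \<le> card {m' \<in> {X..<X + X}. int q dvd int m - int m'}"
  proof (rule card_inj_on_le[where f = "\<lambda>j. X + c + q * j"])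
    show "inj_on (\<lambda>j. X + c + q * j) {..<X div q}" using assms by (auto simp: inj_on_def)
    show "(\<lambda>j. X + c + q * j) ` {..<X div q} \<subseteq> {m' \<in> {X..<X + X}. int q dvd int m - int m'}"
    proof safe
      fix j assume j: "j < X div q"
      have "c + q * j < q * (j + 1)" using cq by simp
      also have "\<dots> \<le> q * (X div q)" using j by (intro mult_left_mono) auto
      also have "\<dots> \<le> X" by simp
      finally show "X + c + q * j \<in> {X..<X + X}" by simp
      have "int q dvd (int m - int X - int c) - int q * int j" using cm by simp
      then show "int q dvd int m - int (X + c + q * j)" by (simp add: algebra_simps)
    qed
  qed simp
  then have a: "real (X div q) \<le> real (card {m' \<in> {X..<X + X}. int q dvd int m - int m'})" by simp
  have "1 \<le> X div q" using assms by (simp add: Suc_le_eq div_greater_zero_iff)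
  moreover have "real X / real q \<le> real (X div q) + 1"
    using floor_divide_of_nat_eq[where ?'a = real, of X q] by linarith
  ultimately have "real X / real q \<le> 2 * real (X div q)" by linarith
  then show ?thesis using a by simp
qed

lemma dvd_power_diff: "(d::int) dvd a - b \<Longrightarrow> d dvd a ^ k - b ^ k"
  by (meson cong_iff_dvd_diff cong_pow)

lemma weyl_sum_second_moment:
  assumes q: "q > 0" "q dvd NA" "q dvd NB"
  shows "(\<Sum>A\<in>{1..NA}. \<Sum>B\<in>{1..NB}. (cmod (weyl_sum k q A B X r))\<^sup>2)
    = real NA * real NB * (\<Sum>m\<in>{X..<X + r}. real (card {m' \<in> {X..<X + r}. int q dvd int m - int m'}))"
proof -
  have "{(m, m') \<in> {X..<X + r} \<times> {X..<X + r}. int q dvd int m ^ k - int m' ^ k \<and> int q dvd int m - int m'}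
     = Sigma {X..<X + r} (\<lambda>m. {m' \<in> {X..<X + r}. int q dvd int m - int m'})"
    by (auto intro: dvd_power_diff)
  then have c: "card {(m, m') \<in> {X..<X + r} \<times> {X..<X + r}. int q dvd int m ^ k - int m' ^ k \<and> int q dvd int m - int m'}
     = (\<Sum>m\<in>{X..<X + r}. card {m' \<in> {X..<X + r}. int q dvd int m - int m'})"
    by simp
  show ?thesis unfolding weyl_sum_def
    by (subst mean_square_echar_sum[OF _ q]) (simp_all only: c of_nat_sum finite_atLeastLessThan)
qed

lemma weyl_sum_second_moment_le:
  assumes q: "q > 0" "q dvd NA" "q dvd NB" "q \<le> X" "r \<le> X"
  shows "(\<Sum>A\<in>{1..NA}. \<Sum>B\<in>{1..NB}. (cmod (weyl_sum k q A B X r))\<^sup>2)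
    \<le> real NA * real NB * (2 * (real X)\<^sup>2 / real q)"
  unfolding weyl_sum_second_moment[OF q(1-3)]
proof (intro mult_left_mono)
  have "(\<Sum>m\<in>{X..<X + r}. real (card {m' \<in> {X..<X + r}. int q dvd int m - int m'}))
      \<le> (\<Sum>m\<in>{X..<X + r}. 2 * real X / real q)"
    using card_residue_class_le[OF q(1,4,5)] by (intro sum_mono) (simp add: dvd_diff_commute)
  also have "\<dots> = real r * (2 * real X / real q)" by simp
  also have "\<dots> \<le> real X * (2 * real X / real q)" using q by (intro mult_right_mono) auto
  finally show "(\<Sum>m\<in>{X..<X + r}. real (card {m' \<in> {X..<X + r}. int q dvd int m - int m'}))
     \<le> 2 * (real X)\<^sup>2 / real q" by (simp add: power2_eq_square mult_ac)
qed auto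

lemma weyl_sum_second_moment_ge:
  assumes q: "q > 0" "q dvd NA" "q dvd NB" "q \<le> X"
  shows "real NA * real NB * ((real X)\<^sup>2 / (2 * real q))
    \<le> (\<Sum>A\<in>{1..NA}. \<Sum>B\<in>{1..NB}. (cmod (weyl_sum k q A B X X))\<^sup>2)"
  unfolding weyl_sum_second_moment[OF q(1-3)]
proof (intro mult_left_mono)
  have "real X * (real X / (2 * real q)) = (\<Sum>m\<in>{X..<X + X}. real X / (2 * real q))" by simp
  also have "\<dots> \<le> (\<Sum>m\<in>{X..<X + X}. real (card {m' \<in> {X..<X + X}. int q dvd int m - int m'}))"
    using card_residue_class_ge[OF q(1,4)] by (intro sum_mono) auto
  finally show "(real X)\<^sup>2 / (2 * real q)
      \<le> (\<Sum>m\<in>{X..<X + X}. real (card {m' \<in> {X..<X + X}. int q dvd int m - int m'}))"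
    by (simp add: power2_eq_square)
qed auto

text \<open>
  The linear condition determines \<open>m2\<close> modulo \<open>q\<close> from \<open>m1\<close>; then \<open>m1\<close> is one of at most \<open>k\<close> roots unless
  \<open>q\<close> divides \<open>\<sigma>\<close>. In the exceptional case the power condition can hold for all \<open>m1\<close> (when \<open>k\<close> is odd
  and \<open>q\<close> divides \<open>\<tau>\<close>), hence the weaker bound. It does no harm to the fourth moment because only a
  proportion of order \<open>1 / q\<close> of all pairs has a sum divisible by \<open>q\<close>.
\<close>

lemma card_sum_and_power_sum_fibre_le:
  fixes \<sigma> \<tau> :: int
  assumes q: "prime q" "k < q" "k \<ge> 2" "q \<le> X"
  defines "F \<equiv> {(m1, m2) \<in> {X..<X + X} \<times> {X..<X + X}.
      int q dvd (int m1 ^ k + int m2 ^ k) - \<tau> \<and> int q dvd (int m1 + int m2) - \<sigma>}"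
  shows "real (card F) \<le> (if int q dvd \<sigma> then real X * (2 * real X / real q)
      else real k * (2 * real X / real q) * (2 * real X / real q))"
proof -
  let ?I = "{X..<X + X}"
  define M where "M = (if int q dvd \<sigma> then ?I else {m \<in> ?I. int q dvd int m ^ k + (\<sigma> - int m) ^ k - \<tau>})"
  have q0: "q > 0" using q by (simp add: prime_gt_0_nat)
  have fin: "finite M" by (auto simp: M_def)
  have "F \<subseteq> Sigma M (\<lambda>m. {m' \<in> ?I. int q dvd int m' - (\<sigma> - int m)})"
  proof safe
    fix m1 m2 assume "(m1, m2) \<in> F"
    then have a: "m1 \<in> ?I" "m2 \<in> ?I" "int q dvd (int m1 ^ k + int m2 ^ k) - \<tau>"
      "int q dvd (int m1 + int m2) - \<sigma>" by (auto simp: F_def)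
    show "m2 \<in> ?I" by fact
    show d: "int q dvd int m2 - (\<sigma> - int m1)" using a(4) by (simp add: algebra_simps)
    have "int q dvd ((int m1 ^ k + int m2 ^ k) - \<tau>) - (int m2 ^ k - (\<sigma> - int m1) ^ k)"
      by (rule dvd_diff[OF a(3) dvd_power_diff[OF d]])
    then show "m1 \<in> M" using a by (simp add: M_def algebra_simps)
  qed
  then have "card F \<le> card (Sigma M (\<lambda>m. {m' \<in> ?I. int q dvd int m' - (\<sigma> - int m)}))"
    using fin by (intro card_mono) auto
  then have "card F \<le> (\<Sum>m\<in>M. card {m' \<in> ?I. int q dvd int m' - (\<sigma> - int m)})"
    using fin by simp
  then have "real (card F) \<le> (\<Sum>m\<in>M. real (card {m' \<in> ?I. int q dvd int m' - (\<sigma> - int m)}))"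
    by (simp flip: of_nat_sum)
  also have "\<dots> \<le> (\<Sum>m\<in>M. 2 * real X / real q)"
    by (intro sum_mono card_residue_class_le) (use q q0 in auto)
  also have "\<dots> = real (card M) * (2 * real X / real q)" by simp
  finally have 1: "real (card F) \<le> real (card M) * (2 * real X / real q)" .
  show ?thesis
  proof (cases "int q dvd \<sigma>")
    case True
    then show ?thesis using 1 by (simp add: M_def)
  next
    case False
    define Z where "Z = {x \<in> {0..<q}. int q dvd int x ^ k + (\<sigma> - int x) ^ k - \<tau>}"
    have Z: "card Z \<le> k" unfolding Z_def by (rule card_power_sum_solutions) (use q False in auto)
    have "M \<subseteq> (\<Union>x\<in>Z. {m \<in> ?I. int q dvd int m - int x})"
    proof
      fix m assume "m \<in> M"
      then have m: "m \<in> ?I" "int q dvd int m ^ k + (\<sigma> - int m) ^ k - \<tau>" using False by (auto simp: M_def)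
      define x where "x = m mod q"
      have dx: "int q dvd int m - int x" unfolding x_def
        by (metis cong_iff_dvd_diff cong_int_iff cong_mod_right cong_refl)
      have "int q dvd (\<sigma> - int m) - (\<sigma> - int x)" using dx by (simp add: dvd_diff_commute)
      from dvd_diff[OF dvd_diff[OF m(2) dvd_power_diff[OF dx, of k]] dvd_power_diff[OF this, of k]]
      have "int q dvd int x ^ k + (\<sigma> - int x) ^ k - \<tau>" by (simp add: algebra_simps)
      then have "x \<in> Z" using q0 by (simp add: Z_def x_def)
      then show "m \<in> (\<Union>x\<in>Z. {m \<in> ?I. int q dvd int m - int x})" using m dx by auto
    qed
    then have "card M \<le> card (\<Union>x\<in>Z. {m \<in> ?I. int q dvd int m - int x})"
      by (intro card_mono) (auto simp: Z_def)
    also have "\<dots> \<le> (\<Sum>x\<in>Z. card {m \<in> ?I. int q dvd int m - int x})"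
      by (rule card_UN_le) (simp add: Z_def)
    finally have "real (card M) \<le> (\<Sum>x\<in>Z. real (card {m \<in> ?I. int q dvd int m - int x}))"
      by (simp flip: of_nat_sum)
    also have "\<dots> \<le> (\<Sum>x\<in>Z. 2 * real X / real q)"
      by (intro sum_mono card_residue_class_le) (use q q0 in auto)
    also have "\<dots> \<le> real k * (2 * real X / real q)" using Z by (auto intro!: divide_right_mono mult_right_mono)
    finally have "real (card M) \<le> real k * (2 * real X / real q)" .
    then have "real (card M) * (2 * real X / real q) \<le> real k * (2 * real X / real q) * (2 * real X / real q)"
      by (intro mult_right_mono) auto
    then show ?thesis using 1 False by simp
  qed
qed

lemma weyl_sum_fourth_moment_le:
  assumes q: "prime q" "k < q" "k \<ge> 2" "q \<le> X" "q dvd NA" "q dvd NB"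
  shows "(\<Sum>A\<in>{1..NA}. \<Sum>B\<in>{1..NB}. (cmod (weyl_sum k q A B X X)) ^ 4)
    \<le> real NA * real NB * (4 * (real k + 1) * (real X) ^ 4 / (real q)\<^sup>2)"
proof -
  let ?I = "{X..<X + X}"
  let ?P = "?I \<times> ?I"
  define u v where "u = (\<lambda>(m1, m2). int m1 ^ k + int m2 ^ k)" and "v = (\<lambda>(m1, m2). int m1 + int m2)"
  have q0: "q > 0" using q by (simp add: prime_gt_0_nat)
  have sq: "(cmod (weyl_sum k q A B X X)) ^ 4 = (cmod (\<Sum>p\<in>?P. echar q (int A * u p + int B * v p)))\<^sup>2" for A B
  proof -
    have "(weyl_sum k q A B X X)\<^sup>2 = (\<Sum>p\<in>?P. echar q (int A * u p + int B * v p))"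
      unfolding weyl_sum_def power2_eq_square sum_product sum.cartesian_product
      by (intro sum.cong refl) (auto simp: u_def v_def algebra_simps simp flip: echar_add)
    then have "(cmod (\<Sum>p\<in>?P. echar q (int A * u p + int B * v p)))\<^sup>2 = (cmod ((weyl_sum k q A B X X)\<^sup>2))\<^sup>2" by simp
    also have "\<dots> = (cmod (weyl_sum k q A B X X)) ^ 4" by (simp add: norm_power flip: power_mult)
    finally show ?thesis by simp
  qed
  define T where "T = {(p, p') \<in> ?P \<times> ?P. int q dvd u p - u p' \<and> int q dvd v p - v p'}"
  define T' where "T' = Sigma ?P (\<lambda>p'. {p \<in> ?P. int q dvd u p - u p' \<and> int q dvd v p - v p'})"
  have cT: "card T = card T'"
    by (rule bij_betw_same_card[of prod.swap])
       (rule bij_betw_byWitness[of _ prod.swap], auto simp: T_def T'_def)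
  let ?D = "{p' \<in> ?P. int q dvd v p'}"
  let ?a = "2 * real X / real q"
  have fib: "real (card {p \<in> ?P. int q dvd u p - u p' \<and> int q dvd v p - v p'})
     \<le> (if int q dvd v p' then real X * ?a else real k * ?a * ?a)" for p'
  proof -
    have "{p \<in> ?P. int q dvd u p - u p' \<and> int q dvd v p - v p'} =
      {(m1, m2) \<in> ?P. int q dvd (int m1 ^ k + int m2 ^ k) - u p' \<and> int q dvd (int m1 + int m2) - v p'}"
      by (auto simp: u_def v_def)
    then show ?thesis using card_sum_and_power_sum_fibre_le[OF q(1-4), of "u p'" "v p'"] by simp
  qed
  have D: "real (card ?D) \<le> real X * ?a"
  proof -
    have "?D = Sigma ?I (\<lambda>m. {m' \<in> ?I. int q dvd int m' - (- int m)})"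
      by (auto simp: v_def add.commute)
    then have "real (card ?D) = (\<Sum>m\<in>?I. real (card {m' \<in> ?I. int q dvd int m' - (- int m)}))" by simp
    also have "\<dots> \<le> (\<Sum>m\<in>?I. ?a)" by (intro sum_mono card_residue_class_le) (use q q0 in auto)
    finally show ?thesis by simp
  qed
  have "real (card T) = (\<Sum>p'\<in>?P. real (card {p \<in> ?P. int q dvd u p - u p' \<and> int q dvd v p - v p'}))"
    unfolding cT by (simp add: T'_def)
  also have "\<dots> \<le> (\<Sum>p'\<in>?P. if int q dvd v p' then real X * ?a else real k * ?a * ?a)"
    by (intro sum_mono fib)
  also have "\<dots> \<le> (\<Sum>p'\<in>?P. (if int q dvd v p' then real X * ?a else 0) + real k * ?a * ?a)"
    by (intro sum_mono) auto
  also have "\<dots> = real (card ?D) * (real X * ?a) + real X * real X * (real k * ?a * ?a)"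
    by (simp add: sum.distrib flip: sum.inter_filter)
  also have "\<dots> \<le> real X * ?a * (real X * ?a) + real X * real X * (real k * ?a * ?a)"
    by (intro add_right_mono mult_right_mono D) auto
  also have "\<dots> = 4 * (real k + 1) * (real X) ^ 4 / (real q)\<^sup>2"
    using q0 by (simp add: field_simps power2_eq_square power4_eq_xxxx)
  finally have T: "real (card T) \<le> 4 * (real k + 1) * (real X) ^ 4 / (real q)\<^sup>2" .
  have "(\<Sum>A\<in>{1..NA}. \<Sum>B\<in>{1..NB}. (cmod (weyl_sum k q A B X X)) ^ 4) = real NA * real NB * real (card T)"
    unfolding sq T_def by (rule mean_square_echar_sum) (use q q0 in auto)
  also have "\<dots> \<le> real NA * real NB * (4 * (real k + 1) * (real X) ^ 4 / (real q)\<^sup>2)"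
    by (intro mult_left_mono T) auto
  finally show ?thesis .
qed

text \<open>
  The part of \<open>g\<close> below \<open>\<mu> / 2\<close> carries at most half of the first moment. By Cauchy-Schwarz the other
  half cannot be carried by few points unless the second moment is large.
\<close>

lemma Paley_Zygmund_card:
  fixes g :: "'w \<Rightarrow> real"
  assumes fin: "finite W" and nn: "\<And>w. w \<in> W \<Longrightarrow> g w \<ge> 0" and mu: "\<mu> > 0" and K: "K > 0"
    and first: "(\<Sum>w\<in>W. g w) \<ge> real (card W) * \<mu>"
    and second: "(\<Sum>w\<in>W. (g w)\<^sup>2) \<le> real (card W) * (K * \<mu>\<^sup>2)"
  shows "real (card {w \<in> W. \<mu> / 2 \<le> g w}) \<ge> real (card W) / (4 * K)"
proof (cases "W = {}")
  case False
  let ?N = "real (card W)" and ?G = "{w \<in> W. \<mu> / 2 \<le> g w}"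
  have N: "?N > 0" using False fin by (simp add: card_gt_0_iff)
  have "?N * \<mu> \<le> (\<Sum>w\<in>W. (if w \<in> ?G then g w else 0) + \<mu> / 2)"
    using first by (rule order_trans) (intro sum_mono, use mu in auto)
  also have "\<dots> = (\<Sum>w\<in>?G. g w) + ?N * (\<mu> / 2)"
    using fin by (simp add: sum.distrib sum.If_cases Int_def)
  finally have a: "?N * \<mu> / 2 \<le> (\<Sum>w\<in>?G. g w)" by simp
  have "(?N * \<mu> / 2)\<^sup>2 \<le> (\<Sum>w\<in>?G. g w)\<^sup>2"
    using a mu by (intro power_mono) auto
  also have "\<dots> \<le> real (card ?G) * (\<Sum>w\<in>?G. (g w)\<^sup>2)"
    using sum_squared_le_sum_of_squares[of g ?G] fin by (simp add: mult.commute)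
  also have "\<dots> \<le> real (card ?G) * (\<Sum>w\<in>W. (g w)\<^sup>2)"
    using fin by (intro mult_left_mono sum_mono2) auto
  also have "\<dots> \<le> real (card ?G) * (?N * (K * \<mu>\<^sup>2))"
    by (intro mult_left_mono second) auto
  finally have "?N * \<mu>\<^sup>2 * ?N \<le> (real (card ?G) * (4 * K)) * \<mu>\<^sup>2 * ?N"
    by (simp add: power2_eq_square field_simps)
  then have "?N \<le> real (card ?G) * (4 * K)" using N mu by simp
  then show ?thesis using K by (simp add: field_simps)
qed simp

lemma Markov_card:
  fixes h :: "'w \<Rightarrow> real"
  assumes "finite W" "\<And>w. w \<in> W \<Longrightarrow> h w \<ge> 0" "c \<ge> 0" "(\<Sum>w\<in>W. h w) \<le> b"
  shows "c * real (card {w \<in> W. c < h w}) \<le> b"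
proof -
  have "c * real (card {w \<in> W. c < h w}) = (\<Sum>w\<in>{w \<in> W. c < h w}. c)" by simp
  also have "\<dots> \<le> (\<Sum>w\<in>{w \<in> W. c < h w}. h w)" by (intro sum_mono) auto
  also have "\<dots> \<le> (\<Sum>w\<in>W. h w)" using assms by (intro sum_mono2) auto
  finally show ?thesis using assms by simp
qed

lemma card_heavy_sections:
  fixes W :: "(nat \<times> nat) set"
  assumes W: "W \<subseteq> {1..NA} \<times> {1..NB}" and c: "2 * c * real NA * real NB \<le> real (card W)"
    and NB: "NB > 0" "c \<ge> 0"
  shows "c * real NA \<le> real (card {A \<in> {1..NA}. c * real NB \<le> real (card {B \<in> {1..NB}. (A, B) \<in> W})})"
proof -
  let ?s = "\<lambda>A. real (card {B \<in> {1..NB}. (A, B) \<in> W})"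
  let ?G = "{A \<in> {1..NA}. c * real NB \<le> ?s A}"
  have "W = Sigma {1..NA} (\<lambda>A. {B \<in> {1..NB}. (A, B) \<in> W})" using W by auto
  then have "card W = card \<dots>" by (rule arg_cong)
  then have "real (card W) = (\<Sum>A\<in>{1..NA}. ?s A)" by simp
  also have "\<dots> \<le> (\<Sum>A\<in>{1..NA}. (if A \<in> ?G then real NB else 0) + c * real NB)"
  proof (intro sum_mono)
    fix A assume "A \<in> {1..NA}"
    have "card {B \<in> {1..NB}. (A, B) \<in> W} \<le> card {1..NB}" by (intro card_mono) auto
    then have "?s A \<le> real NB" by simp
    moreover have "c * real NB \<ge> 0" using NB by simp
    ultimately show "?s A \<le> (if A \<in> ?G then real NB else 0) + c * real NB"
      using \<open>A \<in> _\<close> by auto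
  qed
  also have "\<dots> = real (card ?G) * real NB + real NA * (c * real NB)"
    by (simp add: sum.distrib sum.If_cases Int_def)
  finally have "(2 * c * real NA) * real NB \<le> (real (card ?G) + real NA * c) * real NB"
    using c by (simp add: algebra_simps)
  then show ?thesis using NB by simp
qed

text \<open>
  The arithmetic input of the construction. The index \<open>A\<close> belongs to the time and is shared by all
  coordinates, while \<open>B\<close> is chosen in each coordinate separately; this is why the good pairs are
  arranged as many \<open>B\<close> above each of many \<open>A\<close>. The average of the partial sums is controlled because the
  evolved wave trains are slowly modulated Weyl sums and are compared with them by summation by
  parts. Multiples of \<open>q\<close> are removed since the integers are the only values of \<open>B / q\<close> that different
  primes share.
\<close>

lemma many_large_weyl_sums:
  fixes k q X NA NB :: nat
  defines "p \<equiv> 1 / (64 * (real k + 1))"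
  assumes q: "prime q" "k < q" "k \<ge> 2" "4 / p \<le> real q" "q \<le> X" "q dvd NA" "q dvd NB" "NB > 0"
  obtains G \<B> where "G \<subseteq> {1..NA}" "p / 4 * real NA \<le> real (card G)"
    "\<And>A. A \<in> G \<Longrightarrow> \<B> A \<subseteq> {1..NB}" "\<And>A. A \<in> G \<Longrightarrow> p / 4 * real NB \<le> real (card (\<B> A))"
    "\<And>A B. A \<in> G \<Longrightarrow> B \<in> \<B> A \<Longrightarrow>
       \<not> q dvd B \<and> large_weyl_pair k q X (sqrt (8 / p)) A B"
proof -
  have q0: "q > 0" and X0: "X > 0" using q prime_gt_0_nat[of q] by auto
  have p: "p > 0" by (simp add: p_def)
  define W where "W = {1..NA} \<times> {1..NB}"
  define g where "g = (\<lambda>(A, B). (cmod (weyl_sum k q A B X X))\<^sup>2)"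
  define h where "h = (\<lambda>(A, B). \<Sum>r\<in>{1..X}. (cmod (weyl_sum k q A B X r))\<^sup>2)"
  define \<mu> where "\<mu> = (real X)\<^sup>2 / (2 * real q)"
  have finW: "finite W" and cW: "real (card W) = real NA * real NB" by (auto simp: W_def)
  have \<mu>: "\<mu> > 0" using q0 X0 by (simp add: \<mu>_def)
  \<comment> \<open>The constant 16 (k + 1) is the ratio of the fourth moment bound to the square of \<open>\<mu>\<close>.\<close>
  have good1: "real (card {w \<in> W. \<mu> / 2 \<le> g w}) \<ge> real (card W) / (4 * (16 * (real k + 1)))"
  proof (rule Paley_Zygmund_card[OF finW _ \<mu>])
    show "real (card W) * \<mu> \<le> sum g W"
      using weyl_sum_second_moment_ge[OF q0 q(6,7,5), of k]
      unfolding cW W_def g_def \<mu>_def by (simp add: sum.cartesian_product)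
    have "(\<Sum>w\<in>W. (g w)\<^sup>2) = (\<Sum>A\<in>{1..NA}. \<Sum>B\<in>{1..NB}. (cmod (weyl_sum k q A B X X)) ^ 4)"
      by (simp add: W_def g_def sum.cartesian_product case_prod_beta flip: power_mult)
    also have "\<dots> \<le> real NA * real NB * (4 * (real k + 1) * (real X) ^ 4 / (real q)\<^sup>2)"
      by (rule weyl_sum_fourth_moment_le) (use q in auto)
    also have "4 * (real k + 1) * (real X) ^ 4 / (real q)\<^sup>2 = 16 * (real k + 1) * \<mu>\<^sup>2"
      using q0 by (simp add: \<mu>_def field_simps power2_eq_square power4_eq_xxxx)
    finally show "(\<Sum>w\<in>W. (g w)\<^sup>2) \<le> real (card W) * (16 * (real k + 1) * \<mu>\<^sup>2)"
      by (simp add: cW)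
  qed (auto simp: g_def)
  then have good1: "p * (real NA * real NB) \<le> real (card {w \<in> W. \<mu> / 2 \<le> g w})"
    by (simp add: cW p_def)
  define c where "c = 8 / p * (real X ^ 3 / real q)"
  have c0: "c > 0" using p q0 X0 by (simp add: c_def)
  have "c * real (card {w \<in> W. c < h w}) \<le> real NA * real NB * (2 * (real X) ^ 3 / real q)"
  proof (rule Markov_card[OF finW])
    have "sum h W = (\<Sum>A\<in>{1..NA}. \<Sum>B\<in>{1..NB}. h (A, B))"
      by (simp add: W_def sum.cartesian_product)
    also have "\<dots> = (\<Sum>A\<in>{1..NA}. \<Sum>B\<in>{1..NB}. \<Sum>r\<in>{1..X}. (cmod (weyl_sum k q A B X r))\<^sup>2)"
      by (simp add: h_def)
    also have "\<dots> = (\<Sum>A\<in>{1..NA}. \<Sum>r\<in>{1..X}. \<Sum>B\<in>{1..NB}. (cmod (weyl_sum k q A B X r))\<^sup>2)"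
      by (intro sum.cong refl sum.swap)
    also have "\<dots> = (\<Sum>r\<in>{1..X}. \<Sum>A\<in>{1..NA}. \<Sum>B\<in>{1..NB}. (cmod (weyl_sum k q A B X r))\<^sup>2)"
      by (rule sum.swap)
    also have "\<dots> \<le> (\<Sum>r\<in>{1..X}. real NA * real NB * (2 * (real X)\<^sup>2 / real q))"
      by (intro sum_mono weyl_sum_second_moment_le) (use q q0 in auto)
    also have "\<dots> = real NA * real NB * (2 * (real X) ^ 3 / real q)"
      by (simp add: power2_eq_square power3_eq_cube)
    finally show "sum h W \<le> real NA * real NB * (2 * (real X) ^ 3 / real q)" .
  qed (use c0 in \<open>auto simp: h_def intro!: sum_nonneg\<close>)
  also have "\<dots> = c * (p / 4 * (real NA * real NB))" using p q0 by (simp add: c_def)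
  finally have bad2: "real (card {w \<in> W. c < h w}) \<le> p / 4 * (real NA * real NB)" using c0 by simp
  have bad3: "real (card {w \<in> W. q dvd snd w}) \<le> p / 4 * (real NA * real NB)"
  proof -
    have "{w \<in> W. q dvd snd w} = {1..NA} \<times> {B \<in> {1..NB}. q dvd B}" by (auto simp: W_def)
    moreover have "card {B \<in> {1..NB}. q dvd B} \<le> card {1..NB div q}"
    proof (rule card_inj_on_le[where f = "\<lambda>B. B div q"])
      show "inj_on (\<lambda>B. B div q) {B \<in> {1..NB}. q dvd B}"
        by (rule inj_onI) (auto dest: dvd_div_eq_cancel)
      show "(\<lambda>B. B div q) ` {B \<in> {1..NB}. q dvd B} \<subseteq> {1..NB div q}"
        using q0 by (auto intro: div_le_mono simp: Suc_le_eq div_greater_zero_iff dvd_imp_le)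
    qed auto
    ultimately have "card {w \<in> W. q dvd snd w} \<le> NA * (NB div q)"
      by (simp add: card_cartesian_product)
    then have "real (card {w \<in> W. q dvd snd w}) \<le> real (NA * (NB div q))" by (rule of_nat_mono)
    also have "\<dots> = real NA * real (NB div q)" by simp
    also have "\<dots> \<le> real NA * (real NB / real q)" by (intro mult_left_mono of_nat_div_le_of_nat) auto
    also have "\<dots> \<le> real NA * (real NB * (p / 4))"
    proof (intro mult_left_mono)
      have "1 / real q \<le> p / 4" using q(4) p q0 by (simp add: field_simps)
      then show "real NB / real q \<le> real NB * (p / 4)"
        using mult_left_mono[of "1 / real q" "p / 4" "real NB"] by simp
    qed auto
    finally show ?thesis by (simp add: mult_ac)
  qed
  define V where "V = {w \<in> W. \<mu> / 2 \<le> g w \<and> h w \<le> c \<and> \<not> q dvd snd w}"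
  have "{w \<in> W. \<mu> / 2 \<le> g w} \<subseteq> V \<union> ({w \<in> W. c < h w} \<union> {w \<in> W. q dvd snd w})"
    by (auto simp: V_def)
  then have "card {w \<in> W. \<mu> / 2 \<le> g w} \<le> card (V \<union> ({w \<in> W. c < h w} \<union> {w \<in> W. q dvd snd w}))"
    using finW by (intro card_mono) (auto simp: V_def)
  also have "\<dots> \<le> card V + card ({w \<in> W. c < h w} \<union> {w \<in> W. q dvd snd w})" by (rule card_Un_le)
  also have "\<dots> \<le> card V + (card {w \<in> W. c < h w} + card {w \<in> W. q dvd snd w})"
    by (intro add_left_mono card_Un_le)
  finally have "real (card {w \<in> W. \<mu> / 2 \<le> g w})
      \<le> real (card V + (card {w \<in> W. c < h w} + card {w \<in> W. q dvd snd w}))" by (rule of_nat_mono)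
  then have V: "2 * (p / 4) * real NA * real NB \<le> real (card V)"
    using good1 bad2 bad3 by simp
  define \<B> where "\<B> = (\<lambda>A. {B \<in> {1..NB}. (A, B) \<in> V})"
  define G where "G = {A \<in> {1..NA}. p / 4 * real NB \<le> real (card (\<B> A))}"
  show thesis
  proof (rule that[of G \<B>])
    show "G \<subseteq> {1..NA}" by (auto simp: G_def)
    show "p / 4 * real NA \<le> real (card G)" unfolding G_def \<B>_def
      by (rule card_heavy_sections) (use V p q in \<open>auto simp: V_def W_def\<close>)
    show "\<B> A \<subseteq> {1..NB}" for A by (auto simp: \<B>_def)
    show "p / 4 * real NB \<le> real (card (\<B> A))" if "A \<in> G" for A using that by (simp add: G_def)
    fix A B assume "A \<in> G" "B \<in> \<B> A"
    then have v: "\<mu> / 2 \<le> (cmod (weyl_sum k q A B X X))\<^sup>2"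
      "(\<Sum>r\<in>{1..X}. (cmod (weyl_sum k q A B X r))\<^sup>2) \<le> c" "\<not> q dvd B"
      by (auto simp: \<B>_def V_def g_def h_def)
    have "(real X / (2 * sqrt (real q)))\<^sup>2 \<le> (cmod (weyl_sum k q A B X X))\<^sup>2"
      using v(1) by (simp add: \<mu>_def power_divide power_mult_distrib)
    then have 1: "real X / (2 * sqrt (real q)) \<le> cmod (weyl_sum k q A B X X)"
      by (rule power2_le_imp_le) simp
    have "(\<Sum>r\<in>{1..X}. cmod (weyl_sum k q A B X r))\<^sup>2
        \<le> real X * (\<Sum>r\<in>{1..X}. (cmod (weyl_sum k q A B X r))\<^sup>2)"
      using sum_squared_le_sum_of_squares[of "\<lambda>r. cmod (weyl_sum k q A B X r)" "{1..X}"]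
      by (simp add: mult.commute)
    also have "\<dots> \<le> real X * c" using v by (intro mult_left_mono) auto
    also have "\<dots> = (sqrt (8 / p) * (real X)\<^sup>2 / sqrt (real q))\<^sup>2" using p
      by (simp add: c_def power_divide power_mult_distrib power4_eq_xxxx power3_eq_cube flip: power_mult)
    finally have "(\<Sum>r\<in>{1..X}. cmod (weyl_sum k q A B X r)) \<le> sqrt (8 / p) * (real X)\<^sup>2 / sqrt (real q)"
      by (rule power2_le_imp_le) (use p in simp)
    with 1 v show "\<not> q dvd B \<and> large_weyl_pair k q X (sqrt (8 / p)) A B"
      by (simp add: large_weyl_pair_def)
  qed
qed

section \<open>Primes in geometric ranges\<close>

lemma squarefree_eq_prod_prime_factors:
  assumes "squarefree (s::nat)"
  shows "s = \<Prod>(prime_factors s)"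
proof -
  have s: "s \<noteq> 0" using assms by (metis not_squarefree_0)
  have "s = (\<Prod>p\<in>prime_factors s. p ^ multiplicity p s)"
    using prime_factorization_nat[of s] s by simp
  also have "\<dots> = (\<Prod>p\<in>prime_factors s. p)"
  proof (rule prod.cong[OF refl])
    fix p assume p: "p \<in> prime_factors s"
    then have "multiplicity p s \<le> 1" using assms s squarefree_factorial_semiring''[of s] by auto
    moreover have "multiplicity p s > 0" using p by (simp add: prime_factors_multiplicity)
    ultimately have "multiplicity p s = 1" by simp
    then show "p ^ multiplicity p s = p" by simp
  qed
  finally show ?thesis .
qed

lemma sum_UN_le:
  fixes g :: "'b \<Rightarrow> real"
  assumes "finite I" "\<And>i. i \<in> I \<Longrightarrow> finite (S i)" "\<And>x. g x \<ge> 0"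
  shows "(\<Sum>x\<in>(\<Union>i\<in>I. S i). g x) \<le> (\<Sum>i\<in>I. \<Sum>x\<in>S i. g x)"
  using assms(1,2)
proof (induction I rule: finite_induct)
  case (insert i I)
  have "(\<Sum>x\<in>S i \<union> (\<Union>i\<in>I. S i). g x) \<le> sum g (S i) + (\<Sum>x\<in>(\<Union>i\<in>I. S i). g x)"
    using insert assms(3) by (subst sum_Un) (auto intro!: sum_nonneg)
  then show ?case using insert by simp
qed simp

text \<open>
  Erdos' proof that the sum of the reciprocals of the primes diverges. If the primes above \<open>b\<close>
  contributed less than \<open>1/2\<close>, at most half of the integers up to \<open>N = 4\<^sup>b\<^sup>+\<^sup>2\<close> would have a prime factor above
  \<open>b\<close>. The others are a square times a squarefree number with prime factors up to \<open>b\<close>, so there are at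
  most \<open>2\<^sup>b sqrt N = N / 4\<close> of them.
\<close>

lemma prime_reciprocal_tail:
  fixes b :: nat
  shows "\<exists>F. finite F \<and> (\<forall>p\<in>F. prime p \<and> b < p) \<and> 1 / 2 \<le> (\<Sum>p\<in>F. 1 / real p)"
proof (rule ccontr)
  assume neg: "\<not> ?thesis"
  define N where "N = (4::nat) ^ (b + 2)"
  define F where "F = {p \<in> {1..N}. prime p \<and> b < p}"
  define U where "U = {n \<in> {1..N}. \<exists>p\<in>F. p dvd n}"
  define V where "V = {n \<in> {1..N}. \<forall>p\<in>prime_factors n. p \<le> b}"
  have sub: "{1..N} \<subseteq> U \<union> V"
  proof
    fix n assume n: "n \<in> {1..N}"
    show "n \<in> U \<union> V"
    proof (cases "n \<in> V")
      case False
      then obtain p where p: "p \<in> prime_factors n" "b < p" using n by (auto simp: V_def not_le)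
      then have "prime p" "p dvd n" by auto
      moreover have "p \<le> N" using n \<open>p dvd n\<close> by (auto dest!: dvd_imp_le)
      ultimately have "p \<in> F" using p by (auto simp: F_def prime_ge_1_nat)
      then show ?thesis using n \<open>p dvd n\<close> by (auto simp: U_def)
    qed simp
  qed
  have "card {1..N} \<le> card (U \<union> V)" by (intro card_mono sub) (auto simp: U_def V_def)
  also have "\<dots> \<le> card U + card V" by (rule card_Un_le)
  finally have tot: "real N \<le> real (card U) + real (card V)" by (simp flip: of_nat_add)
  have fF: "finite F" by (simp add: F_def)
  have "card U \<le> card (\<Union>p\<in>F. {n \<in> {1..N}. p dvd n})"
    by (intro card_mono) (auto simp: U_def F_def)
  also have "\<dots> \<le> (\<Sum>p\<in>F. card {n \<in> {1..N}. p dvd n})" by (rule card_UN_le[OF fF])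
  also have "\<dots> \<le> (\<Sum>p\<in>F. N div p)"
  proof (intro sum_mono)
    fix p assume "p \<in> F"
    then have p: "p > 0" by (simp add: F_def)
    have "card {n \<in> {1..N}. p dvd n} \<le> card {1..N div p}"
    proof (rule card_inj_on_le[where f = "\<lambda>n. n div p"])
      show "inj_on (\<lambda>n. n div p) {n \<in> {1..N}. p dvd n}"
        by (rule inj_onI) (auto dest: dvd_div_eq_cancel)
      show "(\<lambda>n. n div p) ` {n \<in> {1..N}. p dvd n} \<subseteq> {1..N div p}"
        using p by (auto intro: div_le_mono simp: Suc_le_eq div_greater_zero_iff dvd_imp_le)
    qed auto
    then show "card {n \<in> {1..N}. p dvd n} \<le> N div p" by simp
  qed
  finally have "real (card U) \<le> (\<Sum>p\<in>F. real (N div p))" by (simp flip: of_nat_sum)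
  also have "\<dots> \<le> (\<Sum>p\<in>F. real N * (1 / real p))"
    by (intro sum_mono) (simp add: of_nat_div_le_of_nat)
  also have "\<dots> = real N * (\<Sum>p\<in>F. 1 / real p)" by (simp add: sum_distrib_left)
  also have "\<dots> \<le> real N * (1 / 2)"
  proof (intro mult_left_mono)
    have "\<forall>p\<in>F. prime p \<and> b < p" unfolding F_def by blast
    then have "\<not> 1 / 2 \<le> (\<Sum>p\<in>F. 1 / real p)" using neg fF by blast
    then show "(\<Sum>p\<in>F. 1 / real p) \<le> 1 / 2" by linarith
  qed simp
  finally have U: "real (card U) \<le> real N / 2" by simp
  have "card V \<le> card (Pow {1..b} \<times> {1..2 ^ (b + 2) :: nat})"
  proof (rule card_inj_on_le[where f = "\<lambda>n::nat. (prime_factors (squarefree_part n), square_part n)"])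
    show "inj_on (\<lambda>n::nat. (prime_factors (squarefree_part n), square_part n)) V"
    proof (rule inj_onI)
      fix m n :: nat assume "(prime_factors (squarefree_part m), square_part m)
        = (prime_factors (squarefree_part n), square_part n)"
      then have e: "prime_factors (squarefree_part m) = prime_factors (squarefree_part n)"
        "square_part m = square_part n" by auto
      have "squarefree_part m = squarefree_part n"
        using e(1) squarefree_eq_prod_prime_factors[of "squarefree_part m"]
          squarefree_eq_prod_prime_factors[of "squarefree_part n"] by simp
      then show "m = n" using e(2) squarefree_decompose[of m] squarefree_decompose[of n] by simp
    qed
    show "(\<lambda>n::nat. (prime_factors (squarefree_part n), square_part n)) ` V \<subseteq> Pow {1..b} \<times> {1..2 ^ (b + 2)}"
    proof safe
      fix n p :: nat assume n: "n \<in> V" and p: "p \<in> prime_factors (squarefree_part n)"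
      have "squarefree_part n dvd n" using squarefree_decompose[of n] by (metis dvd_triv_left)
      moreover have "n \<noteq> 0" using n by (auto simp: V_def)
      ultimately have "p \<in> prime_factors n" using p dvd_prime_factors[of n "squarefree_part n"] by blast
      moreover have "p \<ge> 1" using p by (intro prime_ge_1_nat in_prime_factors_imp_prime)
      ultimately show "p \<in> {1..b}" using n by (auto simp: V_def)
    next
      fix n :: nat assume n: "n \<in> V"
      have "(square_part n)\<^sup>2 dvd n" by simp
      then have "(square_part n)\<^sup>2 \<le> n" using n by (intro dvd_imp_le) (auto simp: V_def)
      also have "\<dots> \<le> N" using n by (simp add: V_def)
      also have "N = (2 ^ (b + 2))\<^sup>2" by (simp add: N_def power2_eq_square flip: power_mult_distrib)
      finally have "square_part n \<le> 2 ^ (b + 2)" by (simp only: power2_nat_le_eq_le)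
      moreover have "square_part n > 0" using n by (intro Nat.gr0I) (simp add: V_def)
      ultimately show "square_part n \<in> {1..2 ^ (b + 2)}" by (simp only: atLeastAtMost_iff Suc_le_eq One_nat_def simp_thms)
    qed
  qed simp
  also have "\<dots> = 2 ^ b * 2 ^ (b + 2)" by (simp add: card_cartesian_product card_Pow)
  finally have "real (card V) \<le> real (2 ^ b * 2 ^ (b + 2))" by (rule of_nat_mono)
  also have "\<dots> = real N / 4" by (simp add: N_def flip: power_mult_distrib)
  finally have "real N \<le> real N / 2 + real N / 4" using tot U by simp
  then show False by (simp add: N_def)
qed

text \<open>
  Otherwise the primes in \<open>[M\<^sup>j, M\<^sup>j\<^sup>+\<^sup>1)\<close> would contribute at most \<open>M\<^sup>-\<^sup>\<epsilon>\<^sup>j\<close> to the sum of reciprocals for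
  all large \<open>j\<close>, and that sum would converge.
\<close>

lemma frequently_many_primes:
  fixes M :: nat and \<epsilon> :: real
  assumes M: "M \<ge> 2" and \<epsilon>: "\<epsilon> > 0"
  shows "\<exists>\<^sub>\<infinity>j. (real M ^ j) powr (1 - \<epsilon>) \<le> real (card {p. prime p \<and> M ^ j \<le> p \<and> p < M ^ (j + 1)})"
proof (rule ccontr)
  let ?P = "\<lambda>j. {p. prime p \<and> M ^ j \<le> p \<and> p < M ^ (j + 1)}"
  assume "\<not> ?thesis"
  then obtain J where J: "\<And>j. j > J \<Longrightarrow> real (card (?P j)) < (real M ^ j) powr (1 - \<epsilon>)"
    unfolding not_INFM MOST_nat not_le by blast
  define \<rho> where "\<rho> = real M powr (- \<epsilon>)"
  have \<rho>: "0 < \<rho>" "\<rho> < 1" using M \<epsilon> powr_less_mono[of "-\<epsilon>" 0 "real M"] by (auto simp: \<rho>_def)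
  have "(\<lambda>j. \<rho> ^ j) \<longlonglongrightarrow> 0" using \<rho> by (intro LIMSEQ_power_zero) auto
  then have "\<forall>\<^sub>F j in sequentially. \<rho> ^ j < (1 - \<rho>) / 4"
    using \<rho> by (intro order_tendstoD) auto
  then obtain J' where J': "\<And>j. j \<ge> J' \<Longrightarrow> \<rho> ^ j < (1 - \<rho>) / 4"
    unfolding eventually_sequentially by blast
  define j0 where "j0 = max J' (Suc J)"
  obtain F where F: "finite F" "\<And>p. p \<in> F \<Longrightarrow> prime p \<and> M ^ j0 < p" "1 / 2 \<le> (\<Sum>p\<in>F. 1 / real p)"
    using prime_reciprocal_tail[of "M ^ j0"] by blast
  define j1 where "j1 = Max (insert 0 F)"
  have fP: "finite (?P j)" for j by (rule finite_subset[of _ "{..<M ^ (j + 1)}"]) auto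
  have sub: "F \<subseteq> (\<Union>j\<in>{j0..<j0 + j1}. ?P j)"
  proof
    fix p assume p: "p \<in> F"
    then have "p \<le> j1" using F(1) by (simp add: j1_def)
    have "p > 0" using F(2)[OF p] prime_gt_0_nat by blast
    define j where "j = (LEAST j. p < M ^ (j + 1))"
    have "p < M ^ p" using M by (simp add: power_gt_expt)
    then have ex: "p < M ^ ((p - 1) + 1)" using \<open>p > 0\<close> by simp
    have j: "p < M ^ (j + 1)" unfolding j_def by (rule LeastI) (rule ex)
    have jp: "j \<le> p - 1" unfolding j_def by (rule Least_le) (rule ex)
    have low: "M ^ j \<le> p"
    proof (cases j)
      case 0
      then show ?thesis using \<open>p > 0\<close> by simp
    next
      case (Suc i)
      then have "\<not> p < M ^ (i + 1)" using not_less_Least[of i "\<lambda>j. p < M ^ (j + 1)"] by (simp add: j_def)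
      then show ?thesis using Suc by simp
    qed
    have "M ^ j0 < M ^ (j + 1)" using F(2)[OF p] j by linarith
    then have "j0 \<le> j" using M power_strict_increasing_iff[of M j0 "j + 1"] by simp
    moreover have "j < j0 + j1" using jp \<open>p \<le> j1\<close> \<open>p > 0\<close> by simp
    ultimately show "p \<in> (\<Union>j\<in>{j0..<j0 + j1}. ?P j)" using F(2)[OF p] j low by auto
  qed
  have "(\<Sum>p\<in>F. 1 / real p) \<le> (\<Sum>p\<in>(\<Union>j\<in>{j0..<j0 + j1}. ?P j). 1 / real p)"
    by (intro sum_mono2 sub) (use fP in auto)
  also have "\<dots> \<le> (\<Sum>j\<in>{j0..<j0 + j1}. \<Sum>p\<in>?P j. 1 / real p)"
    by (rule sum_UN_le) (use fP in auto)
  also have "\<dots> \<le> (\<Sum>j\<in>{j0..<j0 + j1}. \<rho> ^ j)"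
  proof (intro sum_mono)
    fix j assume "j \<in> {j0..<j0 + j1}"
    then have j: "j > J" by (simp add: j0_def)
    have M0: "real M ^ j > 0" using M by simp
    have "(\<Sum>p\<in>?P j. 1 / real p) \<le> (\<Sum>p\<in>?P j. 1 / real M ^ j)"
    proof (intro sum_mono divide_left_mono)
      fix p assume "p \<in> ?P j"
      then have "real (M ^ j) \<le> real p" by (simp only: of_nat_le_iff) simp
      then have le: "real M ^ j \<le> real p" by simp
      show "real M ^ j \<le> real p" by (rule le)
      show "0 < real p * real M ^ j" using le M0 by (intro mult_pos_pos) linarith+
    qed auto
    also have "\<dots> = real (card (?P j)) / real M ^ j" by simp
    also have "\<dots> \<le> (real M ^ j) powr (1 - \<epsilon>) / real M ^ j"
      using J[OF j] M0 by (intro divide_right_mono) auto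
    also have "\<dots> = (real M ^ j) powr (- \<epsilon>)" using M0 by (simp add: powr_diff powr_minus_divide)
    also have "\<dots> = \<rho> ^ j" using M by (simp add: \<rho>_def powr_powr powr_mult mult.commute flip: powr_realpow)
    finally show "(\<Sum>p\<in>?P j. 1 / real p) \<le> \<rho> ^ j" .
  qed
  also have "\<dots> = (\<Sum>i<j1. \<rho> ^ (j0 + i))"
    by (rule sum.reindex_bij_witness[of _ "\<lambda>i. j0 + i" "\<lambda>j. j - j0"]) auto
  also have "\<dots> = \<rho> ^ j0 * (\<Sum>i<j1. \<rho> ^ i)" by (simp add: power_add sum_distrib_left)
  also have "\<dots> \<le> \<rho> ^ j0 * (1 / (1 - \<rho>))"
  proof (intro mult_left_mono)
    have "(\<Sum>i<j1. \<rho> ^ i) = (1 - \<rho> ^ j1) / (1 - \<rho>)" using \<rho> by (simp add: sum_gp_strict)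
    also have "\<dots> \<le> 1 / (1 - \<rho>)" using \<rho> by (intro divide_right_mono) auto
    finally show "(\<Sum>i<j1. \<rho> ^ i) \<le> 1 / (1 - \<rho>)" .
  qed (use \<rho> in auto)
  also have "\<dots> < 1 / 2" using J'[of j0] \<rho> by (simp add: j0_def field_simps)
  finally show False using F(3) by simp
qed

section \<open>The Fejer kernel and one-dimensional wave trains\<close>

text \<open>
  The Fejer kernel. It is integrable with a compactly supported Fourier transform, so wave trains
  built from it are integrable functions whose frequencies are confined exactly. The value at 0 is
  the limit.
\<close>

definition fejer :: "real \<Rightarrow> real" where
  "fejer x = (if x = 0 then 1 / 2 else (1 - cos x) / x\<^sup>2)"

definition tent :: "real \<Rightarrow> real" where
  "tent \<xi> = max 0 (1 - \<bar>\<xi>\<bar>)"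

definition fejer_mass :: real where
  "fejer_mass = (LINT x|lborel. fejer x)"

definition fejer_energy :: real where
  "fejer_energy = (LINT x|lborel. (fejer x)\<^sup>2)"

lemma borel_measurable_fejer [measurable]: "fejer \<in> borel_measurable borel"
  unfolding fejer_def[abs_def] by measurable

lemma borel_measurable_tent [measurable]: "tent \<in> borel_measurable borel"
  unfolding tent_def[abs_def] by measurable

lemma fejer_nonneg: "fejer x \<ge> 0"
  by (simp add: fejer_def)

lemma fejer_even: "fejer (- x) = fejer x"
  by (simp add: fejer_def)

lemma one_minus_cos_le: "1 - cos x \<le> x\<^sup>2 / (2::real)"
proof -
  have "1 - cos x = 2 * (sin (x / 2))\<^sup>2"
    using cos_double_sin[of "x / 2"] by simp
  also have "(sin (x / 2))\<^sup>2 \<le> (x / 2)\<^sup>2"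
    using abs_sin_x_le_abs_x[of "x / 2"] by (simp only: abs_le_square_iff)
  finally show ?thesis by (simp add: power_divide)
qed

lemma fejer_le_half: "fejer x \<le> 1 / 2"
  using one_minus_cos_le[of x] by (simp add: fejer_def field_simps)

lemma fejer_le: "fejer x \<le> 3 * inverse (1 + x\<^sup>2)"
proof -
  have "fejer x * x\<^sup>2 \<le> 2"
    using cos_ge_minus_one[of x] by (auto simp: fejer_def)
  then have "fejer x * (1 + x\<^sup>2) \<le> 3" using fejer_le_half[of x] by (simp add: algebra_simps)
  moreover have "1 + x\<^sup>2 > 0" by (simp add: add_pos_nonneg)
  ultimately show ?thesis by (simp add: field_simps)
qed

lemma integrable_fejer: "integrable lborel fejer"
proof -
  have "integrable lborel (\<lambda>x::real. inverse (1 + x\<^sup>2))"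
    using integrable_inverse_1_plus_square by (simp add: set_integrable_def)
  then have "integrable lborel (\<lambda>x::real. 3 * inverse (1 + x\<^sup>2))" by (rule integrable_mult_right)
  then show ?thesis
    by (rule Bochner_Integration.integrable_bound)
       (use fejer_le fejer_nonneg in \<open>auto intro!: AE_I2 order_trans[OF fejer_le]\<close>)
qed

lemma integrable_fejer_square: "integrable lborel (\<lambda>x. (fejer x)\<^sup>2)"
proof (rule Bochner_Integration.integrable_bound[OF integrable_fejer])
  have "(fejer x)\<^sup>2 \<le> fejer x" for x
    using fejer_le_half[of x] fejer_nonneg[of x] mult_left_mono[of "fejer x" 1 "fejer x"]
    by (simp add: power2_eq_square)
  then show "AE x in lborel. norm ((fejer x)\<^sup>2) \<le> norm (fejer x)"
    using fejer_nonneg by simp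
qed measurable

lemma not_AE_fejer_eq_0: "\<not> (AE x in lborel. fejer x = 0)"
proof
  assume "AE x in lborel. fejer x = 0"
  moreover have "fejer x \<noteq> 0" if "x \<in> {0<..<1}" for x
  proof -
    have "cos x < cos 0" by (rule cos_monotone_0_pi) (use that pi_gt3 in auto)
    then show ?thesis using that by (simp add: fejer_def)
  qed
  ultimately have "AE x in lborel. x \<notin> {0<..<1::real}" by (auto elim: eventually_mono)
  then have "emeasure lborel {0<..<1::real} = 0"
    by (subst (asm) AE_iff_null_sets[symmetric]) (auto simp: null_sets_def)
  then show False by simp
qed

lemma fejer_mass_pos: "fejer_mass > 0"
proof -
  have "fejer_mass \<noteq> 0" unfolding fejer_mass_def
    using integral_nonneg_eq_0_iff_AE[OF integrable_fejer] fejer_nonneg not_AE_fejer_eq_0 by auto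
  moreover have "fejer_mass \<ge> 0" unfolding fejer_mass_def by (simp add: fejer_nonneg)
  ultimately show ?thesis by simp
qed

lemma fejer_energy_pos: "fejer_energy > 0"
proof -
  have "fejer_energy \<noteq> 0" unfolding fejer_energy_def
    using integral_nonneg_eq_0_iff_AE[OF integrable_fejer_square] not_AE_fejer_eq_0 by auto
  moreover have "fejer_energy \<ge> 0" unfolding fejer_energy_def by simp
  ultimately show ?thesis by simp
qed

lemma tent_nonneg: "tent \<xi> \<ge> 0" and tent_even: "tent (- \<xi>) = tent \<xi>"
  and tent_eq_0: "\<bar>\<xi>\<bar> \<ge> 1 \<Longrightarrow> tent \<xi> = 0"
  by (auto simp: tent_def)

lemma tent_second_difference: "tent \<xi> = (\<bar>\<xi> + 1\<bar> + \<bar>\<xi> - 1\<bar> - 2 * \<bar>\<xi>\<bar>) / 2"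
  by (auto simp: tent_def abs_if max_def field_simps)

lemma integrable_tent: "integrable lborel tent"
proof (rule Bochner_Integration.integrable_bound)
  show "integrable lborel (indicator {-1..1} :: real \<Rightarrow> real)" by simp
  show "AE x in lborel. norm (tent x) \<le> norm (indicator {-1..1} x :: real)"
    by (auto simp: tent_def indicator_def)
qed measurable

lemma integrable_mult_cis:
  fixes f g :: "'b \<Rightarrow> real"
  assumes "integrable M f" and [measurable]: "g \<in> borel_measurable M"
  shows "integrable M (\<lambda>x. of_real (f x) * cis (g x))"
proof (rule Bochner_Integration.integrable_bound[OF assms(1)])
  note [measurable] = borel_measurable_integrable[OF assms(1)]
  show "(\<lambda>x. complex_of_real (f x) * cis (g x)) \<in> borel_measurable M"
    unfolding cis_conv_exp by measurable
qed (simp add: norm_mult)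

lemma integral_even_mult_cis:
  fixes f :: "real \<Rightarrow> real"
  assumes f: "integrable lborel f" and even: "\<And>x. f (- x) = f x"
  shows "(LINT x|lborel. of_real (f x) * cis (\<xi> * x)) = of_real (LINT x|lborel. f x * cos (\<xi> * x))"
proof (rule complex_eqI)
  have i: "integrable lborel (\<lambda>x. of_real (f x) * cis (\<xi> * x))"
    by (rule integrable_mult_cis[OF f]) measurable
  show "Re (LINT x|lborel. of_real (f x) * cis (\<xi> * x)) = Re (of_real (LINT x|lborel. f x * cos (\<xi> * x)))"
    using integral_Re[OF i] by simp
  have "(LINT x|lborel. f x * sin (\<xi> * x)) = - (LINT x|lborel. f x * sin (\<xi> * x))"
    by (subst lborel_integral_real_affine[of "-1" _ 0]) (simp_all add: even)
  then show "Im (LINT x|lborel. of_real (f x) * cis (\<xi> * x)) = Im (of_real (LINT x|lborel. f x * cos (\<xi> * x)))"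
    using integral_Im[OF i] by simp
qed

lemma scaled_fejer_integral:
  shows "integrable lborel (\<lambda>x. a\<^sup>2 * fejer (a * x))"
    and "(LINT x|lborel. a\<^sup>2 * fejer (a * x)) = \<bar>a\<bar> * fejer_mass"
proof -
  show "integrable lborel (\<lambda>x. a\<^sup>2 * fejer (a * x))"
    using lborel_integrable_real_affine[OF integrable_fejer, of a 0] by (cases "a = 0") auto
  show "(LINT x|lborel. a\<^sup>2 * fejer (a * x)) = \<bar>a\<bar> * fejer_mass"
  proof (cases "a = 0")
    case False
    have "fejer_mass = \<bar>a\<bar> * (LINT x|lborel. fejer (a * x))"
      unfolding fejer_mass_def using lborel_integral_real_affine[OF False, of fejer 0] by simp
    moreover have "a\<^sup>2 = \<bar>a\<bar> * \<bar>a\<bar>" by (simp add: power2_eq_square)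
    ultimately show ?thesis by (simp only: integral_mult_right_zero mult.assoc)
  qed simp
qed

text \<open>
  With \<open>1 - cos (a x) = x\<^sup>2 (a\<^sup>2 fejer (a x))\<close>, the product formula for cosines turns \<open>fejer x * cos (\<xi> x)\<close>
  into a second difference in \<open>\<xi>\<close> of rescaled kernels. Each of these integrates to \<open>\<bar>a\<bar> * fejer_mass\<close>, and the
  second difference of the absolute value is the tent. The Fourier transform of the kernel is thus
  known from its behaviour under scaling alone.
\<close>

lemma fejer_mult_cos:
  "fejer x * cos (\<xi> * x) =
    ((\<xi> + 1)\<^sup>2 * fejer ((\<xi> + 1) * x) + (\<xi> - 1)\<^sup>2 * fejer ((\<xi> - 1) * x) - 2 * (\<xi>\<^sup>2 * fejer (\<xi> * x))) / 2"
proof (cases "x = 0")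
  case True
  then show ?thesis by (simp add: fejer_def power2_eq_square field_simps)
next
  case False
  have *: "a\<^sup>2 * fejer (a * x) = (1 - cos (a * x)) / x\<^sup>2" for a
    using False by (auto simp: fejer_def power_mult_distrib)
  show ?thesis unfolding * using False
    by (simp add: fejer_def ring_distribs cos_add cos_diff field_simps)
qed

lemma fourier_fejer:
  "(LINT x|lborel. of_real (fejer x) * cis (\<xi> * x)) = of_real (fejer_mass * tent \<xi>)"
proof -
  have b: "has_bochner_integral lborel (\<lambda>x. a\<^sup>2 * fejer (a * x)) (\<bar>a\<bar> * fejer_mass)" for a
    using scaled_fejer_integral[of a] by (simp add: has_bochner_integral_iff)
  have "has_bochner_integral lborel (\<lambda>x. fejer x * cos (\<xi> * x))
      ((\<bar>\<xi> + 1\<bar> * fejer_mass + \<bar>\<xi> - 1\<bar> * fejer_mass - 2 * (\<bar>\<xi>\<bar> * fejer_mass)) / 2)"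
    unfolding fejer_mult_cos
    by (intro has_bochner_integral_divide_zero has_bochner_integral_diff has_bochner_integral_add
        has_bochner_integral_mult_right b)
  then have "(LINT x|lborel. fejer x * cos (\<xi> * x)) =
      (\<bar>\<xi> + 1\<bar> * fejer_mass + \<bar>\<xi> - 1\<bar> * fejer_mass - 2 * (\<bar>\<xi>\<bar> * fejer_mass)) / 2"
    by (rule has_bochner_integral_integral_eq)
  also have "\<dots> = fejer_mass * tent \<xi>" by (simp add: tent_second_difference algebra_simps)
  finally show ?thesis
    by (simp add: integral_even_mult_cis[OF integrable_fejer fejer_even])
qed

lemma integral_tent_cos: "(LINT \<eta>|lborel. tent \<eta> * cos (x * \<eta>)) = 2 * fejer x"
proof -
  have int: "integrable lborel (\<lambda>\<eta>. tent \<eta> * cos (x * \<eta>))"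
    by (rule Bochner_Integration.integrable_bound[OF integrable_tent])
       (auto simp: abs_mult tent_nonneg intro!: mult_left_le)
  define h where "h = (\<lambda>\<eta>. (1 - \<eta>) * cos (x * \<eta>) * indicator {0..1} \<eta> :: real)"
  have h: "has_bochner_integral lborel h (fejer x)"
  proof (cases "x = 0")
    case True
    have "has_bochner_integral lborel (\<lambda>\<eta>. (1 - \<eta>) * indicator {0..1} \<eta>) ((1 - 1\<^sup>2/2) - (0 - 0\<^sup>2/2) :: real)"
      by (rule has_bochner_integral_FTC_Icc_real) (auto intro!: derivative_eq_intros)
    then show ?thesis using True by (simp add: h_def fejer_def)
  next
    case False
    let ?F = "\<lambda>\<eta>. (1 - \<eta>) * sin (x * \<eta>) / x - cos (x * \<eta>) / x\<^sup>2"
    have "has_bochner_integral lborel (\<lambda>\<eta>. ((1 - \<eta>) * cos (x * \<eta>)) * indicator {0..1} \<eta>) (?F 1 - ?F 0)"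
      by (rule has_bochner_integral_FTC_Icc_real)
         (use False in \<open>auto intro!: derivative_eq_intros simp: field_simps power2_eq_square\<close>)
    moreover have "?F 1 - ?F 0 = fejer x" using False by (simp add: fejer_def field_simps)
    ultimately show ?thesis by (simp add: h_def)
  qed
  have h': "has_bochner_integral lborel (\<lambda>\<eta>. h (0 + (-1) * \<eta>)) (fejer x /\<^sub>R \<bar>-1\<bar>)"
    using h by (subst (asm) lborel_has_bochner_integral_real_affine_iff[of "-1" _ _ 0]) auto
  have "has_bochner_integral lborel (\<lambda>\<eta>. h \<eta> + h (- \<eta>)) (fejer x + fejer x)"
    using has_bochner_integral_add[OF h h'] by simp
  then have "(LINT \<eta>|lborel. h \<eta> + h (- \<eta>)) = 2 * fejer x"
    by (simp add: has_bochner_integral_iff)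
  moreover have "(LINT \<eta>|lborel. h \<eta> + h (- \<eta>)) = (LINT \<eta>|lborel. tent \<eta> * cos (x * \<eta>))"
  proof (rule integral_cong_AE)
    show "AE \<eta> in lborel. h \<eta> + h (- \<eta>) = tent \<eta> * cos (x * \<eta>)"
      using AE_lborel_singleton[of "0::real"]
      by eventually_elim (auto simp: h_def tent_def indicator_def)
  qed (auto simp: h_def)
  ultimately show ?thesis by simp
qed

lemma integral_tent: "(LINT \<eta>|lborel. tent \<eta>) = 1"
  using integral_tent_cos[of 0] by (simp add: fejer_def)

lemma fourier_tent:
  "(LINT \<eta>|lborel. of_real (tent \<eta>) * cis (x * \<eta>)) = of_real (2 * fejer x)"
  by (simp add: integral_even_mult_cis[OF integrable_tent tent_even] integral_tent_cos)

text \<open>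
  Writing one factor as the transform of the tent gives \<open>\<integral> tent \<eta> * tent (N + \<eta>)\<close> up to a constant, and
  the two tents do not overlap. This is the orthogonality that makes the energies of separated
  frequencies add up.
\<close>

lemma fourier_fejer_square_eq_0:
  assumes "\<bar>N\<bar> \<ge> 2"
  shows "(LINT x|lborel. of_real ((fejer x)\<^sup>2) * cis (N * x)) = 0"
proof -
  let ?f = "\<lambda>x \<eta>. of_real (fejer x * tent \<eta>) * cis ((N + \<eta>) * x)"
  have prod: "integrable (lborel \<Otimes>\<^sub>M lborel) (\<lambda>z. fejer (fst z) * tent (snd z))"
  proof (rule lborel_pair.Fubini_integrable)
    have "(\<lambda>x. LINT y|lborel. norm (fejer (fst (x, y)) * tent (snd (x, y)))) = fejer"
      by (auto simp: abs_mult fejer_nonneg tent_nonneg integral_tent)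
    then show "integrable lborel (\<lambda>x. LINT y|lborel. norm (fejer (fst (x, y)) * tent (snd (x, y))))"
      by (simp only: integrable_fejer)
    show "AE x in lborel. integrable lborel (\<lambda>y. fejer (fst (x, y)) * tent (snd (x, y)))"
      by (simp add: integrable_tent)
  qed measurable
  have int: "integrable (lborel \<Otimes>\<^sub>M lborel) (case_prod ?f)"
    unfolding case_prod_beta by (rule integrable_mult_cis[OF prod]) measurable
  have "of_real ((fejer x)\<^sup>2) * cis (N * x) = (1/2) * (LINT \<eta>|lborel. ?f x \<eta>)" for x
  proof -
    have "(LINT \<eta>|lborel. ?f x \<eta>)
        = (LINT \<eta>|lborel. (of_real (fejer x) * cis (N * x)) * (of_real (tent \<eta>) * cis (x * \<eta>)))"
      by (intro Bochner_Integration.integral_cong refl) (simp add: ring_distribs mult_ac flip: cis_mult)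
    also have "\<dots> = of_real (fejer x) * cis (N * x) * of_real (2 * fejer x)"
      unfolding integral_mult_right_zero by (simp add: fourier_tent)
    finally show ?thesis by (simp add: power2_eq_square)
  qed
  then have "(LINT x|lborel. of_real ((fejer x)\<^sup>2) * cis (N * x)) = (1/2) * (LINT x|lborel. LINT \<eta>|lborel. ?f x \<eta>)"
    by (simp only: integral_mult_right_zero)
  also have "(LINT x|lborel. LINT \<eta>|lborel. ?f x \<eta>) = (LINT \<eta>|lborel. LINT x|lborel. ?f x \<eta>)"
    using lborel_pair.Fubini_integral[OF int] by simp
  also have "\<dots> = (LINT \<eta>::real|lborel. 0)"
  proof (rule Bochner_Integration.integral_cong[OF refl])
    fix \<eta> :: real
    have "(LINT x|lborel. ?f x \<eta>) = (LINT x|lborel. of_real (tent \<eta>) * (of_real (fejer x) * cis ((N + \<eta>) * x)))"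
      by (intro Bochner_Integration.integral_cong refl) simp
    also have "\<dots> = of_real (tent \<eta>) * of_real (fejer_mass * tent (N + \<eta>))"
      unfolding integral_mult_right_zero by (simp add: fourier_fejer)
    also have "\<dots> = 0"
      using assms tent_eq_0[of \<eta>] tent_eq_0[of "N + \<eta>"] by (cases "\<bar>\<eta>\<bar> \<ge> 1") auto
    finally show "(LINT x|lborel. ?f x \<eta>) = 0" .
  qed
  finally show ?thesis by simp
qed

text \<open>
  One wave of frequency \<open>\<omega>\<close> for every \<open>\<omega>\<close> in \<open>F\<close>, under a common envelope of width \<open>1 / \<rho>\<close>; each wave
  has bandwidth \<open>\<rho>\<close>.
\<close>

definition wave_train :: "real \<Rightarrow> real set \<Rightarrow> real \<Rightarrow> complex" where
  "wave_train \<rho> F x = (\<Sum>\<omega>\<in>F. of_real (fejer (\<rho> * x)) * cis (\<omega> * x))"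

definition wave_train_hat :: "real \<Rightarrow> real set \<Rightarrow> real \<Rightarrow> real" where
  "wave_train_hat \<rho> F \<xi> = fejer_mass / \<rho> * (\<Sum>\<omega>\<in>F. tent ((\<xi> - \<omega>) / \<rho>))"

lemma integrable_scaled_fejer: "\<rho> > 0 \<Longrightarrow> integrable lborel (\<lambda>x. fejer (\<rho> * x))"
  using lborel_integrable_real_affine[OF integrable_fejer, of \<rho> 0] by simp

lemma integrable_wave_train: "\<rho> > 0 \<Longrightarrow> integrable lborel (wave_train \<rho> F)"
  unfolding wave_train_def[abs_def]
  by (intro Bochner_Integration.integrable_sum integrable_mult_cis integrable_scaled_fejer) measurable

lemma fourier_wave_train:
  assumes "\<rho> > 0"
  shows "(LINT x|lborel. wave_train \<rho> F x * cis (- (x * \<xi>))) = of_real (wave_train_hat \<rho> F \<xi>)"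
proof -
  have one: "(LINT x|lborel. of_real (fejer (\<rho> * x)) * cis ((\<omega> - \<xi>) * x)) = of_real (fejer_mass / \<rho> * tent ((\<xi> - \<omega>) / \<rho>))" for \<omega>
  proof -
    have "of_real (fejer_mass * tent ((\<omega> - \<xi>) / \<rho>)) = (LINT x|lborel. of_real (fejer x) * cis ((\<omega> - \<xi>) / \<rho> * x))"
      by (rule fourier_fejer[symmetric])
    also have "\<dots> = \<rho> *\<^sub>R (LINT x|lborel. of_real (fejer (\<rho> * x)) * cis ((\<omega> - \<xi>) * x))"
      using assms by (subst lborel_integral_real_affine[of \<rho> _ 0]) (auto simp: mult_ac)
    finally have "of_real (fejer_mass * tent ((\<omega> - \<xi>) / \<rho>))
      = of_real \<rho> * (LINT x|lborel. of_real (fejer (\<rho> * x)) * cis ((\<omega> - \<xi>) * x))"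
      by (simp only: scaleR_conv_of_real)
    moreover have "tent ((\<omega> - \<xi>) / \<rho>) = tent ((\<xi> - \<omega>) / \<rho>)"
      using tent_even[of "(\<omega> - \<xi>) / \<rho>"] by (simp add: minus_divide_left)
    ultimately show ?thesis using assms by (simp add: field_simps)
  qed
  have "(LINT x|lborel. wave_train \<rho> F x * cis (- (x * \<xi>)))
      = (LINT x|lborel. (\<Sum>\<omega>\<in>F. of_real (fejer (\<rho> * x)) * cis ((\<omega> - \<xi>) * x)))"
    unfolding wave_train_def sum_distrib_right
    by (intro Bochner_Integration.integral_cong sum.cong refl) (simp add: algebra_simps cis_mult)
  also have "\<dots> = (\<Sum>\<omega>\<in>F. LINT x|lborel. of_real (fejer (\<rho> * x)) * cis ((\<omega> - \<xi>) * x))"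
    by (intro Bochner_Integration.integral_sum integrable_mult_cis integrable_scaled_fejer assms) measurable
  finally show ?thesis by (simp add: one wave_train_hat_def sum_distrib_left)
qed

lemma wave_train_energy:
  assumes l: "\<rho> > 0" and F: "finite F"
    and sep: "\<And>\<omega> \<omega>'. \<omega> \<in> F \<Longrightarrow> \<omega>' \<in> F \<Longrightarrow> \<omega> \<noteq> \<omega>' \<Longrightarrow> \<bar>\<omega> - \<omega>'\<bar> \<ge> 2 * \<rho>"
  shows "has_bochner_integral lborel (\<lambda>x. (norm (wave_train \<rho> F x))\<^sup>2) (real (card F) * fejer_energy / \<rho>)"
proof -
  have i2: "integrable lborel (\<lambda>x. (fejer (\<rho> * x))\<^sup>2)"
    using lborel_integrable_real_affine[OF integrable_fejer_square, of \<rho> 0] l by simp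
  have i: "integrable lborel (\<lambda>x. of_real ((fejer (\<rho> * x))\<^sup>2) * cis (N * x))" for N
    by (rule integrable_mult_cis[OF i2]) measurable
  have v: "(LINT x|lborel. of_real ((fejer (\<rho> * x))\<^sup>2) * cis ((\<omega> - \<omega>') * x))
      = (if \<omega> = \<omega>' then of_real (fejer_energy / \<rho>) else 0)" if "\<omega> \<in> F" "\<omega>' \<in> F" for \<omega> \<omega>'
  proof -
    have "(LINT x|lborel. of_real ((fejer x)\<^sup>2) * cis ((\<omega> - \<omega>') / \<rho> * x))
        = \<rho> *\<^sub>R (LINT x|lborel. of_real ((fejer (\<rho> * x))\<^sup>2) * cis ((\<omega> - \<omega>') * x))"
      using l by (subst lborel_integral_real_affine[of \<rho> _ 0]) (auto simp: mult_ac)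
    moreover have "(LINT x|lborel. of_real ((fejer x)\<^sup>2) * cis ((\<omega> - \<omega>') / \<rho> * x))
        = (if \<omega> = \<omega>' then of_real fejer_energy else 0)"
    proof (cases "\<omega> = \<omega>'")
      case False
      have "\<bar>(\<omega> - \<omega>') / \<rho>\<bar> \<ge> 2" using sep[OF that False] l by (simp add: field_simps)
      then show ?thesis using fourier_fejer_square_eq_0[of "(\<omega> - \<omega>') / \<rho>"] False by simp
    qed (simp add: fejer_energy_def flip: of_real_power)
    ultimately show ?thesis using l by (auto simp: scaleR_conv_of_real field_simps)
  qed
  have sq: "complex_of_real ((norm (wave_train \<rho> F x))\<^sup>2)
      = (\<Sum>\<omega>\<in>F. \<Sum>\<omega>'\<in>F. of_real ((fejer (\<rho> * x))\<^sup>2) * cis ((\<omega> - \<omega>') * x))" for x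
    unfolding complex_norm_square wave_train_def cnj_sum sum_product
  proof (intro sum.cong refl)
    fix \<omega> \<omega>'
    have "cis ((\<omega> - \<omega>') * x) = cis (\<omega> * x) * cis (- (\<omega>' * x))"
      by (simp only: cis_mult left_diff_distrib) simp
    then show "of_real (fejer (\<rho> * x)) * cis (\<omega> * x) * cnj (of_real (fejer (\<rho> * x)) * cis (\<omega>' * x))
        = of_real ((fejer (\<rho> * x))\<^sup>2) * cis ((\<omega> - \<omega>') * x)"
      by (simp add: cis_cnj power2_eq_square)
  qed
  have "has_bochner_integral lborel (\<lambda>x. complex_of_real ((norm (wave_train \<rho> F x))\<^sup>2))
     (\<Sum>\<omega>\<in>F. \<Sum>\<omega>'\<in>F. LINT x|lborel. of_real ((fejer (\<rho> * x))\<^sup>2) * cis ((\<omega> - \<omega>') * x))"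
    unfolding sq by (intro has_bochner_integral_sum has_bochner_integral_integrable i)
  also have "(\<Sum>\<omega>\<in>F. \<Sum>\<omega>'\<in>F. LINT x|lborel. of_real ((fejer (\<rho> * x))\<^sup>2) * cis ((\<omega> - \<omega>') * x))
     = (\<Sum>\<omega>\<in>F. \<Sum>\<omega>'\<in>F. if \<omega> = \<omega>' then of_real (fejer_energy / \<rho>) else 0)"
    by (intro sum.cong refl v)
  also have "\<dots> = of_real (real (card F) * fejer_energy / \<rho>)" using F by simp
  finally show ?thesis by (auto dest: has_bochner_integral_Re simp del: of_real_power)
qed

section \<open>Products of wave trains\<close>

text \<open>
  Lebesgue measure on the vectors is the image of a product measure indexed by the basis vectors;
  the content of this proof is the transport of the index set.
\<close>

lemma integral_prod_coordinates:
  fixes h :: "'n::finite \<Rightarrow> real \<Rightarrow> 'b::{real_normed_field, banach, second_countable_topology}"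
  assumes h: "\<And>i. integrable lborel (h i)"
  shows "has_bochner_integral lborel (\<lambda>x::real^'n. \<Prod>i\<in>UNIV. h i (x $ i)) (\<Prod>i\<in>UNIV. LINT x|lborel. h i x)"
proof -
  interpret product_sigma_finite "\<lambda>b::real^'n. lborel :: real measure" by standard
  note [measurable] = borel_measurable_integrable[OF h]
  let ?B = "Basis :: (real^'n) set"
  let ?T = "\<lambda>f. \<Sum>b\<in>?B. f b *\<^sub>R b"
  have bij: "bij_betw (\<lambda>i. axis i (1::real)) UNIV ?B"
    by (auto simp: bij_betw_def inj_on_def axis_eq_axis Basis_vec_def)
  have coord: "(?T f) $ i = f (axis i 1)" for f i
  proof -
    have "(?T f) $ i = (?T f) \<bullet> axis i 1" by (simp add: inner_axis)
    also have "\<dots> = f (axis i 1)"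
      by (rule inner_sum_left_Basis) (simp add: axis_in_Basis_iff)
    finally show ?thesis .
  qed
  have pr: "(\<Prod>i\<in>UNIV. h i (f (axis i 1))) = (\<Prod>b\<in>?B. h (axis_index b) (f b))" for f
    using prod.reindex_bij_betw[OF bij, of "\<lambda>b. h (axis_index b) (f b)"] by simp
  have "has_bochner_integral (\<Pi>\<^sub>M b\<in>?B. lborel) (\<lambda>f. \<Prod>b\<in>?B. h (axis_index b) (f b))
      (\<Prod>b\<in>?B. LINT x|lborel. h (axis_index b) x)"
    unfolding has_bochner_integral_iff
    using product_integrable_prod[of ?B "\<lambda>b. h (axis_index b)"]
      product_integral_prod[of ?B "\<lambda>b. h (axis_index b)"] h by simp
  then have "has_bochner_integral (\<Pi>\<^sub>M b\<in>?B. lborel) (\<lambda>f. \<Prod>i\<in>UNIV. h i (?T f $ i))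
      (\<Prod>i\<in>UNIV. LINT x|lborel. h i x)"
    using prod.reindex_bij_betw[OF bij, of "\<lambda>b. LINT x|lborel. h (axis_index b) x"]
    by (simp only: coord pr axis_index_axis)
  then have "has_bochner_integral (distr (\<Pi>\<^sub>M b\<in>?B. lborel) borel ?T) (\<lambda>x. \<Prod>i\<in>UNIV. h i (x $ i))
      (\<Prod>i\<in>UNIV. LINT x|lborel. h i x)"
    by (intro has_bochner_integral_distr) measurable
  then show ?thesis by (simp add: lborel_eq[symmetric])
qed

lemma emeasure_coordinate_box:
  fixes S :: "'n::finite \<Rightarrow> real set"
  assumes [measurable]: "\<And>i. S i \<in> sets borel"
  shows "emeasure lborel {x::real^'n. \<forall>i. x $ i \<in> S i} = (\<Prod>i\<in>UNIV. emeasure lborel (S i))"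
proof -
  have bij: "bij_betw (\<lambda>i. axis i (1::real)) UNIV (Basis :: (real^'n) set)"
    by (auto simp: bij_betw_def inj_on_def axis_eq_axis Basis_vec_def)
  have m [measurable]: "{x::real^'n. \<forall>i. x $ i \<in> S i} \<in> sets borel" by measurable
  have "indicator {x::real^'n. \<forall>i. x $ i \<in> S i} x
      = (\<Prod>b\<in>Basis. indicator (S (axis_index b)) (x \<bullet> b) :: ennreal)" for x
  proof -
    have "(\<Prod>b\<in>Basis. indicator (S (axis_index b)) (x \<bullet> b) :: ennreal)
        = (\<Prod>i\<in>UNIV. indicator (S i) (x $ i))"
      using prod.reindex_bij_betw[OF bij, of "\<lambda>b. indicator (S (axis_index b)) (x \<bullet> b) :: ennreal"]
      by (simp add: inner_axis)
    also have "\<dots> = indicator {x::real^'n. \<forall>i. x $ i \<in> S i} x"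
      by (auto simp: indicator_def)
    finally show ?thesis by simp
  qed
  then have "emeasure lborel {x::real^'n. \<forall>i. x $ i \<in> S i}
      = (\<integral>\<^sup>+x. (\<Prod>b\<in>(Basis::(real^'n) set). indicator (S (axis_index b)) (x \<bullet> b)) \<partial>lborel)"
    by (simp flip: nn_integral_indicator)
  also have "\<dots> = (\<Prod>b\<in>(Basis::(real^'n) set). \<integral>\<^sup>+x. indicator (S (axis_index b)) x \<partial>lborel)"
    by (rule nn_integral_lborel_prod) auto
  also have "\<dots> = (\<Prod>i\<in>UNIV. emeasure lborel (S i))"
    using prod.reindex_bij_betw[OF bij, of "\<lambda>b. emeasure lborel (S (axis_index b))"] by simp
  finally show ?thesis .
qed

lemma cis_sum: "finite S \<Longrightarrow> cis (\<Sum>i\<in>S. \<theta> i) = (\<Prod>i\<in>S. cis (\<theta> i))"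
  by (induction S rule: finite_induct) (auto simp: cis_mult[symmetric])

text \<open>
  The one-dimensional evolution of a wave train, after the substitution \<open>\<xi> = \<omega> + \<rho> \<eta>\<close> in the part of
  its Fourier transform near \<open>\<omega>\<close>.
\<close>

definition wave_train_flow :: "nat \<Rightarrow> real \<Rightarrow> real set \<Rightarrow> real \<Rightarrow> real \<Rightarrow> complex" where
  "wave_train_flow k \<rho> F t x = of_real (fejer_mass / (2 * pi)) *
     (\<Sum>\<omega>\<in>F. LINT \<eta>|lborel. of_real (tent \<eta>) * cis ((\<omega> + \<rho> * \<eta>) * x + (\<omega> + \<rho> * \<eta>) ^ k * t))"

lemma inverse_fourier_wave_train_hat:
  assumes r: "\<rho> > 0"
  shows "has_bochner_integral lborel (\<lambda>\<xi>. of_real (wave_train_hat \<rho> F \<xi>) * cis (\<xi> * x + \<xi> ^ k * t))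
    (of_real (2 * pi) * wave_train_flow k \<rho> F t x)"
proof -
  let ?c = "\<lambda>\<xi>. cis (\<xi> * x + \<xi> ^ k * t)"
  have one: "has_bochner_integral lborel (\<lambda>\<xi>. of_real (tent ((\<xi> - \<omega>) / \<rho>)) * ?c \<xi>)
     (\<rho> *\<^sub>R (LINT \<eta>|lborel. of_real (tent \<eta>) * ?c (\<omega> + \<rho> * \<eta>)))" for \<omega>
  proof -
    have "has_bochner_integral lborel (\<lambda>\<eta>. of_real (tent \<eta>) * ?c (\<omega> + \<rho> * \<eta>))
      (LINT \<eta>|lborel. of_real (tent \<eta>) * ?c (\<omega> + \<rho> * \<eta>))"
      by (intro has_bochner_integral_integrable integrable_mult_cis integrable_tent) measurable
    then show ?thesis using r
      by (subst lborel_has_bochner_integral_real_affine_iff[of \<rho> _ _ \<omega>]) auto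
  qed
  have "has_bochner_integral lborel (\<lambda>\<xi>. of_real (fejer_mass / \<rho>) * (\<Sum>\<omega>\<in>F. of_real (tent ((\<xi> - \<omega>) / \<rho>)) * ?c \<xi>))
     (of_real (fejer_mass / \<rho>) * (\<Sum>\<omega>\<in>F. \<rho> *\<^sub>R (LINT \<eta>|lborel. of_real (tent \<eta>) * ?c (\<omega> + \<rho> * \<eta>))))"
    by (intro has_bochner_integral_mult_right has_bochner_integral_sum one)
  moreover have "(\<lambda>\<xi>. of_real (fejer_mass / \<rho>) * (\<Sum>\<omega>\<in>F. of_real (tent ((\<xi> - \<omega>) / \<rho>)) * ?c \<xi>))
     = (\<lambda>\<xi>. of_real (wave_train_hat \<rho> F \<xi>) * ?c \<xi>)"
    by (simp add: wave_train_hat_def sum_distrib_right sum_distrib_left mult_ac)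
  moreover have "of_real (fejer_mass / \<rho>) * (\<Sum>\<omega>\<in>F. \<rho> *\<^sub>R (LINT \<eta>|lborel. of_real (tent \<eta>) * ?c (\<omega> + \<rho> * \<eta>)))
     = of_real (2 * pi) * wave_train_flow k \<rho> F t x"
    using r by (simp add: wave_train_flow_def scaleR_conv_of_real sum_distrib_left)
  ultimately show ?thesis by simp
qed

text \<open>
  The product of the wave trains, divided by its \<open>L\<^sup>2\<close> norm \<open>sqrt M\<close>. Norm, Fourier transform and
  evolution all factorise over the coordinates.
\<close>

lemma wave_packet_family:
  fixes \<rho> :: "'n::finite \<Rightarrow> real" and F :: "'n \<Rightarrow> real set" and k :: nat
  assumes r: "\<And>i. \<rho> i > 0" and F: "\<And>i. finite (F i)" "\<And>i. F i \<noteq> {}"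
    and sep: "\<And>i \<omega> \<omega>'. \<omega> \<in> F i \<Longrightarrow> \<omega>' \<in> F i \<Longrightarrow> \<omega> \<noteq> \<omega>' \<Longrightarrow> \<bar>\<omega> - \<omega>'\<bar> \<ge> 2 * \<rho> i"
  defines "M \<equiv> \<Prod>i\<in>UNIV. real (card (F i)) * fejer_energy / \<rho> i"
  obtains f :: "real^'n \<Rightarrow> complex" where
    "square_integrable f" "norm_L2 f = 1"
    "\<And>\<xi>. fourier f \<xi> \<noteq> 0 \<Longrightarrow> (\<forall>i. \<exists>\<omega>\<in>F i. \<bar>\<xi> $ i - \<omega>\<bar> < \<rho> i)"
    "\<And>t x. norm (propagator (power_symbol k) t f x)
       = (\<Prod>i\<in>UNIV. norm (wave_train_flow k (\<rho> i) (F i) t (x $ i))) / sqrt M"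
proof -
  have M: "M > 0" unfolding M_def
    using r F fejer_energy_pos by (intro prod_pos) (simp add: card_gt_0_iff)
  define c where "c = 1 / sqrt M"
  have c: "c > 0" using M by (simp add: c_def)
  define g where "g = (\<lambda>x::real^'n. \<Prod>i\<in>UNIV. wave_train (\<rho> i) (F i) (x $ i))"
  define f where "f = (\<lambda>x. of_real c * g x)"
  have gi: "integrable lborel g"
    using integral_prod_coordinates[of "\<lambda>i. wave_train (\<rho> i) (F i)"] integrable_wave_train[OF r]
    by (auto simp: g_def has_bochner_integral_iff)
  have fi: "integrable lborel f" using gi by (simp add: f_def)
  have "has_bochner_integral lborel (\<lambda>x. (norm (g x))\<^sup>2) M"
  proof -
    have e: "has_bochner_integral lborel (\<lambda>x. (norm (wave_train (\<rho> i) (F i) x))\<^sup>2)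
       (real (card (F i)) * fejer_energy / \<rho> i)" for i
      by (rule wave_train_energy) (use r F sep in auto)
    have "has_bochner_integral lborel (\<lambda>x::real^'n. \<Prod>i\<in>UNIV. (norm (wave_train (\<rho> i) (F i) (x $ i)))\<^sup>2)
       (\<Prod>i\<in>UNIV. LINT x|lborel. (norm (wave_train (\<rho> i) (F i) x))\<^sup>2)"
      by (rule integral_prod_coordinates) (use e in \<open>auto simp: has_bochner_integral_iff\<close>)
    then show ?thesis
      using e by (simp add: g_def M_def prod_norm[symmetric] prod_power_distrib has_bochner_integral_iff)
  qed
  then have "has_bochner_integral lborel (\<lambda>x. c\<^sup>2 * (norm (g x))\<^sup>2) (c\<^sup>2 * M)"
    by (rule has_bochner_integral_mult_right)
  then have "has_bochner_integral lborel (\<lambda>x. (norm (f x))\<^sup>2) 1"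
    using M by (simp add: f_def norm_mult norm_divide power_mult_distrib c_def power_divide)
  then have 1: "square_integrable f" and 2: "norm_L2 f = 1"
    using fi by (auto simp: square_integrable_def norm_L2_def has_bochner_integral_iff)
  have ft: "fourier f \<xi> = of_real (c * (\<Prod>i\<in>UNIV. wave_train_hat (\<rho> i) (F i) (\<xi> $ i)))" for \<xi>
  proof -
    have w: "integrable lborel (\<lambda>x. wave_train (\<rho> i) (F i) x * cis (- (x * \<xi> $ i)))" for i
    proof (rule Bochner_Integration.integrable_bound[OF integrable_wave_train[OF r[of i], of "F i"]])
      note [measurable] = borel_measurable_integrable[OF integrable_wave_train[OF r[of i], of "F i"]]
      show "(\<lambda>x. wave_train (\<rho> i) (F i) x * cis (- (x * \<xi> $ i))) \<in> borel_measurable lborel"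
        unfolding cis_conv_exp by measurable
    qed (simp add: norm_mult)
    have "fourier f \<xi> = (LINT x|lborel. of_real c * (\<Prod>i\<in>UNIV. wave_train (\<rho> i) (F i) (x $ i) * cis (- (x $ i * \<xi> $ i))))"
      using fi unfolding fourier_def fourier_integral_def
      by (simp add: f_def g_def inner_vec_def prod.distrib mult.assoc sum_negf[symmetric] cis_sum del: sum_negf)
    also have "\<dots> = of_real c * (\<Prod>i\<in>UNIV. LINT x|lborel. wave_train (\<rho> i) (F i) x * cis (- (x * \<xi> $ i)))"
      using has_bochner_integral_integral_eq[OF integral_prod_coordinates[of "\<lambda>i x. wave_train (\<rho> i) (F i) x * cis (- (x * \<xi> $ i))", OF w]]
      by simp
    finally show ?thesis by (simp add: fourier_wave_train[OF r])
  qed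
  have 3: "\<forall>i. \<exists>\<omega>\<in>F i. \<bar>\<xi> $ i - \<omega>\<bar> < \<rho> i" if "fourier f \<xi> \<noteq> 0" for \<xi>
  proof
    fix i
    have "wave_train_hat (\<rho> i) (F i) (\<xi> $ i) \<noteq> 0" using that by (simp add: ft)
    then have "(\<Sum>\<omega>\<in>F i. tent ((\<xi> $ i - \<omega>) / \<rho> i)) \<noteq> 0" by (auto simp: wave_train_hat_def)
    then obtain \<omega> where \<omega>: "\<omega> \<in> F i" "tent ((\<xi> $ i - \<omega>) / \<rho> i) \<noteq> 0" by (meson sum.neutral)
    then have "\<bar>(\<xi> $ i - \<omega>) / \<rho> i\<bar> < 1" using tent_eq_0[of "(\<xi> $ i - \<omega>) / \<rho> i"] by linarith
    then have "\<bar>\<xi> $ i - \<omega>\<bar> < \<rho> i" using r[of i] by (simp add: field_simps)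
    then show "\<exists>\<omega>\<in>F i. \<bar>\<xi> $ i - \<omega>\<bar> < \<rho> i" using \<omega> by blast
  qed
  have 4: "norm (propagator (power_symbol k) t f x)
       = (\<Prod>i\<in>UNIV. norm (wave_train_flow k (\<rho> i) (F i) t (x $ i))) / sqrt M" for t x
  proof -
    have cs: "cis (\<xi> \<bullet> x + power_symbol k \<xi> * t) = (\<Prod>i\<in>UNIV. cis (\<xi> $ i * x $ i + (\<xi> $ i) ^ k * t))" for \<xi>
      by (simp add: inner_vec_def power_symbol_def sum_distrib_right flip: sum.distrib cis_sum)
    have h: "has_bochner_integral lborel (\<lambda>\<xi>. of_real (wave_train_hat (\<rho> i) (F i) \<xi>) * cis (\<xi> * x $ i + \<xi> ^ k * t))
       (of_real (2 * pi) * wave_train_flow k (\<rho> i) (F i) t (x $ i))" for i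
      by (rule inverse_fourier_wave_train_hat[OF r])
    have "(LINT \<xi>|lborel. fourier f \<xi> * cis (\<xi> \<bullet> x + power_symbol k \<xi> * t))
      = (LINT \<xi>|lborel. of_real c * (\<Prod>i\<in>UNIV. of_real (wave_train_hat (\<rho> i) (F i) (\<xi> $ i)) * cis (\<xi> $ i * x $ i + (\<xi> $ i) ^ k * t)))"
      unfolding ft cs by (simp add: prod.distrib mult.assoc)
    also have "\<dots> = of_real c * (\<Prod>i\<in>UNIV. LINT \<xi>|lborel. of_real (wave_train_hat (\<rho> i) (F i) \<xi>) * cis (\<xi> * x $ i + \<xi> ^ k * t))"
      using has_bochner_integral_integral_eq[OF integral_prod_coordinates[of
          "\<lambda>i \<xi>. of_real (wave_train_hat (\<rho> i) (F i) \<xi>) * cis (\<xi> * x $ i + \<xi> ^ k * t)"]] h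
      by (simp add: has_bochner_integral_iff)
    also have "\<dots> = of_real c * (\<Prod>i\<in>UNIV. of_real (2 * pi) * wave_train_flow k (\<rho> i) (F i) t (x $ i))"
      using h by (simp add: has_bochner_integral_iff)
    also have "\<dots> = of_real c * (of_real ((2 * pi) ^ CARD('n)) * (\<Prod>i\<in>UNIV. wave_train_flow k (\<rho> i) (F i) t (x $ i)))"
      by (simp only: prod.distrib prod_constant of_real_power)
    finally have "propagator (power_symbol k) t f x = of_real c * (\<Prod>i\<in>UNIV. wave_train_flow k (\<rho> i) (F i) t (x $ i))"
      unfolding propagator_def by simp
    then show ?thesis using M by (simp add: norm_mult norm_divide prod_norm c_def)
  qed
  show thesis using that[OF 1 2 3 4] .
qed

section \<open>Lower bounds for the evolved wave trains\<close>

lemma norm_cis_diff_le: "norm (cis a - cis b) \<le> \<bar>a - b\<bar>"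
proof -
  have "(norm (cis a - cis b))\<^sup>2 = 2 - 2 * (cos a * cos b + sin a * sin b)"
    by (simp add: cmod_power2 power2_diff algebra_simps)
  also have "\<dots> = 2 * (1 - cos (a - b))" by (simp add: cos_diff)
  also have "\<dots> \<le> (a - b)\<^sup>2" using one_minus_cos_le[of "a - b"] by simp
  finally show ?thesis by (simp add: abs_le_square_iff[symmetric])
qed

lemma norm_integral_tent_cis_diff_le:
  assumes [measurable]: "\<theta> \<in> borel_measurable borel" "\<phi> \<in> borel_measurable borel"
    and d: "\<And>\<eta>. \<bar>\<eta>\<bar> \<le> 1 \<Longrightarrow> \<bar>\<theta> \<eta> - \<phi> \<eta>\<bar> \<le> d"
  shows "norm ((LINT \<eta>|lborel. of_real (tent \<eta>) * cis (\<theta> \<eta>)) - (LINT \<eta>|lborel. of_real (tent \<eta>) * cis (\<phi> \<eta>))) \<le> d"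
proof -
  have i: "integrable lborel (\<lambda>\<eta>. of_real (tent \<eta>) * cis (\<theta> \<eta>))"
    "integrable lborel (\<lambda>\<eta>. of_real (tent \<eta>) * cis (\<phi> \<eta>))"
    by (intro integrable_mult_cis integrable_tent; measurable)+
  have "norm ((LINT \<eta>|lborel. of_real (tent \<eta>) * cis (\<theta> \<eta>)) - (LINT \<eta>|lborel. of_real (tent \<eta>) * cis (\<phi> \<eta>)))
     = norm (LINT \<eta>|lborel. of_real (tent \<eta>) * cis (\<theta> \<eta>) - of_real (tent \<eta>) * cis (\<phi> \<eta>))"
    by (simp add: Bochner_Integration.integral_diff[OF i])
  also have "\<dots> \<le> (LINT \<eta>|lborel. d * tent \<eta>)"
  proof (rule Bochner_Integration.integral_norm_bound_integral)
    show "integrable lborel (\<lambda>\<eta>. d * tent \<eta>)" using integrable_tent by simp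
    fix \<eta> :: real
    show "norm (of_real (tent \<eta>) * cis (\<theta> \<eta>) - of_real (tent \<eta>) * cis (\<phi> \<eta>)) \<le> d * tent \<eta>"
    proof (cases "\<bar>\<eta>\<bar> \<le> 1")
      case True
      have "norm (of_real (tent \<eta>) * cis (\<theta> \<eta>) - of_real (tent \<eta>) * cis (\<phi> \<eta>)) = tent \<eta> * norm (cis (\<theta> \<eta>) - cis (\<phi> \<eta>))"
        by (simp add: norm_mult tent_nonneg flip: right_diff_distrib)
      also have "\<dots> \<le> tent \<eta> * d"
        using norm_cis_diff_le[of "\<theta> \<eta>" "\<phi> \<eta>"] d[OF True] tent_nonneg by (intro mult_left_mono) auto
      finally show ?thesis by (simp add: mult.commute)
    qed (simp add: tent_eq_0)
  qed (use i in auto)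
  finally show ?thesis by (simp add: integral_tent)
qed

lemma norm_integral_tent_cis_ge:
  assumes [measurable]: "\<theta> \<in> borel_measurable borel"
    and d: "\<And>\<eta>. \<bar>\<eta>\<bar> \<le> 1 \<Longrightarrow> \<bar>\<theta> \<eta> - \<theta>\<^sub>0\<bar> \<le> 1 / 2"
  shows "1 / 2 \<le> norm (LINT \<eta>|lborel. of_real (tent \<eta>) * cis (\<theta> \<eta>))"
proof -
  have "norm ((LINT \<eta>|lborel. of_real (tent \<eta>) * cis (\<theta> \<eta>)) - (LINT \<eta>|lborel. of_real (tent \<eta>) * cis \<theta>\<^sub>0)) \<le> 1 / 2"
    by (rule norm_integral_tent_cis_diff_le) (use d in auto)
  moreover have "norm (LINT \<eta>|lborel. of_real (tent \<eta>) * cis \<theta>\<^sub>0) = 1"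
    by (simp add: integral_tent)
  ultimately show ?thesis by (smt (verit) norm_triangle_ineq2 norm_minus_commute field_sum_of_halves)
qed

lemma Abel_summation:
  fixes W z :: "nat \<Rightarrow> complex" and X :: nat
  defines "S \<equiv> \<lambda>r. \<Sum>m\<in>{X..<X + r}. z m"
  shows "(\<Sum>m\<in>{X..<X + Suc N}. W m * z m)
    = W (X + N) * S (Suc N) - (\<Sum>r\<in>{1..N}. (W (X + r) - W (X + r - 1)) * S r)"
proof (induction N)
  case (Suc N)
  have S: "S (Suc (Suc N)) = S (Suc N) + z (X + Suc N)" by (simp add: S_def)
  have "(\<Sum>m\<in>{X..<X + Suc (Suc N)}. W m * z m) = (\<Sum>m\<in>{X..<X + Suc N}. W m * z m) + W (X + Suc N) * z (X + Suc N)"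
    by simp
  then show ?case unfolding Suc.IH S by (simp add: algebra_simps)
qed (simp add: S_def)

text \<open>
  Summation by parts. A bound \<open>d\<close> on the increments of the weights charges the average of the partial
  sums and not their maximum, so that moment bounds on the partial sums are enough.
\<close>

lemma norm_weighted_sum_ge:
  fixes W z :: "nat \<Rightarrow> complex" and X :: nat
  defines "S \<equiv> \<lambda>r. \<Sum>m\<in>{X..<X + r}. z m"
  assumes N: "N > 0" and w: "w \<le> norm (W (X + N - 1))"
    and d: "\<And>m. X \<le> m \<Longrightarrow> m + 1 < X + N \<Longrightarrow> norm (W (m + 1) - W m) \<le> d" "d \<ge> 0"
  shows "w * norm (S N) - d * (\<Sum>r\<in>{1..N}. norm (S r)) \<le> norm (\<Sum>m\<in>{X..<X + N}. W m * z m)"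
proof -
  obtain N' where N': "N = Suc N'" using N by (cases N) auto
  have "norm (\<Sum>r\<in>{1..N'}. (W (X + r) - W (X + r - 1)) * S r) \<le> (\<Sum>r\<in>{1..N'}. d * norm (S r))"
  proof (rule order_trans[OF norm_sum sum_mono])
    fix r assume "r \<in> {1..N'}"
    then have "X \<le> X + r - 1" "X + r - 1 + 1 < X + N" "X + r - 1 + 1 = X + r" using N' by auto
    then have "norm (W (X + r) - W (X + r - 1)) \<le> d" using d(1)[of "X + r - 1"] by simp
    then show "norm ((W (X + r) - W (X + r - 1)) * S r) \<le> d * norm (S r)"
      unfolding norm_mult by (rule mult_right_mono) simp
  qed
  also have "\<dots> \<le> (\<Sum>r\<in>{1..N}. d * norm (S r))"
    using d(2) N' by (intro sum_mono2) auto
  finally have 1: "norm (\<Sum>r\<in>{1..N'}. (W (X + r) - W (X + r - 1)) * S r) \<le> d * (\<Sum>r\<in>{1..N}. norm (S r))"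
    by (simp add: sum_distrib_left)
  have "w * norm (S N) \<le> norm (W (X + N') * S N)"
    using w N' by (auto simp: norm_mult intro!: mult_right_mono)
  moreover have "(\<Sum>m\<in>{X..<X + N}. W m * z m)
      = W (X + N') * S N - (\<Sum>r\<in>{1..N'}. (W (X + r) - W (X + r - 1)) * S r)"
    unfolding N' S_def by (rule Abel_summation)
  ultimately show ?thesis
    using 1 norm_triangle_ineq2[of "W (X + N') * S N" "\<Sum>r\<in>{1..N'}. (W (X + r) - W (X + r - 1)) * S r"]
    by simp
qed

lemma abs_power_diff_le:
  fixes x y M :: real
  assumes "\<bar>x\<bar> \<le> M" "\<bar>y\<bar> \<le> M"
  shows "\<bar>x ^ k - y ^ k\<bar> \<le> real k * M ^ (k - 1) * \<bar>x - y\<bar>"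
proof (induction k)
  case (Suc k)
  have M: "M \<ge> 0" using assms by linarith
  have "x ^ Suc k - y ^ Suc k = x * (x ^ k - y ^ k) + (x - y) * y ^ k" by (simp add: algebra_simps)
  then have "\<bar>x ^ Suc k - y ^ Suc k\<bar> \<le> \<bar>x\<bar> * \<bar>x ^ k - y ^ k\<bar> + \<bar>x - y\<bar> * \<bar>y\<bar> ^ k"
    by (metis abs_mult abs_triangle_ineq power_abs)
  also have "\<dots> \<le> M * (real k * M ^ (k - 1) * \<bar>x - y\<bar>) + \<bar>x - y\<bar> * M ^ k"
    using assms M by (intro add_mono mult_mono Suc.IH power_mono) auto
  also have "\<dots> = real (Suc k) * M ^ (Suc k - 1) * \<bar>x - y\<bar>"
    by (cases k) (auto simp: algebra_simps)
  finally show ?case .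
qed simp

text \<open>
  The mean value theorem in the direction of \<open>b\<close>, followed by the Lipschitz bound in the direction of
  \<open>h\<close>.
\<close>

lemma abs_power_second_difference_le:
  fixes a b h M :: real
  assumes "\<And>c. c \<in> closed_segment 0 1 \<Longrightarrow> \<bar>a + c * b\<bar> \<le> M \<and> \<bar>a + c * b + h\<bar> \<le> M"
  shows "\<bar>((a + b + h) ^ k - (a + b) ^ k) - ((a + h) ^ k - a ^ k)\<bar> \<le> (real k)\<^sup>2 * M ^ (k - 2) * \<bar>b\<bar> * \<bar>h\<bar>"
proof -
  let ?f = "\<lambda>c. (a + c * b + h) ^ k - (a + c * b) ^ k"
  let ?f' = "\<lambda>c. real k * b * ((a + c * b + h) ^ (k - 1) - (a + c * b) ^ (k - 1))"
  have "\<exists>c. 0 < c \<and> c < 1 \<and> ?f 1 - ?f 0 = (1 - 0) * ?f' c"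
    by (rule MVT2) (auto intro!: derivative_eq_intros simp: algebra_simps)
  then obtain c where c: "0 < c" "c < 1" "?f 1 - ?f 0 = ?f' c" by auto
  have M: "\<bar>a + c * b\<bar> \<le> M" "\<bar>a + c * b + h\<bar> \<le> M"
    using assms[of c] c by (auto simp: closed_segment_eq_real_ivl)
  have M0: "M \<ge> 0" using M by linarith
  have "\<bar>?f' c\<bar> = real k * \<bar>b\<bar> * \<bar>(a + c * b + h) ^ (k - 1) - (a + c * b) ^ (k - 1)\<bar>"
    by (simp add: abs_mult)
  also have "\<dots> \<le> real k * \<bar>b\<bar> * (real (k - 1) * M ^ (k - 1 - 1) * \<bar>(a + c * b + h) - (a + c * b)\<bar>)"
    by (intro mult_left_mono abs_power_diff_le M) auto
  also have "\<dots> \<le> real k * \<bar>b\<bar> * (real k * M ^ (k - 2) * \<bar>h\<bar>)"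
    using M0 by (intro mult_left_mono) (auto intro!: mult_right_mono simp: numeral_2_eq_2)
  finally show ?thesis using c(3) by (simp add: power2_eq_square mult_ac)
qed

text \<open>
  On the support of the packet the phase \<open>\<xi> x + \<xi>\<^sup>k t\<close> deviates from its value at \<open>R\<close> by a linear term,
  which is small because \<open>x\<close> is close to \<open>- k R\<^sup>k\<^sup>-\<^sup>1 t\<close>, and by a quadratic term of order \<open>R\<^sup>k\<^sup>-\<^sup>1 t\<close>, since
  the bandwidth is \<open>sqrt R\<close>. Hence there is no cancellation in the integral.
\<close>

lemma high_frequency_flow_ge:
  fixes R t x \<delta> :: real
  assumes k: "k \<ge> 2" and R: "R \<ge> 1" and t: "0 \<le> t" "t * R ^ (k - 1) * ((real k)\<^sup>2 * 3 ^ k) \<le> \<delta>"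
    and d: "\<delta> \<le> 1 / 16" and x: "\<bar>x + real k * R ^ (k - 1) * t\<bar> \<le> \<delta> / sqrt R"
  shows "fejer_mass / (4 * pi) \<le> norm (wave_train_flow k (sqrt R) {R} t x)"
proof -
  let ?\<theta> = "\<lambda>\<eta>. (R + sqrt R * \<eta>) * x + (R + sqrt R * \<eta>) ^ k * t"
  have sR: "sqrt R \<le> R" "sqrt R > 0" "sqrt R * sqrt R = R" using R by (auto simp: sqrt_le_D real_le_lsqrt power2_eq_square)
  obtain k' where k': "k = Suc (Suc k')" using k by (metis add_2_eq_Suc le_Suc_ex)
  have b: "\<bar>?\<theta> \<eta> - (R * x + R ^ k * t)\<bar> \<le> 1 / 2" if "\<bar>\<eta>\<bar> \<le> 1" for \<eta>
  proof -
    define h where "h = sqrt R * \<eta>"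
    have h: "\<bar>h\<bar> \<le> sqrt R" "h\<^sup>2 \<le> R" using that sR
      by (auto simp: h_def abs_mult power_mult_distrib abs_square_le_1 intro!: mult_left_le)
    have seg: "\<exists>c. 0 < c \<and> c < 1 \<and> (R + 1 * h) ^ k - (R + 0 * h) ^ k = (1 - 0) * (real k * (R + c * h) ^ (k - 1) * h)"
      by (rule MVT2[of 0 1 "\<lambda>c. (R + c * h) ^ k"]) (auto intro!: derivative_eq_intros)
    then obtain c where c: "0 < c" "c < 1" "(R + h) ^ k - R ^ k = real k * (R + c * h) ^ (k - 1) * h" by auto
    have "\<bar>c * h\<bar> \<le> R"
    proof -
      have "\<bar>c * h\<bar> \<le> 1 * R" unfolding abs_mult using c h sR by (intro mult_mono) auto
      then show ?thesis by simp
    qed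
    then have "\<bar>(R + c * h) ^ (k - 1) - R ^ (k - 1)\<bar> \<le> real (k - 1) * (3 * R) ^ (k - 1 - 1) * \<bar>(R + c * h) - R\<bar>"
      using R by (intro abs_power_diff_le) auto
    also have "\<dots> \<le> real k * (3 * R) ^ k' * \<bar>h\<bar>"
    proof -
      have "\<bar>c * h\<bar> \<le> \<bar>h\<bar>" using c by (simp add: abs_mult mult_left_le_one_le)
      then show ?thesis using R k' by (intro mult_mono) auto
    qed
    finally have "\<bar>real k * h * ((R + c * h) ^ (k - 1) - R ^ (k - 1))\<bar> \<le> real k * \<bar>h\<bar> * (real k * (3 * R) ^ k' * \<bar>h\<bar>)"
      unfolding abs_mult by (intro mult_mono) auto
    also have "\<dots> = (real k)\<^sup>2 * (3 * R) ^ k' * h\<^sup>2" by (simp add: power2_eq_square mult_ac flip: abs_mult)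
    also have "\<dots> \<le> (real k)\<^sup>2 * (3 * R) ^ k' * R" using h R by (intro mult_left_mono) auto
    also have "\<dots> \<le> (real k)\<^sup>2 * 3 ^ k * R ^ (k - 1)" using R k' by (simp add: power_mult_distrib)
    finally have "t * \<bar>real k * h * ((R + c * h) ^ (k - 1) - R ^ (k - 1))\<bar> \<le> t * ((real k)\<^sup>2 * 3 ^ k * R ^ (k - 1))"
      using t by (intro mult_left_mono) auto
    then have 2: "\<bar>t * (real k * h * ((R + c * h) ^ (k - 1) - R ^ (k - 1)))\<bar> \<le> \<delta>"
      using t by (simp add: abs_mult mult_ac)
    have "\<bar>h * (x + real k * R ^ (k - 1) * t)\<bar> \<le> sqrt R * (\<delta> / sqrt R)"
      unfolding abs_mult using h x R by (intro mult_mono) auto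
    then have 1: "\<bar>h * (x + real k * R ^ (k - 1) * t)\<bar> \<le> \<delta>" using sR by simp
    have "?\<theta> \<eta> - (R * x + R ^ k * t) = h * x + t * ((R + h) ^ k - R ^ k)"
      by (simp add: h_def algebra_simps)
    also have "\<dots> = h * (x + real k * R ^ (k - 1) * t) + t * (real k * h * ((R + c * h) ^ (k - 1) - R ^ (k - 1)))"
      unfolding c(3) by (simp add: algebra_simps)
    finally show ?thesis using 1 2 d by linarith
  qed
  have "1 / 2 \<le> norm (LINT \<eta>|lborel. of_real (tent \<eta>) * cis (?\<theta> \<eta>))"
    by (rule norm_integral_tent_cis_ge) (use b in auto)
  then have "fejer_mass / (2 * pi) * (1 / 2) \<le> norm (wave_train_flow k (sqrt R) {R} t x)"
    unfolding wave_train_flow_def norm_mult norm_of_real using fejer_mass_pos by (intro mult_mono) auto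
  then show ?thesis by simp
qed

text \<open>
  The phase of the \<open>m\<close>-th wave is \<open>2 \<pi> (A m\<^sup>k + B m) / q\<close> plus a perturbation \<open>\<psi> m\<close>, which comes from the
  offset \<open>u\<close> and from the width of the wave. The perturbation is bounded, and it varies by \<open>O(\<delta> / X)\<close> from
  one \<open>m\<close> to the next; so the evolved train is a Weyl sum with slowly varying weights that do not
  vanish.
\<close>

lemma arithmetic_flow_ge:
  fixes L t x u \<delta> :: real and A B X q k :: nat
  assumes k: "k \<ge> 2" and L: "L \<ge> 1" and X: "X \<ge> 1" and q: "q > 0"
    and t: "t = 2 * pi * real A / (real q * L ^ k)" "t * (L * real X) ^ (k - 1) * ((real k)\<^sup>2 * 3 ^ k) \<le> \<delta>"
    and x: "x = 2 * pi * real B / (real q * L) + u" "\<bar>x\<bar> \<le> 1 / 8" "\<bar>u\<bar> * (L * real X) \<le> \<delta>"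
    and d: "\<delta> \<le> 1 / 16"
  shows "fejer_mass / (2 * pi) *
      (norm (weyl_sum k q A B X X) / 2 - 2 * \<delta> / real X * (\<Sum>r\<in>{1..X}. norm (weyl_sum k q A B X r)))
    \<le> norm (wave_train_flow k 1 ((\<lambda>m. L * real m) ` {X..<X + X}) t x)"
proof -
  define R where "R = L * real X"
  have R: "R \<ge> 1" using L X mult_mono[of 1 L 1 "real X"] by (simp add: R_def)
  have t0: "t \<ge> 0" using t L by simp
  obtain k' where k': "k = Suc (Suc k')" using k by (metis add_2_eq_Suc le_Suc_ex)
  define \<psi> where "\<psi> m \<eta> = L * real m * u + \<eta> * x + ((L * real m + \<eta>) ^ k - (L * real m) ^ k) * t" for m \<eta>
  define W where "W m = (LINT \<eta>|lborel. of_real (tent \<eta>) * cis (\<psi> m \<eta>))" for m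
  define z where "z m = echar q (int A * int m ^ k + int B * int m)" for m
  have [measurable]: "\<psi> m \<in> borel_measurable borel" for m unfolding \<psi>_def[abs_def] by measurable
  have mode: "(LINT \<eta>|lborel. of_real (tent \<eta>) * cis ((L * real m + 1 * \<eta>) * x + (L * real m + 1 * \<eta>) ^ k * t)) = W m * z m" for m
  proof -
    have "(L * real m + 1 * \<eta>) * x + (L * real m + 1 * \<eta>) ^ k * t
       = \<psi> m \<eta> + 2 * pi * real_of_int (int A * int m ^ k + int B * int m) / real q" for \<eta>
    proof -
      define c where "c = 2 * pi * real B / (real q * L)"
      have xc: "L * real m * x = L * real m * c + L * real m * u" by (simp only: x(1) c_def distrib_left)
      have a: "L * real m * c = 2 * pi * (real B * real m) / real q" using L by (simp add: c_def)
      have b: "(L * real m) ^ k * t = 2 * pi * (real A * real m ^ k) / real q" using L t(1) by (simp add: power_mult_distrib)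
      have "(L * real m + 1 * \<eta>) * x + (L * real m + 1 * \<eta>) ^ k * t
        = \<psi> m \<eta> + L * real m * c + (L * real m) ^ k * t"
        using xc unfolding \<psi>_def by (simp add: algebra_simps)
      then show ?thesis unfolding a b by (simp add: add_divide_distrib distrib_left)
    qed
    then have "(LINT \<eta>|lborel. of_real (tent \<eta>) * cis ((L * real m + 1 * \<eta>) * x + (L * real m + 1 * \<eta>) ^ k * t))
       = (LINT \<eta>|lborel. of_real (tent \<eta>) * cis (\<psi> m \<eta>) * z m)"
      by (simp only: z_def echar_def mult.assoc flip: cis_mult)
    also have "\<dots> = W m * z m" unfolding W_def by simp
    finally show ?thesis .
  qed
  have "inj_on (\<lambda>m. L * real m) {X..<X + X}" using L by (auto simp: inj_on_def)
  then have flow: "wave_train_flow k 1 ((\<lambda>m. L * real m) ` {X..<X + X}) t x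
     = of_real (fejer_mass / (2 * pi)) * (\<Sum>m\<in>{X..<X + X}. W m * z m)"
    unfolding wave_train_flow_def by (simp only: sum.reindex comp_def mode)
  have tR: "t * ((real k)\<^sup>2 * (3 * R) ^ (k - 1)) \<le> \<delta>"
  proof -
    have "t * ((real k)\<^sup>2 * (3 * R) ^ (k - 1)) \<le> t * ((real k)\<^sup>2 * (3 * (3 * R) ^ (k - 1)))"
      using t0 R by (intro mult_left_mono) auto
    also have "\<dots> = t * R ^ (k - 1) * ((real k)\<^sup>2 * 3 ^ k)" using k' by (simp add: power_mult_distrib)
    finally show ?thesis using t(2) by (simp add: R_def)
  qed
  have \<delta>0: "\<delta> \<ge> 0" using tR t0 R by (smt (verit) mult_nonneg_nonneg zero_le_power zero_le_power2)
  have Lm: "0 \<le> L * real m" "L * real m \<le> 2 * R" if "m \<le> X + X" for m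
  proof -
    show "0 \<le> L * real m" using L by simp
    have "L * real m \<le> L * real (X + X)" using L that by (intro mult_left_mono) auto
    then show "L * real m \<le> 2 * R" by (simp add: R_def)
  qed
  have W1: "1 / 2 \<le> norm (W (X + X - 1))" unfolding W_def
  proof (rule norm_integral_tent_cis_ge[where \<theta>\<^sub>0 = 0])
    fix \<eta> :: real assume \<eta>: "\<bar>\<eta>\<bar> \<le> 1"
    let ?a = "L * real (X + X - 1)"
    have a: "0 \<le> ?a" "?a \<le> 2 * R" using Lm[of "X + X - 1"] by auto
    have "\<bar>(?a + \<eta>) ^ k - ?a ^ k\<bar> \<le> real k * (3 * R) ^ (k - 1) * \<bar>?a + \<eta> - ?a\<bar>"
      using a R \<eta> by (intro abs_power_diff_le) auto
    also have "\<dots> \<le> real k * (3 * R) ^ (k - 1) * 1" using \<eta> R by (intro mult_left_mono) auto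
    also have "\<dots> \<le> (real k)\<^sup>2 * (3 * R) ^ (k - 1)"
      using k R by (auto simp: power2_eq_square intro!: mult_right_mono)
    finally have "t * \<bar>(?a + \<eta>) ^ k - ?a ^ k\<bar> \<le> t * ((real k)\<^sup>2 * (3 * R) ^ (k - 1))"
      using t0 by (rule mult_left_mono)
    then have 1: "\<bar>((?a + \<eta>) ^ k - ?a ^ k) * t\<bar> \<le> \<delta>" using tR t0 by (simp add: abs_mult mult.commute)
    have "\<bar>?a * u\<bar> \<le> 2 * R * \<bar>u\<bar>" unfolding abs_mult using a by (intro mult_right_mono) auto
    then have 2: "\<bar>?a * u\<bar> \<le> 2 * \<delta>" using x(3) by (simp add: R_def mult_ac)
    have "\<bar>\<eta> * x\<bar> \<le> 1 * (1 / 8)" unfolding abs_mult using \<eta> x by (intro mult_mono) auto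
    then show "\<bar>\<psi> (X + X - 1) \<eta> - 0\<bar> \<le> 1 / 2" unfolding \<psi>_def using 1 2 d by linarith
  qed measurable
  have W2: "norm (W (m + 1) - W m) \<le> 2 * \<delta> / real X" if m: "X \<le> m" "m + 1 < X + X" for m
    unfolding W_def
  proof (rule norm_integral_tent_cis_diff_le)
    fix \<eta> :: real assume \<eta>: "\<bar>\<eta>\<bar> \<le> 1"
    let ?a = "L * real m"
    have a: "0 \<le> ?a" "?a + L \<le> 2 * R" using Lm[of m] Lm[of "m + 1"] m by (auto simp: distrib_left)
    have e: "\<psi> (m + 1) \<eta> - \<psi> m \<eta> = L * u + (((?a + L + \<eta>) ^ k - (?a + L) ^ k) - ((?a + \<eta>) ^ k - ?a ^ k)) * t"
      by (simp add: \<psi>_def algebra_simps)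
    have "\<bar>((?a + L + \<eta>) ^ k - (?a + L) ^ k) - ((?a + \<eta>) ^ k - ?a ^ k)\<bar> \<le> (real k)\<^sup>2 * (3 * R) ^ (k - 2) * \<bar>L\<bar> * \<bar>\<eta>\<bar>"
    proof (rule abs_power_second_difference_le)
      fix c :: real assume c: "c \<in> closed_segment 0 1"
      have "0 \<le> c * L" "c * L \<le> L" using c L by (auto simp: closed_segment_eq_real_ivl mult_left_le_one_le)
      then show "\<bar>?a + c * L\<bar> \<le> 3 * R \<and> \<bar>?a + c * L + \<eta>\<bar> \<le> 3 * R" using a \<eta> R by (intro conjI abs_leI) linarith+
    qed
    also have "\<dots> \<le> (real k)\<^sup>2 * (3 * R) ^ (k - 2) * L * 1"
      using \<eta> L R by (intro mult_mono) auto
    finally have "t * \<bar>((?a + L + \<eta>) ^ k - (?a + L) ^ k) - ((?a + \<eta>) ^ k - ?a ^ k)\<bar> \<le> t * ((real k)\<^sup>2 * (3 * R) ^ (k - 2) * L)"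
      using t0 by (intro mult_left_mono) auto
    also have "\<dots> \<le> \<delta> / real X"
    proof -
      have "t * ((real k)\<^sup>2 * (3 * R) ^ (k - 2) * L) * real X = t * ((real k)\<^sup>2 * (3 * R) ^ (k - 2) * R)" by (simp add: R_def mult_ac)
      also have "\<dots> \<le> t * ((real k)\<^sup>2 * (3 * R) ^ (k - 2) * (3 * R))" using t0 R by (intro mult_left_mono) auto
      also have "\<dots> = t * ((real k)\<^sup>2 * (3 * R) ^ (k - 1))" using k' by simp
      also have "\<dots> \<le> \<delta>" by (rule tR)
      finally show ?thesis using X by (simp add: field_simps)
    qed
    finally have 1: "\<bar>(((?a + L + \<eta>) ^ k - (?a + L) ^ k) - ((?a + \<eta>) ^ k - ?a ^ k)) * t\<bar> \<le> \<delta> / real X"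
      using t0 by (simp add: abs_mult mult.commute)
    have 2: "\<bar>L * u\<bar> \<le> \<delta> / real X" using x(3) X L by (simp add: abs_mult field_simps)
    show "\<bar>\<psi> (m + 1) \<eta> - \<psi> m \<eta>\<bar> \<le> 2 * \<delta> / real X" unfolding e using 1 2 by linarith
  qed measurable
  have S: "(\<Sum>m\<in>{X..<X + r}. z m) = weyl_sum k q A B X r" for r by (simp add: z_def weyl_sum_def)
  have "1 / 2 * norm (weyl_sum k q A B X X) - 2 * \<delta> / real X * (\<Sum>r\<in>{1..X}. norm (weyl_sum k q A B X r))
      \<le> norm (\<Sum>m\<in>{X..<X + X}. W m * z m)"
    using norm_weighted_sum_ge[of X "1/2" W X "2 * \<delta> / real X" z] X W1 W2 \<delta>0 unfolding S by simp
  then have "fejer_mass / (2 * pi) * (1 / 2 * norm (weyl_sum k q A B X X) - 2 * \<delta> / real X * (\<Sum>r\<in>{1..X}. norm (weyl_sum k q A B X r)))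
      \<le> fejer_mass / (2 * pi) * norm (\<Sum>m\<in>{X..<X + X}. W m * z m)"
    using fejer_mass_pos by (intro mult_left_mono) auto
  then show ?thesis unfolding flow norm_mult norm_of_real using fejer_mass_pos by simp
qed

section \<open>Combs with prime denominators\<close>

lemma measure_Union_ge_Bonferroni:
  assumes "finite P" "\<And>q. q \<in> P \<Longrightarrow> \<Omega> q \<in> fmeasurable M"
  shows "(\<Sum>q\<in>P. measure M (\<Omega> q)) - (\<Sum>q\<in>P. \<Sum>q'\<in>P - {q}. measure M (\<Omega> q \<inter> \<Omega> q'))
    \<le> measure M (\<Union>q\<in>P. \<Omega> q)"
  using assms
proof (induction P rule: finite_induct)
  case (insert p P)
  let ?U = "\<Union>q\<in>P. \<Omega> q"
  let ?m = "\<lambda>q q'. measure M (\<Omega> q \<inter> \<Omega> q')"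
  have U: "?U \<in> fmeasurable M" using insert by (intro fmeasurable.finite_UN) auto
  have p: "\<Omega> p \<in> fmeasurable M" using insert by simp
  have "measure M (\<Omega> p \<inter> ?U) \<le> (\<Sum>q\<in>P. ?m p q)"
  proof -
    have "\<Omega> p \<inter> ?U = (\<Union>q\<in>P. \<Omega> p \<inter> \<Omega> q)" by auto
    also have "measure M \<dots> \<le> (\<Sum>q\<in>P. ?m p q)"
      using insert by (intro measure_UNION_le) (auto intro!: fmeasurableD)
    finally show ?thesis .
  qed
  moreover have "measure M (\<Omega> p \<union> ?U) = measure M (\<Omega> p) + measure M ?U - measure M (\<Omega> p \<inter> ?U)"
    using measure_Un3[OF p U] .
  moreover have "(\<Sum>q\<in>P. measure M (\<Omega> q)) - (\<Sum>q\<in>P. \<Sum>q'\<in>P - {q}. ?m q q') \<le> measure M ?U"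
    using insert by (intro insert.IH) auto
  moreover have "(\<Sum>q\<in>P. ?m p q) + (\<Sum>q\<in>P. \<Sum>q'\<in>P - {q}. ?m q q')
      \<le> (\<Sum>q\<in>insert p P. \<Sum>q'\<in>insert p P - {q}. ?m q q')"
  proof -
    have "(\<Sum>q\<in>P. \<Sum>q'\<in>P - {q}. ?m q q') \<le> (\<Sum>q\<in>P. \<Sum>q'\<in>insert p P - {q}. ?m q q')"
      using insert by (intro sum_mono sum_mono2) auto
    moreover have "insert p P - {p} = P" using insert by auto
    ultimately show ?thesis using insert by simp
  qed
  ultimately show ?case using insert by simp
qed simp

lemma measure_coordinate_box:
  fixes S :: "'n::finite \<Rightarrow> real set"
  assumes S: "\<And>i. S i \<in> fmeasurable lborel"
  shows "{x::real^'n. \<forall>i. x $ i \<in> S i} \<in> fmeasurable lborel"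
    and "measure lborel {x::real^'n. \<forall>i. x $ i \<in> S i} = (\<Prod>i\<in>UNIV. measure lborel (S i))"
proof -
  have [measurable]: "S i \<in> sets borel" for i using S[of i] by (auto dest: fmeasurableD)
  have e: "emeasure lborel {x::real^'n. \<forall>i. x $ i \<in> S i} = ennreal (\<Prod>i\<in>UNIV. measure lborel (S i))"
    by (simp add: emeasure_coordinate_box emeasure_eq_measure2 S prod_ennreal)
  moreover have "{x::real^'n. \<forall>i. x $ i \<in> S i} \<in> sets lborel" by simp
  ultimately show "{x::real^'n. \<forall>i. x $ i \<in> S i} \<in> fmeasurable lborel"
    by (intro fmeasurableI) auto
  show "measure lborel {x::real^'n. \<forall>i. x $ i \<in> S i} = (\<Prod>i\<in>UNIV. measure lborel (S i))"
    using e by (simp add: measure_def prod_nonneg)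
qed

text \<open>
  The positions at which an evolved wave train is close to a Weyl sum modulo \<open>q\<close>; in the application
  \<open>\<beta> = 2 \<pi> / L\<close> is the period of the train.
\<close>

definition comb :: "real \<Rightarrow> nat \<Rightarrow> real \<Rightarrow> nat set \<Rightarrow> real set" where
  "comb \<beta> q \<rho> T = (\<Union>B\<in>T. {\<beta> * real B / real q - \<rho>..\<beta> * real B / real q + \<rho>})"

lemma fmeasurable_Icc [simp]: "{a..b::real} \<in> fmeasurable lborel"
  by (rule fmeasurableI) (simp_all add: emeasure_lborel_Icc_eq)

lemma comb_fmeasurable: "finite T \<Longrightarrow> comb \<beta> q \<rho> T \<in> fmeasurable lborel"
  unfolding comb_def by (intro fmeasurable.finite_UN) auto

lemma comb_teeth_disjoint:
  assumes "2 * \<rho> < \<beta> / real q" "\<rho> \<ge> 0" "q > 0" "B \<noteq> B'"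
  shows "{\<beta> * real B / real q - \<rho>..\<beta> * real B / real q + \<rho>} \<inter>
    {\<beta> * real B' / real q - \<rho>..\<beta> * real B' / real q + \<rho>} = {}"
proof -
  have c: "\<beta> / real q > 0" using assms by linarith
  have "1 \<le> \<bar>real B - real B'\<bar>" using assms(4) by linarith
  then have "\<beta> / real q * 1 \<le> \<beta> / real q * \<bar>real B - real B'\<bar>" using c by (intro mult_left_mono) auto
  also have "\<dots> = \<bar>\<beta> / real q * (real B - real B')\<bar>" using c by (simp only: abs_mult abs_of_pos)
  also have "\<beta> / real q * (real B - real B') = \<beta> * real B / real q - \<beta> * real B' / real q"
    by (simp add: algebra_simps diff_divide_distrib)
  finally show ?thesis using assms(1) by auto
qed

lemma measure_comb:
  assumes "2 * \<rho> < \<beta> / real q" "\<rho> \<ge> 0" "q > 0" "finite T"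
  shows "measure lborel (comb \<beta> q \<rho> T) = real (card T) * (2 * \<rho>)"
proof -
  have "measure lborel (comb \<beta> q \<rho> T)
      = (\<Sum>B\<in>T. measure lborel {\<beta> * real B / real q - \<rho>..\<beta> * real B / real q + \<rho>})"
    unfolding comb_def using assms comb_teeth_disjoint[OF assms(1-3)]
    by (intro measure_finite_Union) (auto simp: disjoint_family_on_def)
  also have "\<dots> = real (card T) * (2 * \<rho>)" using assms by simp
  finally show ?thesis .
qed

text \<open>
  Two intervals meet only if \<open>v = B q' - B' q\<close> is at most \<open>M = 2 \<rho> q q' / \<beta>\<close> in absolute value. Here \<open>v\<close>
  is not 0, because \<open>q\<close> does not divide \<open>B\<close>; and \<open>v\<close> determines \<open>B\<close> modulo \<open>q\<close>. With \<open>J\<close> periods there are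
  at most
  \<open>2 M J\<close> such pairs, which is the number expected for independent sets. Counting the nonzero \<open>v\<close> only
  is essential when \<open>M\<close> is small.
\<close>

lemma measure_comb_Int_le:
  fixes q q' J :: nat
  assumes q: "prime q" "prime q'" "q \<noteq> q'" and b: "\<beta> > 0" "\<rho> \<ge> 0"
    and T: "T \<subseteq> {B \<in> {1..q * J}. \<not> q dvd B}" and T': "T' \<subseteq> {B \<in> {1..q' * J}. \<not> q' dvd B}"
  shows "measure lborel (comb \<beta> q \<rho> T \<inter> comb \<beta> q' \<rho> T') \<le> 8 * \<rho>\<^sup>2 * real q * real q' * real J / \<beta>"
proof -
  have q0: "q > 0" "q' > 0" using q by (auto simp: prime_gt_0_nat)
  have cop: "coprime (int q) (int q')" using q by (simp add: primes_coprime)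
  define M where "M = 2 * \<rho> * real q * real q' / \<beta>"
  have M0: "M \<ge> 0" using b by (simp add: M_def)
  define Pr where "Pr = {(B, B') \<in> T \<times> T'. \<bar>real B * real q' - real B' * real q\<bar> \<le> M}"
  have finT: "finite T" "finite T'" using T T' by (auto intro: finite_subset)
  have finPr: "finite Pr" unfolding Pr_def by (rule finite_subset[of _ "T \<times> T'"]) (use finT in auto)
  let ?I = "\<lambda>B. {\<beta> * real B / real q - \<rho>..\<beta> * real B / real q + \<rho>}"
  have sub: "comb \<beta> q \<rho> T \<inter> comb \<beta> q' \<rho> T' \<subseteq> (\<Union>z\<in>Pr. ?I (fst z))"
  proof
    fix x assume "x \<in> comb \<beta> q \<rho> T \<inter> comb \<beta> q' \<rho> T'"
    then obtain B B' where B: "B \<in> T" "x \<in> ?I B" and B': "B' \<in> T'" "\<bar>x - \<beta> * real B' / real q'\<bar> \<le> \<rho>"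
      by (auto simp: comb_def abs_le_iff)
    have "\<bar>\<beta> * real B / real q - \<beta> * real B' / real q'\<bar> \<le> 2 * \<rho>" using B B' by auto
    also have "\<beta> * real B / real q - \<beta> * real B' / real q' = \<beta> / (real q * real q') * (real B * real q' - real B' * real q)"
      using q0 by (simp add: field_simps)
    finally have "\<beta> / (real q * real q') * \<bar>real B * real q' - real B' * real q\<bar> \<le> 2 * \<rho>"
      using b by (simp add: abs_mult)
    then have "\<bar>real B * real q' - real B' * real q\<bar> \<le> M"
      using b q0 by (simp add: M_def field_simps)
    then have "(B, B') \<in> Pr" using B B' by (simp add: Pr_def)
    then show "x \<in> (\<Union>z\<in>Pr. ?I (fst z))" using B by force
  qed
  define V where "V = {- \<lfloor>M\<rfloor>..\<lfloor>M\<rfloor>} - {0}"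
  have cardV: "real (card V) \<le> 2 * M"
  proof -
    have "card V = card {- \<lfloor>M\<rfloor>..\<lfloor>M\<rfloor>} - 1" unfolding V_def using M0 by (subst card_Diff_singleton) auto
    also have "\<dots> = nat (2 * \<lfloor>M\<rfloor>)" by simp
    finally have "real (card V) = 2 * real_of_int \<lfloor>M\<rfloor>" using M0 by simp
    then show ?thesis by linarith
  qed
  have cardPr: "card Pr \<le> card (V \<times> {..<J})"
  proof (rule card_inj_on_le[where f = "\<lambda>(B, B'). (int B * int q' - int B' * int q, B div q)"])
    show "inj_on (\<lambda>(B, B'). (int B * int q' - int B' * int q, B div q)) Pr"
    proof (rule inj_onI, clarify)
      fix B B' C C'
      assume e: "int B * int q' - int B' * int q = int C * int q' - int C' * int q" "B div q = C div q"
      have "int q dvd (int B - int C) * int q'"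
      proof -
        have "(int B - int C) * int q' = (int B' - int C') * int q" using e(1) by (simp add: algebra_simps)
        then show ?thesis by simp
      qed
      then have "int q dvd int B - int C" using cop by (simp add: coprime_dvd_mult_left_iff)
      then have "B mod q = C mod q"
        using cong_int_iff[of B C q] by (simp add: cong_iff_dvd_diff cong_def)
      then have BC: "B = C" using e(2) by (metis div_mult_mod_eq)
      then show "B = C \<and> B' = C'" using e(1) q0 by simp
    qed
    show "(\<lambda>(B, B'). (int B * int q' - int B' * int q, B div q)) ` Pr \<subseteq> V \<times> {..<J}"
    proof (clarify, intro conjI SigmaI)
      fix B B' assume "(B, B') \<in> Pr"
      then have B: "B \<in> T" "B' \<in> T'" "\<bar>real B * real q' - real B' * real q\<bar> \<le> M" by (auto simp: Pr_def)
      have nd: "\<not> q dvd B" "B \<le> q * J" using B T by auto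
      have "\<bar>real_of_int (int B * int q' - int B' * int q)\<bar> \<le> M" using B(3) by (simp only: of_int_diff of_int_mult of_int_of_nat_eq)
      then have "\<bar>int B * int q' - int B' * int q\<bar> \<le> \<lfloor>M\<rfloor>" by (simp only: le_floor_iff of_int_abs)
      moreover have "int B * int q' - int B' * int q \<noteq> 0"
      proof
        assume "int B * int q' - int B' * int q = 0"
        then have "int q dvd int B * int q'" by (metis dvd_triv_right eq_iff_diff_eq_0)
        then have "int q dvd int B" using cop by (simp add: coprime_dvd_mult_left_iff)
        then show False using nd by simp
      qed
      ultimately show "int B * int q' - int B' * int q \<in> V" by (auto simp: V_def)
      have "B < q * J" using nd by (metis dvd_triv_left le_neq_implies_less)
      then show "B div q \<in> {..<J}" by (simp add: less_mult_imp_div_less mult.commute)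
    qed
  qed (simp add: V_def)
  have "measure lborel (comb \<beta> q \<rho> T \<inter> comb \<beta> q' \<rho> T') \<le> measure lborel (\<Union>z\<in>Pr. ?I (fst z))"
    using finPr finT
    by (intro measure_mono_fmeasurable sub fmeasurable.finite_UN)
       (auto intro!: sets.Int fmeasurableD[OF comb_fmeasurable, simplified])
  also have "\<dots> \<le> (\<Sum>z\<in>Pr. measure lborel (?I (fst z)))"
    using finPr by (intro measure_UNION_le) auto
  also have "\<dots> = real (card Pr) * (2 * \<rho>)" using b by simp
  also have "\<dots> \<le> real (card (V \<times> {..<J})) * (2 * \<rho>)" using cardPr b by (intro mult_right_mono) auto
  also have "\<dots> \<le> (2 * M * real J) * (2 * \<rho>)"
    using cardV b by (intro mult_right_mono) (auto simp: card_cartesian_product intro!: mult_right_mono)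
  also have "\<dots> = 8 * \<rho>\<^sup>2 * real q * real q' * real J / \<beta>" by (simp add: M_def power2_eq_square)
  finally show ?thesis .
qed

text \<open>
  The region of points at which the packet focuses at the time with index \<open>A\<close>, if \<open>T\<close> consists of the
  good indices \<open>B\<close>. The distinguished coordinate is negative because the packet moves in the negative
  direction.
\<close>

definition focus_box :: "'n \<Rightarrow> real \<Rightarrow> real \<Rightarrow> real \<Rightarrow> real \<Rightarrow> nat \<Rightarrow> nat \<Rightarrow> nat set \<Rightarrow> (real^'n::finite) set" where
  "focus_box i0 \<alpha> r1 \<beta> r2 q A T = {x. \<forall>i. x $ i \<in> (if i = i0
     then {- (\<alpha> * real A / real q) - r1..- (\<alpha> * real A / real q) + r1} else comb \<beta> q r2 T)}"

lemma prod_distinguished: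
  "(\<Prod>i\<in>(UNIV::'n::finite set). if i = i0 then a else b) = a * b ^ (CARD('n) - 1)" for a b :: real
proof -
  have "(\<Prod>i\<in>(UNIV::'n set). if i = i0 then a else b) = a * (\<Prod>i\<in>UNIV - {i0}. if i = i0 then a else b)"
    by (subst prod.remove[of UNIV i0]) auto
  also have "(\<Prod>i\<in>UNIV - {i0}. if i = i0 then a else b) = (\<Prod>i\<in>(UNIV::'n set) - {i0}. b)"
    by (intro prod.cong) auto
  finally show ?thesis by simp
qed

lemma measure_focus_box:
  fixes i0 :: "'n::finite"
  assumes "finite T" "r1 \<ge> 0" "2 * r2 < \<beta> / real q" "r2 \<ge> 0" "q > 0"
  shows "focus_box i0 \<alpha> r1 \<beta> r2 q A T \<in> fmeasurable lborel"
    and "measure lborel (focus_box i0 \<alpha> r1 \<beta> r2 q A T)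
      = 2 * r1 * (real (card T) * (2 * r2)) ^ (CARD('n) - 1)"
proof -
  let ?S = "\<lambda>i. if i = i0 then {- (\<alpha> * real A / real q) - r1..- (\<alpha> * real A / real q) + r1} else comb \<beta> q r2 T"
  have S: "?S i \<in> fmeasurable lborel" for i using assms comb_fmeasurable by auto
  show "focus_box i0 \<alpha> r1 \<beta> r2 q A T \<in> fmeasurable lborel"
    unfolding focus_box_def by (rule measure_coordinate_box(1)[OF S])
  have "measure lborel (focus_box i0 \<alpha> r1 \<beta> r2 q A T) = (\<Prod>i\<in>UNIV. measure lborel (?S i))"
    unfolding focus_box_def by (rule measure_coordinate_box(2)[OF S])
  also have "\<dots> = (\<Prod>i\<in>UNIV. if i = i0 then 2 * r1 else real (card T) * (2 * r2))"
    using assms by (intro prod.cong refl) (auto simp: measure_comb)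
  finally show "measure lborel (focus_box i0 \<alpha> r1 \<beta> r2 q A T)
      = 2 * r1 * (real (card T) * (2 * r2)) ^ (CARD('n) - 1)" by (simp add: prod_distinguished)
qed

text \<open>
  By Bonferroni's inequality the union has at least half of the total measure once the pairwise
  intersections are at most half of it, which is what the hypothesis \<open>sparse\<close> says. In an
  intersection of the sets of two primes the distinguished coordinate is merely confined to
  \<open>[-1, 1]\<close>; the gain comes from the other coordinates.
\<close>

lemma measure_focus_boxes_ge:
  fixes i0 :: "'n::finite" and P :: "nat set" and J J' :: nat and \<alpha> \<beta> r1 r2 g b Z :: real
  assumes P: "finite P" "\<And>q. q \<in> P \<Longrightarrow> prime q" "\<And>q. q \<in> P \<Longrightarrow> real q \<le> Z"
    and G: "\<And>q. q \<in> P \<Longrightarrow> G q \<subseteq> {1..q * J}" "\<And>q. q \<in> P \<Longrightarrow> g \<le> real (card (G q))"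
    and \<B>: "\<And>q A. q \<in> P \<Longrightarrow> A \<in> G q \<Longrightarrow> \<B> q A \<subseteq> {B \<in> {1..q * J'}. \<not> q dvd B}"
      "\<And>q A. q \<in> P \<Longrightarrow> A \<in> G q \<Longrightarrow> b \<le> real (card (\<B> q A))"
    and sep: "\<And>q. q \<in> P \<Longrightarrow> 2 * r1 < \<alpha> / real q" "\<And>q. q \<in> P \<Longrightarrow> 2 * r2 < \<beta> / real q"
    and pos: "r1 \<ge> 0" "r2 \<ge> 0" "\<alpha> > 0" "\<beta> > 0" "b \<ge> 0" "g \<ge> 0" and in1: "\<alpha> * real J + r1 \<le> 1"
    and sparse: "real (card P) * (2 * (8 * r2\<^sup>2 * Z\<^sup>2 * real J' / \<beta>) ^ (CARD('n) - 1))
      \<le> g * (2 * r1) * (b * (2 * r2)) ^ (CARD('n) - 1) / 2"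
  defines "\<Omega> \<equiv> \<lambda>q. \<Union>A\<in>G q. focus_box i0 \<alpha> r1 \<beta> r2 q A (\<B> q A)"
  shows "(\<Union>q\<in>P. \<Omega> q) \<in> fmeasurable lborel"
    and "real (card P) * (g * (2 * r1) * (b * (2 * r2)) ^ (CARD('n) - 1)) / 2 \<le> measure lborel (\<Union>q\<in>P. \<Omega> q)"
proof -
  let ?box = "\<lambda>q A. focus_box i0 \<alpha> r1 \<beta> r2 q A (\<B> q A)"
  let ?d = "CARD('n) - 1"
  let ?a = "g * (2 * r1) * (b * (2 * r2)) ^ ?d"
  let ?e = "8 * r2\<^sup>2 * Z\<^sup>2 * real J' / \<beta>"
  have q0: "q > 0" if "q \<in> P" for q using P(2)[OF that] by (rule prime_gt_0_nat)
  have finG: "finite (G q)" if "q \<in> P" for q using G(1)[OF that] by (rule finite_subset) simp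
  have finB: "finite (\<B> q A)" if "q \<in> P" "A \<in> G q" for q A using \<B>(1)[OF that] by (rule finite_subset) simp
  have boxm: "?box q A \<in> fmeasurable lborel" if "q \<in> P" "A \<in> G q" for q A
    by (rule measure_focus_box(1)) (use that finB pos sep q0 in auto)
  have \<Omega>m: "\<Omega> q \<in> fmeasurable lborel" if "q \<in> P" for q
    unfolding \<Omega>_def using that finG boxm by (intro fmeasurable.finite_UN) auto
  show "(\<Union>q\<in>P. \<Omega> q) \<in> fmeasurable lborel" using P(1) \<Omega>m by (intro fmeasurable.finite_UN) auto
  have low: "?a \<le> measure lborel (\<Omega> q)" if q: "q \<in> P" for q
  proof -
    have "measure lborel (\<Omega> q) = (\<Sum>A\<in>G q. measure lborel (?box q A))"
      unfolding \<Omega>_def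
    proof (rule measure_finite_Union)
      show "disjoint_family_on (\<lambda>A. ?box q A) (G q)"
        unfolding disjoint_family_on_def
      proof safe
        fix A A' x assume "A \<noteq> A'" and x: "x \<in> ?box q A"
          "x \<in> ?box q A'"
        have "x $ i0 \<in> {- (\<alpha> * real A / real q) - r1..- (\<alpha> * real A / real q) + r1}"
          "x $ i0 \<in> {- (\<alpha> * real A' / real q) - r1..- (\<alpha> * real A' / real q) + r1}"
          using x by (auto simp: focus_box_def dest!: spec[of _ i0])
        then have "- (x $ i0) \<in> {\<alpha> * real A / real q - r1..\<alpha> * real A / real q + r1} \<inter>
            {\<alpha> * real A' / real q - r1..\<alpha> * real A' / real q + r1}" by auto
        then show "x \<in> {}" using comb_teeth_disjoint[OF sep(1)[OF q] pos(1) q0[OF q] \<open>A \<noteq> A'\<close>] by blast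
      qed
      show "(\<lambda>A. ?box q A) ` G q \<subseteq> sets lborel"
        using fmeasurableD[OF boxm[OF q]] by blast
      show "emeasure lborel (?box q A) \<noteq> \<infinity>" if "A \<in> G q" for A
        using fmeasurableD2[OF boxm[OF q that]] by simp
    qed (use finG q in auto)
    also have "\<dots> \<ge> (\<Sum>A\<in>G q. 2 * r1 * (b * (2 * r2)) ^ ?d)"
    proof (rule sum_mono)
      fix A assume A: "A \<in> G q"
      have "measure lborel (?box q A) = 2 * r1 * (real (card (\<B> q A)) * (2 * r2)) ^ ?d"
        by (rule measure_focus_box(2)) (use q A finB pos sep q0 in auto)
      also have "\<dots> \<ge> 2 * r1 * (b * (2 * r2)) ^ ?d"
        using pos \<B>(2)[OF q A] by (intro mult_left_mono power_mono mult_right_mono) auto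
      finally show "2 * r1 * (b * (2 * r2)) ^ ?d \<le> measure lborel (?box q A)" .
    qed
    also have "(\<Sum>A\<in>G q. 2 * r1 * (b * (2 * r2)) ^ ?d) = real (card (G q)) * (2 * r1 * (b * (2 * r2)) ^ ?d)" by simp
    also have "\<dots> \<ge> g * (2 * r1 * (b * (2 * r2)) ^ ?d)"
      using G(2)[OF q] pos by (intro mult_right_mono) auto
    finally show ?thesis by (simp add: mult.assoc)
  qed
  have up: "measure lborel (\<Omega> q \<inter> \<Omega> q') \<le> 2 * ?e ^ ?d" if q: "q \<in> P" "q' \<in> P" "q \<noteq> q'" for q q'
  proof -
    define T where "T q = {B \<in> {1..q * J'}. \<not> q dvd B}" for q
    have finT: "finite (T q)" for q by (simp add: T_def)
    let ?C = "comb \<beta> q r2 (T q) \<inter> comb \<beta> q' r2 (T q')"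
    let ?S = "\<lambda>i. if i = i0 then {-1..1} else ?C"
    have C: "?C \<in> fmeasurable lborel" using comb_fmeasurable[OF finT] fmeasurableD[OF comb_fmeasurable[OF finT]]
      by (intro fmeasurable_Int_fmeasurable) auto
    have S: "?S i \<in> fmeasurable lborel" for i using C by auto
    have "\<Omega> q \<inter> \<Omega> q' \<subseteq> {x. \<forall>i. x $ i \<in> ?S i}"
    proof (intro subsetI CollectI allI)
      fix x i assume x: "x \<in> \<Omega> q \<inter> \<Omega> q'"
      then obtain A A' where A: "A \<in> G q" "x \<in> ?box q A"
        and A': "A' \<in> G q'" "x \<in> ?box q' A'" by (auto simp: \<Omega>_def)
      show "x $ i \<in> ?S i"
      proof (cases "i = i0")
        case True
        have "A \<le> q * J" using A(1) G(1)[OF q(1)] by auto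
        then have "real A \<le> real q * real J" by (metis of_nat_le_iff of_nat_mult)
        then have "real A / real q \<le> real J" using q0[OF q(1)] by (simp add: field_simps)
        then have "\<alpha> * (real A / real q) \<le> \<alpha> * real J" using pos by (intro mult_left_mono) auto
        then have "\<alpha> * real A / real q \<le> \<alpha> * real J" by simp
        moreover have "0 \<le> \<alpha> * real A / real q" "0 \<le> \<alpha> * real J" using pos by simp_all
        moreover have "x $ i0 \<in> {- (\<alpha> * real A / real q) - r1..- (\<alpha> * real A / real q) + r1}"
          using A(2) by (auto simp: focus_box_def dest!: spec[of _ i0])
        ultimately have "x $ i0 \<in> {-1..1}" using in1 unfolding atLeastAtMost_iff by (intro conjI) linarith+
        then show ?thesis using True by simp
      next
        case False
        have "x $ i \<in> comb \<beta> q r2 (\<B> q A)" "x $ i \<in> comb \<beta> q' r2 (\<B> q' A')"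
          using A(2) A'(2) False by (auto simp: focus_box_def dest!: spec[of _ i])
        moreover have "comb \<beta> q r2 (\<B> q A) \<subseteq> comb \<beta> q r2 (T q)" "comb \<beta> q' r2 (\<B> q' A') \<subseteq> comb \<beta> q' r2 (T q')"
          using \<B>(1)[OF q(1) A(1)] \<B>(1)[OF q(2) A'(1)] unfolding comb_def T_def by blast+
        ultimately show ?thesis using False by auto
      qed
    qed
    then have "measure lborel (\<Omega> q \<inter> \<Omega> q') \<le> measure lborel {x::real^'n. \<forall>i. x $ i \<in> ?S i}"
    proof (rule measure_mono_fmeasurable)
      show "\<Omega> q \<inter> \<Omega> q' \<in> sets lborel"
        using fmeasurableD[OF \<Omega>m[OF q(1)]] fmeasurableD[OF \<Omega>m[OF q(2)]] by (rule sets.Int)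
    qed (rule measure_coordinate_box(1)[OF S])
    also have "\<dots> = (\<Prod>i\<in>UNIV. measure lborel (?S i))" by (rule measure_coordinate_box(2)[OF S])
    also have "\<dots> = (\<Prod>i\<in>UNIV. if i = i0 then 2 else measure lborel ?C)" by (intro prod.cong) auto
    also have "\<dots> = 2 * measure lborel ?C ^ ?d" by (rule prod_distinguished)
    also have "\<dots> \<le> 2 * ?e ^ ?d"
    proof (intro mult_left_mono power_mono)
      have "measure lborel ?C \<le> 8 * r2\<^sup>2 * real q * real q' * real J' / \<beta>"
        using P(2) q pos by (intro measure_comb_Int_le) (auto simp: T_def)
      also have "\<dots> = 8 * r2\<^sup>2 * (real q * real q') * real J' / \<beta>" by simp
      also have "\<dots> \<le> 8 * r2\<^sup>2 * (Z * Z) * real J' / \<beta>"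
        using P(3)[OF q(1)] P(3)[OF q(2)] pos
        by (intro divide_right_mono mult_right_mono mult_left_mono mult_mono) (auto intro: order_trans[OF of_nat_0_le_iff])
      finally show "measure lborel ?C \<le> ?e" by (simp add: power2_eq_square)
    qed auto
    finally show ?thesis .
  qed
  have "real (card P) * ?a \<le> (\<Sum>q\<in>P. measure lborel (\<Omega> q))"
    using sum_mono[of P "\<lambda>_. ?a" "\<lambda>q. measure lborel (\<Omega> q)"] low by simp
  moreover have "(\<Sum>q\<in>P. \<Sum>q'\<in>P - {q}. measure lborel (\<Omega> q \<inter> \<Omega> q')) \<le> real (card P) * (?a / 2)"
  proof -
    have e0: "0 \<le> ?e" using pos by simp
    have "(\<Sum>q\<in>P. \<Sum>q'\<in>P - {q}. measure lborel (\<Omega> q \<inter> \<Omega> q')) \<le> (\<Sum>q\<in>P. \<Sum>q'\<in>P - {q}. 2 * ?e ^ ?d)"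
      by (intro sum_mono up) auto
    also have "\<dots> \<le> (\<Sum>q\<in>P. \<Sum>q'\<in>P. 2 * ?e ^ ?d)"
      using P(1) e0 by (intro sum_mono sum_mono2) auto
    also have "\<dots> = real (card P) * (real (card P) * (2 * ?e ^ ?d))" by simp
    also have "\<dots> \<le> real (card P) * (?a / 2)" by (intro mult_left_mono sparse) auto
    finally show ?thesis .
  qed
  moreover have "(\<Sum>q\<in>P. measure lborel (\<Omega> q)) - (\<Sum>q\<in>P. \<Sum>q'\<in>P - {q}. measure lborel (\<Omega> q \<inter> \<Omega> q'))
    \<le> measure lborel (\<Union>q\<in>P. \<Omega> q)"
    by (rule measure_Union_ge_Bonferroni[OF P(1) \<Omega>m])
  ultimately show "real (card P) * ?a / 2 \<le> measure lborel (\<Union>q\<in>P. \<Omega> q)" by simp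
qed

section \<open>The construction at a single scale\<close>

lemma prod_ge_distinguished:
  fixes h :: "'n::finite \<Rightarrow> real"
  assumes "0 \<le> a" "a \<le> h i0" "0 \<le> b" "\<And>i. i \<noteq> i0 \<Longrightarrow> b \<le> h i"
  shows "a * b ^ (CARD('n) - 1) \<le> (\<Prod>i\<in>UNIV. h i)"
proof -
  have "a * b ^ (CARD('n) - 1) = (\<Prod>i\<in>(UNIV::'n set). if i = i0 then a else b)"
    by (rule prod_distinguished[symmetric])
  also have "\<dots> \<le> (\<Prod>i\<in>UNIV. h i)" using assms by (intro prod_mono) auto
  finally show ?thesis .
qed

text \<open>
  The packet of the construction: the frequency \<open>R\<close> with bandwidth \<open>sqrt R\<close> in the coordinate \<open>i0\<close>, and
  the progression \<open>L m\<close> with bandwidth 1 in the others. The hypothesis \<open>16 \<delta> T \<le> 1\<close> lets the loss in the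
  summation by parts cost at most half of the Weyl sum.
\<close>

lemma focusing_packet:
  fixes i0 :: "'n::finite" and k X :: nat and L \<delta> T :: real
  defines "R \<equiv> L * real X"
  assumes k: "k \<ge> 2" and L: "L \<ge> 2" and X: "X \<ge> 1" and R4: "R \<ge> 4"
    and \<delta>: "\<delta> > 0" "\<delta> \<le> 1 / 16" "16 * \<delta> * T \<le> 1"
  obtains f :: "real^'n \<Rightarrow> complex" where
    "square_integrable f" "norm_L2 f = 1"
    "\<And>\<xi>. fourier f \<xi> \<noteq> 0 \<Longrightarrow> R / 2 \<le> norm \<xi> \<and> norm \<xi> \<le> 3 * real CARD('n) * R"
    "\<And>t x q A. q > 0 \<Longrightarrow> t = 2 * pi * real A / (real q * L ^ k) \<Longrightarrow>
       t * R ^ (k - 1) * ((real k)\<^sup>2 * 3 ^ k) \<le> \<delta> \<Longrightarrow>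
       \<bar>x $ i0 + real k * R ^ (k - 1) * t\<bar> \<le> \<delta> / sqrt R \<Longrightarrow>
       (\<And>i. i \<noteq> i0 \<Longrightarrow> \<bar>x $ i\<bar> \<le> 1 / 8 \<and>
          (\<exists>B. \<bar>x $ i - 2 * pi * real B / (real q * L)\<bar> * R \<le> \<delta> \<and> large_weyl_pair k q X T A B)) \<Longrightarrow>
       fejer_mass / (4 * pi) / sqrt (fejer_energy / sqrt R) *
         (fejer_mass / (16 * pi * sqrt (real q)) * real X / sqrt (real X * fejer_energy)) ^ (CARD('n) - 1)
       \<le> norm (propagator (power_symbol k) t f x)"
proof -
  let ?d = "CARD('n) - 1"
  define \<rho> where "\<rho> = (\<lambda>i. if i = i0 then sqrt R else 1)"
  define F where "F = (\<lambda>i. if i = i0 then {R} else (\<lambda>m. L * real m) ` {X..<X + X})"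
  define M where "M = (\<Prod>i\<in>UNIV. real (card (F i)) * fejer_energy / \<rho> i)"
  have R0: "R > 0" using R4 by simp
  have sR: "sqrt R \<le> R / 2"
  proof -
    have "R \<le> (R / 2)\<^sup>2" using R4 by (simp add: power2_eq_square field_simps)
    then show ?thesis using R0 by (intro real_le_lsqrt) auto
  qed
  have inj: "inj_on (\<lambda>m. L * real m) {X..<X + X}" using L by (auto simp: inj_on_def)
  have M: "M = fejer_energy / sqrt R * (real X * fejer_energy) ^ ?d"
  proof -
    have "M = (\<Prod>i\<in>UNIV. if i = i0 then fejer_energy / sqrt R else real X * fejer_energy)"
      unfolding M_def F_def \<rho>_def by (intro prod.cong refl) (auto simp: card_image[OF inj])
    then show ?thesis by (simp add: prod_distinguished)
  qed
  have 1: "\<rho> i > 0" for i using R0 by (simp add: \<rho>_def)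
  have 2: "finite (F i)" for i by (simp add: F_def)
  have 3: "F i \<noteq> {}" for i using X by (simp add: F_def)
  have 4: "\<bar>\<omega> - \<omega>'\<bar> \<ge> 2 * \<rho> i" if w: "\<omega> \<in> F i" "\<omega>' \<in> F i" "\<omega> \<noteq> \<omega>'" for i \<omega> \<omega>'
  proof (cases "i = i0")
    case False
    then obtain m m' where m: "\<omega> = L * real m" "\<omega>' = L * real m'" using w by (auto simp: F_def)
    then have "1 \<le> \<bar>real m - real m'\<bar>" using w(3) by (cases "m = m'") (auto simp: abs_if)
    then have "L * 1 \<le> L * \<bar>real m - real m'\<bar>" using L by (intro mult_left_mono) auto
    also have "\<dots> = \<bar>\<omega> - \<omega>'\<bar>" using L by (simp add: m abs_mult flip: right_diff_distrib)
    finally show ?thesis using False L by (simp add: \<rho>_def)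
  qed (use w in \<open>simp add: F_def\<close>)
  obtain f :: "real^'n \<Rightarrow> complex" where f: "square_integrable f" "norm_L2 f = 1"
    "\<And>\<xi>. fourier f \<xi> \<noteq> 0 \<Longrightarrow> (\<forall>i. \<exists>\<omega>\<in>F i. \<bar>\<xi> $ i - \<omega>\<bar> < \<rho> i)"
    "\<And>t x. norm (propagator (power_symbol k) t f x)
       = (\<Prod>i\<in>UNIV. norm (wave_train_flow k (\<rho> i) (F i) t (x $ i))) / sqrt M"
    by (rule wave_packet_family[where \<rho> = \<rho> and F = F and k = k, OF 1 2 3 4, folded M_def],
        assumption, assumption, assumption) (rule that)
  show thesis
  proof (rule that[OF f(1,2)])
    fix \<xi> assume "fourier f \<xi> \<noteq> 0"
    from f(3)[OF this] have \<xi>: "\<exists>\<omega>\<in>F i. \<bar>\<xi> $ i - \<omega>\<bar> < \<rho> i" for i by blast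
    have "\<bar>\<xi> $ i0 - R\<bar> < sqrt R" using \<xi>[of i0] by (simp add: F_def \<rho>_def)
    then have "R / 2 \<le> \<bar>\<xi> $ i0\<bar>" using sR by linarith
    also have "\<dots> \<le> norm \<xi>" by (rule component_le_norm_cart)
    finally have low: "R / 2 \<le> norm \<xi>" .
    have "\<bar>\<xi> $ i\<bar> \<le> 3 * R" for i
    proof (cases "i = i0")
      case True
      then show ?thesis using \<open>\<bar>\<xi> $ i0 - R\<bar> < sqrt R\<close> sR R0 by (simp add: abs_if split: if_splits)
    next
      case False
      then obtain m where m: "m < X + X" "\<bar>\<xi> $ i - L * real m\<bar> < 1" using \<xi>[of i] by (auto simp: F_def \<rho>_def)
      have "L * real m \<le> L * real (X + X)" using m L by (intro mult_left_mono) auto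
      then have "L * real m \<le> 2 * R" by (simp add: R_def)
      moreover have "0 \<le> L * real m" using L by simp
      ultimately show ?thesis using m(2) R4 by linarith
    qed
    then have "(\<Sum>i\<in>UNIV. \<bar>\<xi> $ i\<bar>) \<le> (\<Sum>i\<in>(UNIV::'n set). 3 * R)" by (intro sum_mono) auto
    then have "norm \<xi> \<le> 3 * real CARD('n) * R" using norm_le_l1_cart[of \<xi>] by simp
    with low show "R / 2 \<le> norm \<xi> \<and> norm \<xi> \<le> 3 * real CARD('n) * R" by simp
  next
    fix t :: real and x :: "real^'n" and q A :: nat
    assume q: "q > 0" and t: "t = 2 * pi * real A / (real q * L ^ k)" "t * R ^ (k - 1) * ((real k)\<^sup>2 * 3 ^ k) \<le> \<delta>"
      and x0: "\<bar>x $ i0 + real k * R ^ (k - 1) * t\<bar> \<le> \<delta> / sqrt R"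
      and x: "\<And>i. i \<noteq> i0 \<Longrightarrow> \<bar>x $ i\<bar> \<le> 1 / 8 \<and>
          (\<exists>B. \<bar>x $ i - 2 * pi * real B / (real q * L)\<bar> * R \<le> \<delta> \<and> large_weyl_pair k q X T A B)"
    let ?w = "fejer_mass / (16 * pi * sqrt (real q)) * real X"
    have t0: "t \<ge> 0" using t(1) L by simp
    have sq: "sqrt (real q) > 0" using q by simp
    have "fejer_mass / (4 * pi) * ?w ^ ?d \<le> (\<Prod>i\<in>UNIV. norm (wave_train_flow k (\<rho> i) (F i) t (x $ i)))"
    proof (rule prod_ge_distinguished[of _ _ i0])
      show "0 \<le> fejer_mass / (4 * pi)" using fejer_mass_pos by simp
      show "0 \<le> ?w" using fejer_mass_pos by simp
      show "fejer_mass / (4 * pi) \<le> norm (wave_train_flow k (\<rho> i0) (F i0) t (x $ i0))"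
        using high_frequency_flow_ge[OF k _ t0 t(2) \<delta>(2) x0] R4 by (simp add: \<rho>_def F_def)
      fix i assume i: "i \<noteq> i0"
      from x[OF i] obtain B where B: "\<bar>x $ i - 2 * pi * real B / (real q * L)\<bar> * R \<le> \<delta>"
         "real X / (2 * sqrt (real q)) \<le> cmod (weyl_sum k q A B X X)"
         "(\<Sum>r\<in>{1..X}. cmod (weyl_sum k q A B X r)) \<le> T * (real X)\<^sup>2 / sqrt (real q)" and x8: "\<bar>x $ i\<bar> \<le> 1 / 8"
        by (auto simp: large_weyl_pair_def)
      have "2 * \<delta> / real X * (\<Sum>r\<in>{1..X}. norm (weyl_sum k q A B X r)) \<le> 2 * \<delta> / real X * (T * (real X)\<^sup>2 / sqrt (real q))"
        using B(3) \<delta> by (intro mult_left_mono) auto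
      also have "\<dots> = (2 * \<delta> * T) * (real X / sqrt (real q))" using X by (simp add: power2_eq_square)
      also have "\<dots> \<le> 1 / 8 * (real X / sqrt (real q))" using \<delta>(3) by (intro mult_right_mono) auto
      finally have D: "2 * \<delta> / real X * (\<Sum>r\<in>{1..X}. norm (weyl_sum k q A B X r)) \<le> 1 / 8 * (real X / sqrt (real q))" .
      have "1 / 4 * (real X / sqrt (real q)) \<le> norm (weyl_sum k q A B X X) / 2" using B(2) by simp
      with D have "1 / 8 * (real X / sqrt (real q)) \<le>
        norm (weyl_sum k q A B X X) / 2 - 2 * \<delta> / real X * (\<Sum>r\<in>{1..X}. norm (weyl_sum k q A B X r))" by linarith
      then have "fejer_mass / (2 * pi) * (1 / 8 * (real X / sqrt (real q))) \<le> fejer_mass / (2 * pi) *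
        (norm (weyl_sum k q A B X X) / 2 - 2 * \<delta> / real X * (\<Sum>r\<in>{1..X}. norm (weyl_sum k q A B X r)))"
        using fejer_mass_pos by (intro mult_left_mono) auto
      also have "\<dots> \<le> norm (wave_train_flow k 1 ((\<lambda>m. L * real m) ` {X..<X + X}) t (x $ i))"
        by (rule arithmetic_flow_ge[where u = "x $ i - 2 * pi * real B / (real q * L)" and t = t])
           (use k L X q t B(1) x8 \<delta> in \<open>auto simp: R_def\<close>)
      finally show "?w \<le> norm (wave_train_flow k (\<rho> i) (F i) t (x $ i))"
        using i by (simp add: \<rho>_def F_def)
    qed
    then have "fejer_mass / (4 * pi) * ?w ^ ?d / sqrt M \<le> norm (propagator (power_symbol k) t f x)"
      unfolding f(4) by (intro divide_right_mono) (simp_all add: M fejer_energy_pos less_imp_le R0)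
    moreover have "fejer_mass / (4 * pi) * ?w ^ ?d / sqrt M =
       fejer_mass / (4 * pi) / sqrt (fejer_energy / sqrt R) * (?w / sqrt (real X * fejer_energy)) ^ ?d"
    proof -
      have "u * w ^ ?d / (s * z ^ ?d) = u / s * (w / z) ^ ?d" for u w s z :: real
        by (simp add: power_divide)
      then show ?thesis by (simp only: M real_sqrt_mult[of "fejer_energy / sqrt R"] real_sqrt_power)
    qed
    ultimately show "fejer_mass / (4 * pi) / sqrt (fejer_energy / sqrt R) * (?w / sqrt (real X * fejer_energy)) ^ ?d
       \<le> norm (propagator (power_symbol k) t f x)" by simp
  qed
qed

lemma maximal_function_integral_ge:
  assumes S: "S \<in> sets lborel" "S \<subseteq> U" "U \<in> sets lborel"
    and V: "V \<ge> 0" "\<And>x. x \<in> S \<Longrightarrow> \<exists>t. 0 < t \<and> t < 1 \<and> V \<le> norm (propagator P t f x)"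
    and m: "S \<in> fmeasurable lborel"
  shows "ennreal (V * measure lborel S) \<le> norm_L1_on U (maximal_function P f)"
proof -
  have "ennreal (V * measure lborel S) = ennreal V * emeasure lborel S"
    using V m by (simp add: emeasure_eq_measure2 ennreal_mult)
  also have "\<dots> = (\<integral>\<^sup>+x. ennreal V * indicator S x \<partial>lborel)"
    using S by (simp add: nn_integral_cmult_indicator)
  also have "\<dots> \<le> (\<integral>\<^sup>+x. maximal_function P f x * indicator U x \<partial>lborel)"
  proof (rule nn_integral_mono)
    fix x
    show "ennreal V * indicator S x \<le> maximal_function P f x * indicator U x"
    proof (cases "x \<in> S")
      case True
      then obtain t where t: "t \<in> {0<..<1}" "V \<le> norm (propagator P t f x)" using V(2) by auto
      have "ennreal V \<le> ennreal (norm (propagator P t f x))" using t(2) by (rule ennreal_leI)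
      also have "\<dots> \<le> maximal_function P f x" unfolding maximal_function_def using t(1) by (rule SUP_upper)
      finally show ?thesis using True S by auto
    qed simp
  qed
  finally show ?thesis unfolding norm_L1_on_def .
qed

lemma half_le_floor: "x \<ge> 1 \<Longrightarrow> x / 2 \<le> real (nat \<lfloor>x\<rfloor>)" for x :: real
proof -
  assume x: "x \<ge> 1"
  then have "1 \<le> \<lfloor>x\<rfloor>" by (simp add: le_floor_iff)
  then have "1 \<le> real_of_int \<lfloor>x\<rfloor>" by simp
  moreover have "x < real_of_int \<lfloor>x\<rfloor> + 1" by linarith
  moreover have "real (nat \<lfloor>x\<rfloor>) = real_of_int \<lfloor>x\<rfloor>" using x by simp
  ultimately show ?thesis by linarith
qed

text \<open>
  All constants depend on \<open>n\<close>, \<open>k\<close> and \<open>\<Lambda>\<close> only. The choice \<open>sqrt R = X\<^sup>k / Q\<close> balances the distinguished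
  coordinate: consecutive times \<open>2 \<pi> A / (q L\<^sup>k)\<close> move the packet by a distance comparable to the
  resolution \<open>1 / sqrt R\<close>, so the admissible positions are disjoint and yet fill a positive
  proportion. The number of primes enters twice, as a factor in the measure of the good set and through
  the sparsity condition that bounds the overlaps.
\<close>

lemma single_scale_bound:
  fixes k :: nat and \<Lambda> :: real
  assumes n: "CARD('n::finite) \<ge> 2" and k: "k \<ge> 2" and Lam: "\<Lambda> \<ge> 1"
  shows "\<exists>c Y \<kappa>. c > 0 \<and> Y \<ge> 1 \<and> \<kappa> > 0 \<and> (\<forall>Q X P R.
     Y \<le> real Q \<longrightarrow> Y * real Q \<le> real X \<longrightarrow> finite P \<longrightarrow>
     (\<forall>q\<in>P. prime q \<and> Q \<le> q \<and> real q \<le> \<Lambda> * real Q) \<longrightarrow>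
     real (card P) * (real Q / real X) ^ (CARD('n) - 1) \<le> \<kappa> \<longrightarrow>
     R = (real X ^ k / real Q)\<^sup>2 \<longrightarrow>
     (\<exists>f :: real^'n \<Rightarrow> complex. square_integrable f \<and> norm_L2 f = 1 \<and>
        (\<forall>\<xi>. fourier f \<xi> \<noteq> 0 \<longrightarrow> R / 2 \<le> norm \<xi> \<and> norm \<xi> \<le> 3 * real CARD('n) * R) \<and>
        ennreal (c * sqrt (sqrt R) * real (card P) * sqrt (real Q / real X) ^ (CARD('n) - 1))
          \<le> norm_L1_on (ball 0 1) (maximal_function (power_symbol k) f)))"
proof -
  define d where "d = CARD('n) - 1"
  define N where "N = real CARD('n)"
  define p where "p = 1 / (64 * (real k + 1))"
  define T where "T = sqrt (8 / p)"
  \<comment> \<open>The factor \<open>T\<close> serves the summation by parts, the factor \<open>\<Lambda>\<close> the disjointness of the time windows.\<close>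
  define \<delta> where "\<delta> = 1 / (16 * \<Lambda> * T)"
  \<comment> \<open>All times used are at most \<open>\<tau> / R\<^sup>k\<^sup>-\<^sup>1\<close>, which keeps the nonlinear phases below \<open>\<delta>\<close> and the points in the unit ball.\<close>
  define \<tau> where "\<tau> = \<delta> / (16 * N * (real k)\<^sup>2 * 3 ^ k)"
  define c1 where "c1 = p / 4 * (\<tau> * \<delta> / (2 * pi)) * (p * \<delta> / (128 * pi * N)) ^ d"
  define c2 where "c2 = \<delta>\<^sup>2 * \<Lambda>\<^sup>2 / (8 * pi\<^sup>2 * N)"
  define c4 where "c4 = fejer_mass / (4 * pi * sqrt fejer_energy) * (fejer_mass / (16 * pi * sqrt (\<Lambda> * fejer_energy))) ^ d"
  define c where "c = c4 * c1 / 2"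
  define \<kappa> where "\<kappa> = c1 / (4 * c2 ^ d)"
  define Y where "Y = 4 + real k + 4 / p + \<Lambda> + 32 * pi * N + 2 * pi / \<tau>"
  have N2: "N \<ge> 2" using n by (simp add: N_def)
  have p0: "p > 0" and p1: "p \<le> 1" by (auto simp: p_def)
  have T1: "T \<ge> 1" unfolding T_def using p0 p1 by (simp add: field_simps)
  have k2: "real k \<ge> 2" using k by simp
  have d0: "\<delta> > 0" using Lam T1 by (simp add: \<delta>_def)
  have dT: "16 * \<delta> * T * \<Lambda> = 1" using Lam T1 by (simp add: \<delta>_def)
  have TL: "T * \<Lambda> \<ge> 1" using T1 Lam mult_mono[of 1 T 1 \<Lambda>] by simp
  have d16: "\<delta> \<le> 1 / 16"
  proof -
    have "16 * \<delta> * 1 \<le> 16 * \<delta> * (T * \<Lambda>)" using TL d0 by (intro mult_left_mono) auto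
    also have "\<dots> = 1" using dT by (simp only: mult.assoc)
    finally show ?thesis by simp
  qed
  have dT1: "16 * \<delta> * T \<le> 1"
  proof -
    have "16 * \<delta> * T * 1 \<le> 16 * \<delta> * T * \<Lambda>" using Lam d0 T1 by (intro mult_left_mono) auto
    then show ?thesis unfolding dT by simp
  qed
  have dLam: "\<delta> * \<Lambda> \<le> 1 / 16"
  proof -
    have "16 * \<delta> * \<Lambda> * 1 \<le> 16 * \<delta> * \<Lambda> * T" using T1 d0 Lam by (intro mult_left_mono) auto
    also have "\<dots> = 16 * \<delta> * T * \<Lambda>" by simp
    finally show ?thesis unfolding dT by simp
  qed
  have K1: "(real k)\<^sup>2 * 3 ^ k \<ge> 1" using k2 by (intro mult_ge1_I) auto
  have tau0: "\<tau> > 0" using d0 N2 k2 by (simp add: \<tau>_def)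
  have tauK: "\<tau> * ((real k)\<^sup>2 * 3 ^ k) = \<delta> / (16 * N)" using k2 by (simp add: \<tau>_def)
  have tauk: "\<tau> * real k \<le> 1 / (16 * N)"
  proof -
    have "real k * 1 \<le> real k * (real k * 3 ^ k)" using k2 by (intro mult_left_mono) (auto intro!: mult_ge1_I)
    then have "real k \<le> (real k)\<^sup>2 * 3 ^ k" by (simp add: power2_eq_square mult.assoc)
    then have "\<tau> * real k \<le> \<tau> * ((real k)\<^sup>2 * 3 ^ k)" using tau0 by (intro mult_left_mono) auto
    also have "\<dots> = \<delta> / (16 * N)" by (rule tauK)
    also have "\<dots> \<le> 1 / (16 * N)" using d16 N2 by (intro divide_right_mono) auto
    finally show ?thesis .
  qed
  have tau1: "\<tau> < 1"
  proof -
    have "\<tau> * 1 \<le> \<tau> * ((real k)\<^sup>2 * 3 ^ k)" using K1 tau0 by (intro mult_left_mono) auto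
    also have "\<dots> < 1" unfolding tauK using d16 N2 by (simp add: field_simps)
    finally show ?thesis by simp
  qed
  have c1: "c1 > 0" using p0 tau0 d0 N2 by (simp add: c1_def)
  have c2: "c2 > 0" using d0 Lam N2 by (simp add: c2_def)
  have c4: "c4 > 0" using fejer_mass_pos fejer_energy_pos Lam by (simp add: c4_def)
  have Ybig: "Y \<ge> 4" "Y \<ge> real k + 1" "Y \<ge> 4 / p" "Y \<ge> \<Lambda>" "Y \<ge> 32 * pi * N" "Y \<ge> 2 * pi / \<tau>"
    using p0 Lam N2 tau0 pi_gt_zero k2 by (auto simp: Y_def intro!: add_increasing2 add_increasing)
  have main: "\<exists>f :: real^'n \<Rightarrow> complex. square_integrable f \<and> norm_L2 f = 1 \<and>
        (\<forall>\<xi>. fourier f \<xi> \<noteq> 0 \<longrightarrow> R / 2 \<le> norm \<xi> \<and> norm \<xi> \<le> 3 * real CARD('n) * R) \<and>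
        ennreal (c * sqrt (sqrt R) * real (card P) * sqrt (real Q / real X) ^ (CARD('n) - 1))
          \<le> norm_L1_on (ball 0 1) (maximal_function (power_symbol k) f)"
    if Q: "Y \<le> real Q" and X: "Y * real Q \<le> real X" and P: "finite P"
      and Pq: "\<forall>q\<in>P. prime q \<and> Q \<le> q \<and> real q \<le> \<Lambda> * real Q"
      and sparse: "real (card P) * (real Q / real X) ^ (CARD('n) - 1) \<le> \<kappa>"
      and R: "R = (real X ^ k / real Q)\<^sup>2"
    for Q X :: nat and P :: "nat set" and R :: real
  proof -
    define D where "D = real X ^ k / real Q"
    define L where "L = R / real X"
    \<comment> \<open>The numbers of periods of the phase in time (\<open>J\<close>) and in space (\<open>J'\<close>) that fit into the admissible ranges.\<close>
    define J where "J = nat \<lfloor>\<tau> * L ^ k / (2 * pi * R ^ (k - 1))\<rfloor>"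
    define J' where "J' = nat \<lfloor>L / (32 * pi * N)\<rfloor>"
    define \<alpha> where "\<alpha> = 2 * pi * real k * R ^ (k - 1) / L ^ k"
    define \<beta> where "\<beta> = 2 * pi / L"
    define r1 where "r1 = \<delta> / sqrt R"
    define r2 where "r2 = \<delta> / R"
    have Q4: "real Q \<ge> 4" using Q Ybig by linarith
    have Q0: "real Q > 0" using Q4 by simp
    have YQ: "real Q \<le> real X" "Y \<le> real X" "\<Lambda> * real Q \<le> real X"
    proof -
      have "1 * real Q \<le> Y * real Q" "Y * 1 \<le> Y * real Q" "\<Lambda> * real Q \<le> Y * real Q"
        using Ybig Q4 by (intro mult_right_mono mult_left_mono; simp)+
      then show "real Q \<le> real X" "Y \<le> real X" "\<Lambda> * real Q \<le> real X" using X by linarith+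
    qed
    have X4: "real X \<ge> 4" using YQ Q4 by linarith
    have X0: "real X > 0" using X4 by simp
    have X1: "X \<ge> 1" using X4 by linarith
    have XQ: "Y \<le> real X / real Q" using X Q0 by (simp add: field_simps)
    have Xk: "(real X)\<^sup>2 \<le> real X ^ k" using X4 k by (intro power_increasing) auto
    have XkQ2: "Y \<le> real X ^ k / (real Q)\<^sup>2"
    proof -
      have "Y * 1 \<le> (real X / real Q) * (real X / real Q)" using XQ Ybig by (intro mult_mono) auto
      also have "\<dots> = (real X)\<^sup>2 / (real Q)\<^sup>2" by (simp add: power2_eq_square)
      also have "\<dots> \<le> real X ^ k / (real Q)\<^sup>2" using Xk by (intro divide_right_mono) auto
      finally show ?thesis by simp
    qed
    have DX: "real X * Y \<le> D"
    proof -
      have "real X * Y \<le> real X * (real X / real Q)" using XQ X0 by (intro mult_left_mono) auto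
      also have "\<dots> = (real X)\<^sup>2 / real Q" by (simp add: power2_eq_square)
      also have "\<dots> \<le> D" unfolding D_def using Xk Q0 by (intro divide_right_mono) auto
      finally show ?thesis .
    qed
    have "1 * Y \<le> real X * Y" using X4 Ybig by (intro mult_right_mono) auto
    then have DY: "D \<ge> Y" using DX by linarith
    have D0: "D > 0" using DY Ybig by linarith
    have RD: "R = D\<^sup>2" by (simp add: R D_def)
    have sR: "sqrt R = D" using D0 by (simp add: RD)
    have R0: "R > 0" using D0 by (simp add: RD)
    have LX: "L * real X = R" using X0 by (simp add: L_def)
    have LY: "L \<ge> Y"
    proof -
      have "Y * real X \<le> D * 1" using DX by (simp add: mult.commute)
      also have "D * 1 \<le> D * D" using DY Ybig D0 by (intro mult_left_mono) auto
      finally have "Y * real X \<le> R" by (simp add: RD power2_eq_square)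
      then show ?thesis using X0 by (simp add: L_def field_simps)
    qed
    have L0: "L > 0" using LY Ybig by linarith
    have LR: "L \<le> R"
    proof -
      have "L * 1 \<le> L * real X" using X4 L0 by (intro mult_left_mono) auto
      then show ?thesis using LX by simp
    qed
    have R4: "R \<ge> 4" using LR LY Ybig by linarith
    have LkR: "L ^ k / R ^ (k - 1) = R / real X ^ k"
    proof -
      have "L ^ k * real X ^ k = R * R ^ (k - 1)"
        using LX k by (simp flip: power_mult_distrib power_Suc)
      then show ?thesis using X0 R0 by (simp add: field_simps)
    qed
    have RXk: "R / real X ^ k = D / real Q" using X0 Q0 by (simp add: RD D_def power2_eq_square)
    have DQ: "D / real Q \<ge> Y" using XkQ2 by (simp add: D_def power2_eq_square)
    have Jarg: "\<tau> * L ^ k / (2 * pi * R ^ (k - 1)) = \<tau> / (2 * pi) * (D / real Q)"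
      unfolding RXk[symmetric] LkR[symmetric] by simp
    have Jarg1: "1 \<le> \<tau> / (2 * pi) * (D / real Q)"
    proof -
      have "\<tau> / (2 * pi) * (2 * pi / \<tau>) \<le> \<tau> / (2 * pi) * (D / real Q)"
        using tau0 DQ Ybig by (intro mult_left_mono) auto
      then show ?thesis using tau0 by simp
    qed
    have Jlow: "\<tau> / (4 * pi) * (D / real Q) \<le> real J" and Jup: "real J \<le> \<tau> / (2 * pi) * (D / real Q)"
      using half_le_floor[OF Jarg1] Jarg1 unfolding J_def Jarg by (simp_all add: field_simps)
    have J'arg1: "1 \<le> L / (32 * pi * N)" using LY Ybig N2 by (simp add: field_simps)
    have J'low: "L / (64 * pi * N) \<le> real J'" and J'up: "real J' \<le> L / (32 * pi * N)"
      using half_le_floor[OF J'arg1] J'arg1 unfolding J'_def by (simp_all add: field_simps)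
    have alphaQ: "\<alpha> = 2 * pi * real k * (real Q / D)"
    proof -
      have "\<alpha> = 2 * pi * real k * (1 / (L ^ k / R ^ (k - 1)))" by (simp add: \<alpha>_def)
      also have "\<dots> = 2 * pi * real k * (real Q / D)" unfolding LkR RXk by simp
      finally show ?thesis .
    qed
    have alpha0: "\<alpha> > 0" using Q0 D0 k2 by (simp add: alphaQ)
    have beta0: "\<beta> > 0" using L0 by (simp add: \<beta>_def)
    have alphaJ: "\<alpha> * real J \<le> 1 / (16 * N)"
    proof -
      have "\<alpha> * real J \<le> \<alpha> * (\<tau> / (2 * pi) * (D / real Q))" using Jup alpha0 by (intro mult_left_mono) auto
      also have "\<dots> = \<tau> * real k" using Q0 D0 by (simp add: alphaQ)
      finally show ?thesis using tauk by linarith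
    qed
    have betaJ: "\<beta> * real J' \<le> 1 / (16 * N)"
    proof -
      have "\<beta> * real J' \<le> \<beta> * (L / (32 * pi * N))" using J'up beta0 by (intro mult_left_mono) auto
      also have "\<dots> = 1 / (16 * N)" using L0 by (simp add: \<beta>_def)
      finally show ?thesis .
    qed
    have rho1: "r1 > 0" "r1 \<le> 1 / (16 * N)" and rho2: "r2 > 0" "r2 \<le> 1 / (16 * N)"
    proof -
      have "1 * N \<le> 32 * pi * N" using N2 pi_gt3 by (intro mult_right_mono) auto
      then have nY: "N \<le> Y" using Ybig(5) by linarith
      have NR: "N \<le> R" using nY LY LR by linarith
      show "r1 > 0" "r2 > 0" using d0 R0 by (auto simp: r1_def r2_def)
      have "r1 \<le> (1 / 16) / N" unfolding r1_def sR using d16 d0 nY DY N2 by (intro frac_le) auto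
      then show "r1 \<le> 1 / (16 * N)" by simp
      have "r2 \<le> (1 / 16) / N" unfolding r2_def using d16 d0 NR N2 by (intro frac_le) auto
      then show "r2 \<le> 1 / (16 * N)" by simp
    qed
    have qfacts: "prime q" "k < q" "4 / p \<le> real q" "q \<le> X" "real Q \<le> real q" "real q \<le> \<Lambda> * real Q" "real q > 0" if "q \<in> P" for q
    proof -
      show "prime q" "real q \<le> \<Lambda> * real Q" using Pq that by auto
      show Qq: "real Q \<le> real q" using Pq that by simp
      have "real k < real q" using Qq Q Ybig by linarith
      then show "k < q" by simp
      show "4 / p \<le> real q" using Qq Q Ybig by linarith
      have "real q \<le> real X" using Pq that YQ by fastforce
      then show "q \<le> X" by simp
      show "real q > 0" using Qq Q0 by linarith
    qed
    have "\<forall>q\<in>P. \<exists>G \<B>. G \<subseteq> {1..q * J} \<and> p / 4 * real (q * J) \<le> real (card G) \<and>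
      (\<forall>A\<in>G. \<B> A \<subseteq> {1..q * J'} \<and> p / 4 * real (q * J') \<le> real (card (\<B> A)) \<and>
        (\<forall>B\<in>\<B> A. \<not> q dvd B \<and> large_weyl_pair k q X T A B))"
    proof
      fix q assume q: "q \<in> P"
      have "0 < L / (64 * pi * N)" using L0 N2 by simp
      then have "real J' > 0" using J'low by linarith
      then have pos: "q * J' > 0" using qfacts(7)[OF q] by simp
      obtain G \<B> where "G \<subseteq> {1..q * J}" "p / 4 * real (q * J) \<le> real (card G)"
        "\<And>A. A \<in> G \<Longrightarrow> \<B> A \<subseteq> {1..q * J'}" "\<And>A. A \<in> G \<Longrightarrow> p / 4 * real (q * J') \<le> real (card (\<B> A))"
        "\<And>A B. A \<in> G \<Longrightarrow> B \<in> \<B> A \<Longrightarrow> \<not> q dvd B \<and>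
           large_weyl_pair k q X T A B"
        unfolding T_def p_def
        by (rule many_large_weyl_sums[of q k X "q * J" "q * J'"])
           (use qfacts[OF q] k pos in \<open>auto simp: p_def\<close>)
      then show "\<exists>G \<B>. G \<subseteq> {1..q * J} \<and> p / 4 * real (q * J) \<le> real (card G) \<and>
      (\<forall>A\<in>G. \<B> A \<subseteq> {1..q * J'} \<and> p / 4 * real (q * J') \<le> real (card (\<B> A)) \<and>
        (\<forall>B\<in>\<B> A. \<not> q dvd B \<and> large_weyl_pair k q X T A B))" by blast
    qed
    then obtain G \<B> where all: "\<forall>q\<in>P. G q \<subseteq> {1..q * J} \<and> p / 4 * real (q * J) \<le> real (card (G q)) \<and>
      (\<forall>A\<in>G q. \<B> q A \<subseteq> {1..q * J'} \<and> p / 4 * real (q * J') \<le> real (card (\<B> q A)) \<and>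
        (\<forall>B\<in>\<B> q A. \<not> q dvd B \<and> large_weyl_pair k q X T A B))"
      unfolding bchoice_iff by (elim exE) (rule that)
    have GB: "\<And>q. q \<in> P \<Longrightarrow> G q \<subseteq> {1..q * J}"
      "\<And>q. q \<in> P \<Longrightarrow> p / 4 * real (q * J) \<le> real (card (G q))"
      "\<And>q A. q \<in> P \<Longrightarrow> A \<in> G q \<Longrightarrow> \<B> q A \<subseteq> {1..q * J'}"
      "\<And>q A. q \<in> P \<Longrightarrow> A \<in> G q \<Longrightarrow> p / 4 * real (q * J') \<le> real (card (\<B> q A))"
      "\<And>q A B. q \<in> P \<Longrightarrow> A \<in> G q \<Longrightarrow> B \<in> \<B> q A \<Longrightarrow> \<not> q dvd B"
      "\<And>q A B. q \<in> P \<Longrightarrow> A \<in> G q \<Longrightarrow> B \<in> \<B> q A \<Longrightarrow> large_weyl_pair k q X T A B"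
      using all by blast+
    obtain i0 :: 'n where True by simp
    define \<Omega> where "\<Omega> = (\<Union>q\<in>P. \<Union>A\<in>G q. focus_box i0 \<alpha> r1 \<beta> r2 q A (\<B> q A))"
    define g where "g = p / 4 * (real Q * real J)"
    define b where "b = p / 4 * (real Q * real J')"
    define a where "a = g * (2 * r1) * (b * (2 * r2)) ^ d"
    have a_low: "c1 * (real Q / real X) ^ d \<le> a"
    proof -
      have "p / 4 * (\<tau> * \<delta> / (2 * pi)) = p / 4 * (real Q * (\<tau> / (4 * pi) * (D / real Q))) * (2 * r1)"
        using Q0 D0 by (simp add: r1_def sR)
      also have "\<dots> \<le> g * (2 * r1)" unfolding g_def
        using Jlow p0 Q0 rho1 by (intro mult_right_mono mult_left_mono) auto
      finally have 1: "p / 4 * (\<tau> * \<delta> / (2 * pi)) \<le> g * (2 * r1)" .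
      have "p * \<delta> / (128 * pi * N) * (real Q / real X) = p / 4 * (real Q * (L / (64 * pi * N))) * (2 * r2)"
        unfolding r2_def LX[symmetric] using L0 X0 by (simp add: mult_ac)
      also have "\<dots> \<le> b * (2 * r2)" unfolding b_def
        using J'low p0 Q0 rho2 by (intro mult_right_mono mult_left_mono) auto
      finally have 2: "p * \<delta> / (128 * pi * N) * (real Q / real X) \<le> b * (2 * r2)" .
      have "c1 * (real Q / real X) ^ d = p / 4 * (\<tau> * \<delta> / (2 * pi)) * (p * \<delta> / (128 * pi * N) * (real Q / real X)) ^ d"
        unfolding c1_def power_mult_distrib by (simp only: mult.assoc)
      also have "\<dots> \<le> a" unfolding a_def
      proof (rule mult_mono[OF 1 power_mono[OF 2]])
        show "0 \<le> p * \<delta> / (128 * pi * N) * (real Q / real X)" using p0 d0 N2 by simp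
        then show "0 \<le> (p * \<delta> / (128 * pi * N) * (real Q / real X)) ^ d" by (rule zero_le_power)
        show "0 \<le> g * (2 * r1)" using p0 rho1 by (simp add: g_def)
      qed
      finally show ?thesis .
    qed
    have meas: "\<Omega> \<in> fmeasurable lborel" "real (card P) * a / 2 \<le> measure lborel \<Omega>"
    proof -
      have sep1: "2 * r1 < \<alpha> / real q" if "q \<in> P" for q
      proof -
        have "2 * r1 * real q \<le> 2 * r1 * (\<Lambda> * real Q)" using qfacts[OF that] rho1 by (intro mult_left_mono) auto
        also have "\<dots> = 2 * (\<delta> * \<Lambda>) * (real Q / D)" by (simp add: r1_def sR)
        also have "\<dots> < 2 * pi * real k * (real Q / D)"
        proof (rule mult_strict_right_mono)
          have "2 * (\<delta> * \<Lambda>) < 2 * pi * 1" using dLam pi_gt3 by simp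
          also have "\<dots> \<le> 2 * pi * real k" using k2 by (intro mult_left_mono) auto
          finally show "2 * (\<delta> * \<Lambda>) < 2 * pi * real k" .
        qed (use Q0 D0 in simp)
        finally show ?thesis unfolding alphaQ pos_less_divide_eq[OF qfacts(7)[OF that]] .
      qed
      have sep2: "2 * r2 < \<beta> / real q" if "q \<in> P" for q
      proof -
        have "2 * r2 * real q \<le> 2 * r2 * real X" using qfacts(4)[OF that] rho2 by (intro mult_left_mono) auto
        also have "\<dots> = 2 * \<delta> / L" unfolding r2_def LX[symmetric] using X0 by simp
        also have "\<dots> < \<beta>" unfolding \<beta>_def using d16 pi_gt3 L0 by (intro divide_strict_right_mono) auto
        finally show ?thesis unfolding pos_less_divide_eq[OF qfacts(7)[OF that]] .
      qed
      have e: "8 * r2\<^sup>2 * (\<Lambda> * real Q)\<^sup>2 * real J' / \<beta> \<le> c2 * (real Q / real X)\<^sup>2"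
      proof -
        have "8 * r2\<^sup>2 * (\<Lambda> * real Q)\<^sup>2 * real J' / \<beta> \<le> 8 * r2\<^sup>2 * (\<Lambda> * real Q)\<^sup>2 * (L / (32 * pi * N)) / \<beta>"
          using J'up beta0 by (intro divide_right_mono mult_left_mono) auto
        also have "\<dots> = c2 * (real Q / real X)\<^sup>2"
          unfolding r2_def \<beta>_def c2_def LX[symmetric] using L0 X0
          by (simp add: power_mult_distrib power_divide power2_eq_square mult_ac)
        finally show ?thesis .
      qed
      have sp: "real (card P) * (2 * (8 * r2\<^sup>2 * (\<Lambda> * real Q)\<^sup>2 * real J' / \<beta>) ^ d) \<le> a / 2"
      proof -
        have "real (card P) * (2 * (8 * r2\<^sup>2 * (\<Lambda> * real Q)\<^sup>2 * real J' / \<beta>) ^ d)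
          \<le> real (card P) * (2 * (c2 * (real Q / real X)\<^sup>2) ^ d)"
          using e beta0 by (intro mult_left_mono power_mono) auto
        also have "\<dots> = (real (card P) * (real Q / real X) ^ d) * (2 * c2 ^ d * (real Q / real X) ^ d)"
          by (simp only: power2_eq_square power_mult_distrib mult_ac)
        also have "\<dots> \<le> \<kappa> * (2 * c2 ^ d * (real Q / real X) ^ d)"
          using sparse c2 unfolding d_def by (intro mult_right_mono) auto
        also have "\<dots> = c1 * (real Q / real X) ^ d / 2" using c2 by (simp add: \<kappa>_def)
        also have "\<dots> \<le> a / 2" using a_low by simp
        finally show ?thesis .
      qed
      have G2: "g \<le> real (card (G q))" if "q \<in> P" for q
      proof -
        have "g \<le> p / 4 * (real q * real J)" unfolding g_def
          using qfacts(5)[OF that] p0 by (intro mult_left_mono mult_right_mono) auto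
        then show ?thesis using GB(2)[OF that] by simp
      qed
      have B2: "b \<le> real (card (\<B> q A))" if "q \<in> P" "A \<in> G q" for q A
      proof -
        have "b \<le> p / 4 * (real q * real J')" unfolding b_def
          using qfacts(5)[OF that(1)] p0 by (intro mult_left_mono mult_right_mono) auto
        then show ?thesis using GB(4)[OF that] by simp
      qed
      have B1: "\<B> q A \<subseteq> {B \<in> {1..q * J'}. \<not> q dvd B}" if "q \<in> P" "A \<in> G q" for q A
        using GB(3)[OF that] GB(5)[OF that] by blast
      have g0: "g \<ge> 0" "b \<ge> 0" using p0 by (auto simp: g_def b_def)
      have N16: "1 / (16 * N) + 1 / (16 * N) \<le> 1" using N2 by (simp add: field_simps)
      have in1: "\<alpha> * real J + r1 \<le> 1" using alphaJ rho1 N16 by linarith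
      show "\<Omega> \<in> fmeasurable lborel" unfolding \<Omega>_def
        by (rule measure_focus_boxes_ge(1)[where Z = "\<Lambda> * real Q" and g = g and b = b and J = J and J' = J'])
           (use P qfacts GB(1) G2 B1 B2 sep1 sep2 rho1 rho2 alpha0 beta0 g0 in1 sp in \<open>auto simp: a_def d_def\<close>)
      have "real (card P) * (g * (2 * r1) * (b * (2 * r2)) ^ (CARD('n) - 1)) / 2 \<le> measure lborel \<Omega>" unfolding \<Omega>_def
        by (rule measure_focus_boxes_ge(2)[where Z = "\<Lambda> * real Q" and g = g and b = b and J = J and J' = J'])
           (use P qfacts GB(1) G2 B1 B2 sep1 sep2 rho1 rho2 alpha0 beta0 g0 in1 sp in \<open>auto simp: a_def d_def\<close>)
      then show "real (card P) * a / 2 \<le> measure lborel \<Omega>" by (simp add: a_def d_def)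
    qed
    have L2: "L \<ge> 2" using LY Ybig by linarith
    obtain f :: "real^'n \<Rightarrow> complex" where f: "square_integrable f" "norm_L2 f = 1"
      "\<And>\<xi>. fourier f \<xi> \<noteq> 0 \<Longrightarrow> R / 2 \<le> norm \<xi> \<and> norm \<xi> \<le> 3 * real CARD('n) * R"
      "\<And>t x q A. q > 0 \<Longrightarrow> t = 2 * pi * real A / (real q * L ^ k) \<Longrightarrow>
       t * R ^ (k - 1) * ((real k)\<^sup>2 * 3 ^ k) \<le> \<delta> \<Longrightarrow>
       \<bar>x $ i0 + real k * R ^ (k - 1) * t\<bar> \<le> \<delta> / sqrt R \<Longrightarrow>
       (\<And>i. i \<noteq> i0 \<Longrightarrow> \<bar>x $ i\<bar> \<le> 1 / 8 \<and>
          (\<exists>B. \<bar>x $ i - 2 * pi * real B / (real q * L)\<bar> * R \<le> \<delta> \<and> large_weyl_pair k q X T A B)) \<Longrightarrow>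
       fejer_mass / (4 * pi) / sqrt (fejer_energy / sqrt R) *
         (fejer_mass / (16 * pi * sqrt (real q)) * real X / sqrt (real X * fejer_energy)) ^ (CARD('n) - 1)
       \<le> norm (propagator (power_symbol k) t f x)"
      using focusing_packet[of k L X \<delta> T i0, unfolded LX] k L2 X1 R4 d0 d16 dT1 by blast
    \<comment> \<open>A lower bound for the focused packet that is uniform in \<open>q\<close>.\<close>
    define V where "V = c4 * sqrt (sqrt R) * sqrt (real X / real Q) ^ d"
    have V0: "V \<ge> 0" using c4 R0 by (simp add: V_def)
    have Vle: "V \<le> fejer_mass / (4 * pi) / sqrt (fejer_energy / sqrt R) *
         (fejer_mass / (16 * pi * sqrt (real q)) * real X / sqrt (real X * fejer_energy)) ^ (CARD('n) - 1)" (is "_ \<le> ?rhs")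
      if q: "q \<in> P" for q
    proof -
      have "fejer_mass / (16 * pi * sqrt (\<Lambda> * fejer_energy)) * sqrt (real X / real Q)
        = fejer_mass / (16 * pi * sqrt (\<Lambda> * real Q)) * real X / sqrt (real X * fejer_energy)"
      proof -
        have "u / (16 * pi * (l * e)) * (s / r) = u / (16 * pi * (l * r)) * (s * s) / (s * e)"
          if "s > 0" for u l e s r :: real using that by simp
        from this[of "sqrt (real X)" fejer_mass "sqrt \<Lambda>" "sqrt fejer_energy" "sqrt (real Q)"]
        show ?thesis using X0 by (simp only: real_sqrt_mult real_sqrt_divide real_sqrt_gt_0_iff) simp
      qed
      also have "\<dots> \<le> fejer_mass / (16 * pi * sqrt (real q)) * real X / sqrt (real X * fejer_energy)"
        using qfacts[OF q] fejer_mass_pos fejer_energy_pos X0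
        by (intro divide_right_mono mult_right_mono divide_left_mono mult_left_mono mult_pos_pos) auto
      finally have 1: "fejer_mass / (16 * pi * sqrt (\<Lambda> * fejer_energy)) * sqrt (real X / real Q)
        \<le> fejer_mass / (16 * pi * sqrt (real q)) * real X / sqrt (real X * fejer_energy)" .
      have "V = fejer_mass / (4 * pi) / sqrt (fejer_energy / sqrt R) *
         (fejer_mass / (16 * pi * sqrt (\<Lambda> * fejer_energy)) * sqrt (real X / real Q)) ^ d"
        unfolding V_def c4_def power_mult_distrib by (simp add: real_sqrt_divide)
      also have "\<dots> \<le> ?rhs" unfolding d_def
        using 1 fejer_mass_pos fejer_energy_pos Lam R0
        by (intro mult_left_mono power_mono) (auto intro!: divide_nonneg_nonneg mult_nonneg_nonneg)
      finally show ?thesis .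
    qed
    have pt: "norm x < 1 \<and> (\<exists>t. 0 < t \<and> t < 1 \<and> V \<le> norm (propagator (power_symbol k) t f x))" if x: "x \<in> \<Omega>" for x
    proof -
      obtain q A where q: "q \<in> P" and A: "A \<in> G q" and box: "x \<in> focus_box i0 \<alpha> r1 \<beta> r2 q A (\<B> q A)"
        using x by (auto simp: \<Omega>_def)
      have q0: "real q > 0" by (rule qfacts(7)[OF q])
      have le: "\<gamma> * real C / real q \<le> \<gamma> * real j" if "C \<le> q * j" "\<gamma> > 0" for C j and \<gamma> :: real
      proof -
        have "real C \<le> real q * real j" using that(1) by (metis of_nat_le_iff of_nat_mult)
        then have "\<gamma> * real C \<le> \<gamma> * (real q * real j)" using that(2) by (intro mult_left_mono) auto
        then show ?thesis using q0 by (simp add: field_simps)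
      qed
      have AJ: "1 \<le> A" "A \<le> q * J" using GB(1)[OF q] A by auto
      define t where "t = 2 * pi * real A / (real q * L ^ k)"
      have talpha: "real k * R ^ (k - 1) * t = \<alpha> * real A / real q" by (simp add: t_def \<alpha>_def mult_ac)
      have t0: "t > 0" using AJ q0 L0 by (simp add: t_def)
      have tR: "t * R ^ (k - 1) \<le> \<tau>"
      proof -
        have "t * R ^ (k - 1) = (2 * pi * (R ^ (k - 1) / L ^ k)) * real A / real q" by (simp add: t_def mult_ac)
        also have "\<dots> \<le> (2 * pi * (R ^ (k - 1) / L ^ k)) * real J"
          by (rule le[OF AJ(2)]) (use R0 L0 in simp)
        also have "R ^ (k - 1) / L ^ k = real Q / D"
        proof -
          have "R ^ (k - 1) / L ^ k = 1 / (L ^ k / R ^ (k - 1))" by simp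
          also have "\<dots> = real Q / D" unfolding LkR RXk by simp
          finally show ?thesis .
        qed
        also have "2 * pi * (real Q / D) * real J \<le> 2 * pi * (real Q / D) * (\<tau> / (2 * pi) * (D / real Q))"
          using Jup D0 by (intro mult_left_mono) auto
        also have "\<dots> = \<tau>" using Q0 D0 by simp
        finally show ?thesis .
      qed
      have t1: "t < 1"
      proof -
        have "t * 1 \<le> t * R ^ (k - 1)" using t0 R4 by (intro mult_left_mono) auto
        then show ?thesis using tR tau1 by linarith
      qed
      have tK: "t * R ^ (k - 1) * ((real k)\<^sup>2 * 3 ^ k) \<le> \<delta>"
      proof -
        have "t * R ^ (k - 1) * ((real k)\<^sup>2 * 3 ^ k) \<le> \<tau> * ((real k)\<^sup>2 * 3 ^ k)"
          using tR by (intro mult_right_mono) auto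
        also have "\<dots> = \<delta> / (16 * N)" by (rule tauK)
        also have "\<dots> \<le> \<delta> / 1" using d0 N2 by (intro divide_left_mono) auto
        finally show ?thesis by simp
      qed
      have xi0: "\<bar>x $ i0 + \<alpha> * real A / real q\<bar> \<le> r1"
        using box by (auto simp: focus_box_def abs_le_iff dest!: spec[of _ i0])
      have aq: "0 \<le> \<alpha> * real A / real q" "\<alpha> * real A / real q \<le> \<alpha> * real J"
        using alpha0 le[OF AJ(2) alpha0] by auto
      have xi: "\<exists>B. B \<in> \<B> q A \<and> \<bar>x $ i - \<beta> * real B / real q\<bar> \<le> r2" if "i \<noteq> i0" for i
      proof -
        have "x $ i \<in> comb \<beta> q r2 (\<B> q A)" using box that by (auto simp: focus_box_def dest!: spec[of _ i])
        then show ?thesis by (force simp: comb_def abs_le_iff)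
      qed
      have small: "\<bar>x $ i\<bar> \<le> 1 / (8 * N)" for i
      proof (cases "i = i0")
        case True
        then show ?thesis using xi0 aq alphaJ rho1 by (simp add: abs_le_iff)
      next
        case False
        then obtain B where B: "B \<in> \<B> q A" "\<bar>x $ i - \<beta> * real B / real q\<bar> \<le> r2" using xi by blast
        have "B \<le> q * J'" using GB(3)[OF q A] B by auto
        then have "\<beta> * real B / real q \<le> \<beta> * real J'" by (rule le[OF _ beta0])
        moreover have "0 \<le> \<beta> * real B / real q" using beta0 by simp
        ultimately show ?thesis using B(2) betaJ rho2 by (simp add: abs_le_iff)
      qed
      have "norm x \<le> (\<Sum>i\<in>UNIV. \<bar>x $ i\<bar>)" by (rule norm_le_l1_cart)
      also have "\<dots> \<le> (\<Sum>i\<in>(UNIV::'n set). 1 / (8 * N))" by (intro sum_mono small)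
      also have "\<dots> = 1 / 8" using N2 by (simp add: N_def)
      finally have nx: "norm x < 1" by simp
      have "fejer_mass / (4 * pi) / sqrt (fejer_energy / sqrt R) *
         (fejer_mass / (16 * pi * sqrt (real q)) * real X / sqrt (real X * fejer_energy)) ^ (CARD('n) - 1)
         \<le> norm (propagator (power_symbol k) t f x)"
      proof (rule f(4)[OF _ t_def tK])
        show "q > 0" using q0 by simp
        show "\<bar>x $ i0 + real k * R ^ (k - 1) * t\<bar> \<le> \<delta> / sqrt R"
          using xi0 unfolding talpha r1_def .
        fix i assume i: "i \<noteq> i0"
        obtain B where B: "B \<in> \<B> q A" "\<bar>x $ i - \<beta> * real B / real q\<bar> \<le> r2" using xi[OF i] by blast
        have "\<beta> * real B / real q = 2 * pi * real B / (real q * L)" by (simp add: \<beta>_def)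
        then have "\<bar>x $ i - 2 * pi * real B / (real q * L)\<bar> * R \<le> r2 * R" using B R0 by (intro mult_right_mono) auto
        also have "r2 * R = \<delta>" using R0 by (simp add: r2_def)
        finally have "\<bar>x $ i - 2 * pi * real B / (real q * L)\<bar> * R \<le> \<delta>" .
        moreover have "\<bar>x $ i\<bar> \<le> 1 / 8"
        proof -
          have "1 / (8 * N) \<le> 1 / 8" using N2 by (intro divide_left_mono) auto
          then show ?thesis using small[of i] by linarith
        qed
        ultimately show "\<bar>x $ i\<bar> \<le> 1 / 8 \<and>
          (\<exists>B. \<bar>x $ i - 2 * pi * real B / (real q * L)\<bar> * R \<le> \<delta> \<and> large_weyl_pair k q X T A B)"
          using GB(6)[OF q A B(1)] by blast
      qed
      with Vle[OF q] have "V \<le> norm (propagator (power_symbol k) t f x)" by linarith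
      then show ?thesis using nx t0 t1 by blast
    qed
    \<comment> \<open>The height contributes \<open>sqrt (X / Q)\<close> and the measure \<open>Q / X\<close> per coordinate.\<close>
    have "c * sqrt (sqrt R) * real (card P) * sqrt (real Q / real X) ^ (CARD('n) - 1) \<le> V * measure lborel \<Omega>"
    proof -
      have "sqrt (real X / real Q) ^ d * (real Q / real X) ^ d = sqrt (real Q / real X) ^ d"
      proof -
        have "sqrt (real X / real Q) * (real Q / real X) = sqrt (real Q / real X)"
        proof -
          have "sqrt (real X / real Q) * sqrt (real Q / real X) = 1" using X0 Q0 by (simp flip: real_sqrt_mult)
          moreover have "real Q / real X = sqrt (real Q / real X) * sqrt (real Q / real X)" by simp
          ultimately show ?thesis by (metis mult.assoc mult_1)
        qed
        then show ?thesis by (simp flip: power_mult_distrib)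
      qed
      then have "c * sqrt (sqrt R) * real (card P) * sqrt (real Q / real X) ^ d
        = V * (real (card P) * (c1 * (real Q / real X) ^ d) / 2)"
        by (simp add: c_def V_def mult_ac)
      also have "\<dots> \<le> V * (real (card P) * a / 2)" using a_low V0 by (intro mult_left_mono divide_right_mono) auto
      also have "\<dots> \<le> V * measure lborel \<Omega>" using meas(2) V0 by (intro mult_left_mono)
      finally show ?thesis by (simp add: d_def)
    qed
    then have "ennreal (c * sqrt (sqrt R) * real (card P) * sqrt (real Q / real X) ^ (CARD('n) - 1)) \<le> ennreal (V * measure lborel \<Omega>)"
      by (rule ennreal_leI)
    also have "\<dots> \<le> norm_L1_on (ball 0 1) (maximal_function (power_symbol k) f)"
    proof (rule maximal_function_integral_ge)
      show "\<Omega> \<subseteq> ball 0 1" using pt by auto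
    qed (use pt V0 meas(1) in \<open>auto dest: fmeasurableD\<close>)
    finally show ?thesis using f(1-3) by blast
  qed
  show ?thesis
    by (rule exI[of _ c], rule exI[of _ Y], rule exI[of _ \<kappa>])
       (use main c1 c2 c4 Ybig in \<open>auto simp: c_def \<kappa>_def\<close>)
qed

section \<open>Passage to a sequence of scales\<close>

lemma filterlim_power_at_top:
  fixes a :: real
  assumes "a > 1"
  shows "filterlim (\<lambda>i. a ^ i) at_top sequentially"
  unfolding filterlim_at_top eventually_sequentially
proof
  fix Z
  obtain m where "Z < a ^ m" using real_arch_pow[OF assms] by blast
  then have "\<forall>i\<ge>m. Z \<le> a ^ i"
    using assms power_increasing[of m _ a] by (meson less_imp_le order_trans)
  then show "\<exists>m. \<forall>i\<ge>m. Z \<le> a ^ i" by blast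
qed

lemma filterlim_geometric_at_top:
  fixes a b :: real
  assumes "a > 1" "b > 0" "strict_mono r"
  shows "filterlim (\<lambda>i. b * a ^ (r i)) at_top sequentially"
proof (rule filterlim_compose[OF _ filterlim_subseq[OF assms(3)]])
  show "filterlim (\<lambda>i. b * a ^ i) at_top sequentially"
    by (rule filterlim_tendsto_pos_mult_at_top[OF tendsto_const assms(2)])
       (rule filterlim_power_at_top[OF assms(1)])
qed

theorem theorem1p2:
  fixes k :: nat and s :: real
  assumes "CARD('n::finite) \<ge> 2" and "k \<ge> 2"
    and "s < 1 / 4 + (real CARD('n) - 1) / (4 * ((real k - 1) * real CARD('n) + 1))"
  shows "\<exists>(C::real) (R :: nat \<Rightarrow> real) (f :: nat \<Rightarrow> real ^ 'n \<Rightarrow> complex).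
    C > 1 \<and> filterlim R at_top sequentially \<and>
    (\<forall>j. square_integrable (f j) \<and> norm_L2 (f j) = 1 \<and>
       (AE \<xi> in lborel. fourier (f j) \<xi> \<noteq> 0 \<longrightarrow>
          (1 / C) * R j \<le> norm \<xi> \<and> norm \<xi> \<le> C * R j)) \<and>
    (\<lambda>j. ennreal (R j powr (- s)) *
       norm_L1_on (ball 0 1) (maximal_function (power_symbol k) (f j))) \<longlonglongrightarrow> \<infinity>"
proof -
  define n where "n = CARD('n)"
  define d where "d = n - 1"
  \<comment> \<open>\<open>R\<close> is of order \<open>y\<^sup>2\<^sup>e\<close> on the scale \<open>y = 2\<^sup>j\<close>, and \<open>e = (k - 1) n + 1\<close>.\<close>
  define e where "e = n * k - d"
  define M where "M = (2::nat) ^ d"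
  define \<sigma> where "\<sigma> = 1 / 4 + real d / (4 * real e) - s"
  \<comment> \<open>This spends half of the surplus \<open>\<sigma>\<close> in the exponent on the density of the primes.\<close>
  define \<epsilon> where "\<epsilon> = real e * \<sigma> / real d"
  have n2: "n \<ge> 2" using assms(1) by (simp add: n_def)
  have nd: "n = Suc d" using n2 by (simp add: d_def)
  have d1: "d \<ge> 1" using n2 by (simp add: d_def)
  have dnk: "d \<le> n * k" using assms(2) nd mult_le_mono[of d n 1 k] by simp
  have e_real: "real e = (real k - 1) * real n + 1"
  proof -
    have "real e = real n * real k - real d" using dnk by (simp add: e_def of_nat_diff)
    then show ?thesis by (simp add: nd algebra_simps)
  qed
  have e1: "e \<ge> 1"
  proof -
    have "(real k - 1) * real n \<ge> 0" using assms(2) by simp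
    then have "real e \<ge> 1" using e_real by linarith
    then show ?thesis by simp
  qed
  have \<sigma>0: "\<sigma> > 0" using assms(3) unfolding \<sigma>_def e_real by (simp add: d_def n_def)
  have \<epsilon>0: "\<epsilon> > 0" using \<sigma>0 d1 e1 by (simp add: \<epsilon>_def)
  have M2: "M \<ge> 2" unfolding M_def using d1 power_increasing[of 1 d "2::nat"] by simp
  obtain c Y \<kappa> where c: "c > 0" and Y: "Y \<ge> 1" and \<kappa>: "\<kappa> > 0" and
    scale: "\<And>Q X P R. Y \<le> real Q \<Longrightarrow> Y * real Q \<le> real X \<Longrightarrow> finite P \<Longrightarrow>
     (\<forall>q\<in>P. prime q \<and> Q \<le> q \<and> real q \<le> real M * real Q) \<Longrightarrow>
     real (card P) * (real Q / real X) ^ d \<le> \<kappa> \<Longrightarrow>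
     R = (real X ^ k / real Q)\<^sup>2 \<Longrightarrow>
     (\<exists>f :: real^'n \<Rightarrow> complex. square_integrable f \<and> norm_L2 f = 1 \<and>
        (\<forall>\<xi>. fourier f \<xi> \<noteq> 0 \<longrightarrow> R / 2 \<le> norm \<xi> \<and> norm \<xi> \<le> 3 * real n * R) \<and>
        ennreal (c * sqrt (sqrt R) * real (card P) * sqrt (real Q / real X) ^ d)
          \<le> norm_L1_on (ball 0 1) (maximal_function (power_symbol k) f))"
    using single_scale_bound[OF assms(1,2), of "real M"] M2 unfolding d_def n_def by auto
  \<comment> \<open>Large enough for the overlaps to be negligible: the expected multiplicity of the cover is of order \<open>M / H\<^sup>d\<close>.\<close>
  define H where "H = nat \<lceil>max Y (real M / \<kappa>)\<rceil>"
  have HY: "Y \<le> real H" and HM: "real M / \<kappa> \<le> real H"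
    unfolding H_def by linarith+
  have H1: "real H \<ge> 1" using HY Y by linarith
  define P where "P = (\<lambda>j. {p. prime p \<and> M ^ j \<le> p \<and> p < M ^ (j + 1)})"
  define R where "R = (\<lambda>j. (real H ^ k * (2 ^ e) ^ j)\<^sup>2)"
  define \<gamma> where "\<gamma> = real e * \<sigma>"
  define c' where "c' = c * ((real H ^ k)\<^sup>2) powr (1 / 4 - s) * sqrt (1 / real H) ^ d"
  have \<gamma>0: "\<gamma> > 0" using e1 \<sigma>0 by (simp add: \<gamma>_def)
  have c'0: "c' > 0" using c H1 by (simp add: c'_def)
  have key: "\<exists>f :: real^'n \<Rightarrow> complex. square_integrable f \<and> norm_L2 f = 1 \<and>
        (\<forall>\<xi>. fourier f \<xi> \<noteq> 0 \<longrightarrow> R j / 2 \<le> norm \<xi> \<and> norm \<xi> \<le> 3 * real n * R j) \<and>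
        ennreal (c' * (2 powr \<gamma>) ^ j)
          \<le> ennreal (R j powr (- s)) * norm_L1_on (ball 0 1) (maximal_function (power_symbol k) f)"
    if j: "Y \<le> real M ^ j" and many: "(real M ^ j) powr (1 - \<epsilon>) \<le> real (card (P j))" for j
  proof -
    define y where "y = (2::nat) ^ j"
    define X where "X = H * y ^ n"
    have y1: "real y \<ge> 1" by (simp add: y_def)
    have Q: "M ^ j = y ^ d" by (simp add: M_def y_def mult.commute flip: power_mult)
    have QX: "real (M ^ j) / real X = 1 / (real H * real y)"
      unfolding Q X_def using y1 H1 by (simp add: nd)
    have RX: "R j = (real X ^ k / real (M ^ j))\<^sup>2"
    proof -
      have "real X ^ k = real H ^ k * real y ^ (n * k)" by (simp add: X_def power_mult_distrib power_mult)
      also have "real y ^ (n * k) = real y ^ d * real y ^ e"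
        using dnk by (simp add: e_def flip: power_add)
      finally have "real X ^ k / real (M ^ j) = real H ^ k * real y ^ e" unfolding Q using y1 by simp
      also have "real y ^ e = (2 ^ e) ^ j" by (simp add: y_def mult.commute flip: power_mult)
      finally show ?thesis by (simp add: R_def)
    qed
    have R0: "R j > 0" using H1 by (simp add: R_def)
    have finP: "finite (P j)" unfolding P_def by (rule finite_subset[of _ "{..<M ^ (j + 1)}"]) auto
    have "\<exists>f :: real^'n \<Rightarrow> complex. square_integrable f \<and> norm_L2 f = 1 \<and>
        (\<forall>\<xi>. fourier f \<xi> \<noteq> 0 \<longrightarrow> R j / 2 \<le> norm \<xi> \<and> norm \<xi> \<le> 3 * real n * R j) \<and>
        ennreal (c * sqrt (sqrt (R j)) * real (card (P j)) * sqrt (real (M ^ j) / real X) ^ d)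
          \<le> norm_L1_on (ball 0 1) (maximal_function (power_symbol k) f)"
    proof (rule scale[OF _ _ finP _ _ RX])
      show "Y \<le> real (M ^ j)" using j by simp
      have "Y * real (M ^ j) \<le> (real H * real y) * real (M ^ j)"
        using HY y1 Y H1 mult_mono[of Y "real H" 1 "real y"] by (intro mult_right_mono) auto
      also have "\<dots> = real X" by (simp add: Q X_def nd)
      finally show "Y * real (M ^ j) \<le> real X" .
      show "\<forall>q\<in>P j. prime q \<and> M ^ j \<le> q \<and> real q \<le> real M * real (M ^ j)"
      proof
        fix q assume q: "q \<in> P j"
        then have "q \<le> M * M ^ j" by (simp add: P_def)
        then have "real q \<le> real (M * M ^ j)" by (rule of_nat_mono)
        then show "prime q \<and> M ^ j \<le> q \<and> real q \<le> real M * real (M ^ j)" using q by (simp add: P_def)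
      qed
      have "card (P j) \<le> card {..<M * M ^ j}" by (intro card_mono) (auto simp: P_def)
      then have "real (card (P j)) \<le> real (M * M ^ j)" by (simp only: card_lessThan of_nat_mono)
      then have "real (card (P j)) * (real (M ^ j) / real X) ^ d \<le> real (M * M ^ j) * (1 / (real H * real y)) ^ d"
        unfolding QX by (intro mult_right_mono) auto
      also have "\<dots> = real M * (1 / real H) ^ d"
        unfolding of_nat_mult Q using y1 by (simp add: power_mult_distrib power_divide)
      also have "\<dots> \<le> real M * (1 / real H) ^ 1"
        using H1 d1 by (intro mult_left_mono power_decreasing) auto
      also have "\<dots> \<le> \<kappa>" using HM \<kappa> H1 by (simp add: field_simps)
      finally show "real (card (P j)) * (real (M ^ j) / real X) ^ d \<le> \<kappa>" .
    qed
    then obtain f :: "real^'n \<Rightarrow> complex" where f: "square_integrable f" "norm_L2 f = 1"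
      "\<forall>\<xi>. fourier f \<xi> \<noteq> 0 \<longrightarrow> R j / 2 \<le> norm \<xi> \<and> norm \<xi> \<le> 3 * real n * R j"
      and low: "ennreal (c * sqrt (sqrt (R j)) * real (card (P j)) * sqrt (real (M ^ j) / real X) ^ d)
          \<le> norm_L1_on (ball 0 1) (maximal_function (power_symbol k) f)" by blast
    have "c' * (2 powr \<gamma>) ^ j \<le> R j powr (- s) * (c * sqrt (sqrt (R j)) * real (card (P j)) * sqrt (real (M ^ j) / real X) ^ d)"
    proof -
      have b: "(2 powr a) ^ j = real y powr a" for a :: real
        by (simp add: y_def powr_powr powr_realpow[symmetric] mult.commute)
      have sq: "sqrt (sqrt (R j)) = R j powr (1 / 4)"
        using R0 by (simp add: powr_half_sqrt[symmetric] powr_powr)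
      have "R j = (real H ^ k)\<^sup>2 * real y powr (2 * real e)"
      proof -
        have "((2::real) ^ e) ^ j = real y powr real e"
          using b[of "real e"] by (simp add: powr_realpow)
        moreover have "(real y powr real e)\<^sup>2 = real y powr (2 * real e)"
          by (simp add: power2_eq_square flip: powr_add)
        ultimately show ?thesis by (simp add: R_def power_mult_distrib)
      qed
      then have Rp: "R j powr (1 / 4 - s) = ((real H ^ k)\<^sup>2) powr (1 / 4 - s) * real y powr (2 * real e * (1 / 4 - s))"
        by (simp add: powr_mult powr_powr)
      have cP: "real y powr (real d * (1 - \<epsilon>)) \<le> real (card (P j))"
      proof -
        have "real M ^ j = real (M ^ j)" by simp
        also have "\<dots> = real y powr real d" unfolding Q using y1 by (simp add: powr_realpow)
        finally show ?thesis using many by (simp add: powr_powr)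
      qed
      have sX: "sqrt (real (M ^ j) / real X) ^ d = sqrt (1 / real H) ^ d * real y powr (- (real d / 2))"
      proof -
        have "sqrt (real (M ^ j) / real X) = sqrt (1 / real H) * (1 / sqrt (real y))"
          unfolding QX by (simp add: real_sqrt_divide real_sqrt_mult)
        moreover have "(1 / sqrt (real y)) ^ d = real y powr (- (real d / 2))"
        proof -
          have "1 / sqrt (real y) = real y powr (- (1 / 2))" using y1 by (simp add: powr_minus_divide powr_half_sqrt)
          then show ?thesis using y1 by (simp add: powr_powr flip: powr_realpow)
        qed
        ultimately show ?thesis by (simp only: power_mult_distrib)
      qed
      have ex: "2 * real e * (1 / 4 - s) + real d * (1 - \<epsilon>) + - (real d / 2) = \<gamma>"
      proof -
        have "real d * \<epsilon> = real e * \<sigma>" using d1 by (simp add: \<epsilon>_def)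
        moreover have "real e * \<sigma> = real e / 4 + real d / 4 - real e * s"
          using e1 by (simp add: \<sigma>_def algebra_simps)
        ultimately show ?thesis by (simp add: \<gamma>_def algebra_simps)
      qed
      have yg: "real y powr \<gamma> = real y powr (2 * real e * (1 / 4 - s)) * real y powr (real d * (1 - \<epsilon>)) * real y powr (- (real d / 2))"
        by (simp only: ex[symmetric] powr_add)
      have Rs: "R j powr (1 / 4 - s) = R j powr (- s) * R j powr (1 / 4)" by (simp flip: powr_add)
      have "c' * (2 powr \<gamma>) ^ j = c * R j powr (1 / 4 - s) * real y powr (real d * (1 - \<epsilon>)) * sqrt (real (M ^ j) / real X) ^ d"
        by (simp only: b yg Rp sX c'_def mult_ac)
      also have "\<dots> \<le> c * R j powr (1 / 4 - s) * real (card (P j)) * sqrt (real (M ^ j) / real X) ^ d"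
        using c cP by (intro mult_right_mono mult_left_mono) auto
      also have "\<dots> = R j powr (- s) * (c * sqrt (sqrt (R j)) * real (card (P j)) * sqrt (real (M ^ j) / real X) ^ d)"
        by (simp only: sq Rs mult_ac)
      finally show ?thesis .
    qed
    then have "ennreal (c' * (2 powr \<gamma>) ^ j) \<le> ennreal (R j powr (- s)) *
        ennreal (c * sqrt (sqrt (R j)) * real (card (P j)) * sqrt (real (M ^ j) / real X) ^ d)"
      by (subst ennreal_mult'[symmetric]) (auto intro: ennreal_leI)
    also have "\<dots> \<le> ennreal (R j powr (- s)) * norm_L1_on (ball 0 1) (maximal_function (power_symbol k) f)"
      by (intro mult_left_mono low) auto
    finally show ?thesis using f by blast
  qed
  obtain j0 where j0: "\<And>j. j \<ge> j0 \<Longrightarrow> Y \<le> real M ^ j"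
  proof -
    have "filterlim (\<lambda>j. real M ^ j) at_top sequentially"
      using M2 by (intro filterlim_power_at_top) auto
    then have "\<forall>\<^sub>F j in sequentially. Y \<le> real M ^ j" by (simp add: filterlim_at_top)
    then show thesis using that unfolding eventually_sequentially by blast
  qed
  define S where "S = {j. (real M ^ j) powr (1 - \<epsilon>) \<le> real (card (P j)) \<and> j \<ge> j0}"
  have "infinite S"
  proof -
    have "\<exists>\<^sub>\<infinity>j. (real M ^ j) powr (1 - \<epsilon>) \<le> real (card (P j))"
      unfolding P_def by (rule frequently_many_primes[OF M2 \<epsilon>0])
    then have "\<exists>\<^sub>\<infinity>j. (real M ^ j) powr (1 - \<epsilon>) \<le> real (card (P j)) \<and> j \<ge> j0"
      by (rule INFM_conjI) (auto simp: MOST_nat_le)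
    then show ?thesis by (simp add: S_def INFM_iff_infinite)
  qed
  from infinite_enumerate[OF this] obtain r :: "nat \<Rightarrow> nat"
    where r: "strict_mono r" "\<And>i. r i \<in> S" by auto
  have "\<forall>i. \<exists>f :: real^'n \<Rightarrow> complex. square_integrable f \<and> norm_L2 f = 1 \<and>
        (\<forall>\<xi>. fourier f \<xi> \<noteq> 0 \<longrightarrow> R (r i) / 2 \<le> norm \<xi> \<and> norm \<xi> \<le> 3 * real n * R (r i)) \<and>
        ennreal (c' * (2 powr \<gamma>) ^ (r i))
          \<le> ennreal (R (r i) powr (- s)) * norm_L1_on (ball 0 1) (maximal_function (power_symbol k) f)"
    using key j0 r(2) by (simp add: S_def)
  then obtain f :: "nat \<Rightarrow> real^'n \<Rightarrow> complex" where f: "\<And>i. square_integrable (f i)" "\<And>i. norm_L2 (f i) = 1"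
    "\<And>i \<xi>. fourier (f i) \<xi> \<noteq> 0 \<Longrightarrow> R (r i) / 2 \<le> norm \<xi> \<and> norm \<xi> \<le> 3 * real n * R (r i)"
    "\<And>i. ennreal (c' * (2 powr \<gamma>) ^ (r i))
          \<le> ennreal (R (r i) powr (- s)) * norm_L1_on (ball 0 1) (maximal_function (power_symbol k) (f i))"
    by (metis (no_types, lifting) choice)
  show ?thesis
  proof (intro exI conjI allI)
    show "3 * real n > 1" using n2 by simp
    have "(\<lambda>i. R (r i)) = (\<lambda>i. (real H ^ k)\<^sup>2 * (4 ^ e) ^ (r i))"
    proof
      fix i
      have "(((2::real) ^ e) ^ r i)\<^sup>2 = (4 ^ e) ^ r i"
        by (simp flip: power_mult) (simp add: power_mult mult.commute)
      then show "R (r i) = (real H ^ k)\<^sup>2 * (4 ^ e) ^ (r i)" by (simp add: R_def power_mult_distrib)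
    qed
    moreover have "(4::real) ^ e > 1" using e1 by (intro one_less_power) auto
    ultimately show "filterlim (\<lambda>i. R (r i)) at_top sequentially"
      using filterlim_geometric_at_top[OF _ _ r(1), of "4 ^ e" "(real H ^ k)\<^sup>2"] H1 by simp
    show "square_integrable (f i)" "norm_L2 (f i) = 1" for i using f by auto
    show "AE \<xi> in lborel. fourier (f i) \<xi> \<noteq> 0 \<longrightarrow>
          (1 / (3 * real n)) * R (r i) \<le> norm \<xi> \<and> norm \<xi> \<le> 3 * real n * R (r i)" for i
    proof (intro AE_I2 impI)
      fix \<xi> assume "fourier (f i) \<xi> \<noteq> 0"
      note b = f(3)[OF this]
      have "R (r i) \<ge> 0" by (simp add: R_def)
      then have "(1 / (3 * real n)) * R (r i) \<le> (1 / 2) * R (r i)"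
        using n2 by (intro mult_right_mono) (auto simp: field_simps)
      then show "(1 / (3 * real n)) * R (r i) \<le> norm \<xi> \<and> norm \<xi> \<le> 3 * real n * R (r i)" using b by simp
    qed
    have "filterlim (\<lambda>i. c' * (2 powr \<gamma>) ^ (r i)) at_top sequentially"
      using \<gamma>0 by (intro filterlim_geometric_at_top c'0 r(1)) auto
    then have "(\<lambda>i. ennreal (c' * (2 powr \<gamma>) ^ (r i))) \<longlonglongrightarrow> \<infinity>"
      by (simp add: ennreal_tendsto_top_eq_at_top)
    then show "(\<lambda>i. ennreal (R (r i) powr (- s)) *
        norm_L1_on (ball 0 1) (maximal_function (power_symbol k) (f i))) \<longlonglongrightarrow> \<infinity>"
      by (rule tendsto_sandwich[OF _ _ _ tendsto_const, rotated 2]) (use f(4) in auto)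
  qed
qed

end
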